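(* The ideal generated by the images of the $\vartheta[m]^4$ (that is, by the $35$ elements $D(S)$) in the ring $\mathbb C[Y_1,\dots,Y_{14}]/\mathcal J$ is the intersection of $56$ ideals which are generated by linear forms. One of them is $$(Y_2,Y_3,Y_5,Y_6,Y_8,Y_9,Y_{10},Y_{11},Y_{13},Y_{14}).$$ The others are obtained by applying $S_8$.
   Context: For a $2\times4$ matrix $\begin{pmatrix}i_1&i_2&i_3&i_4\\ j_1&j_2&j_3&j_4\end{pmatrix}$ with entries $1,\dots,8$ (each once), the Specht polynomial is $\prod_{\nu}(X_{i_\nu}-X_{j_\nu})\in\mathbb C[X_1,\dots,X_8]$. The tableau is standard if rows are increasing and $i_\nu<j_\nu$. The $14$ standard tableaux, written $i_1i_2i_3i_4/j_1j_2j_3j_4$, are, in this order: $1234/5678$, $1235/4678$, $1236/4578$, $1237/4568$, $1245/3678$, $1246/3578$, $1247/3568$, $1256/3478$, $1257/3468$, $1345/2678$, $1346/2578$, $1347/2568$, $1356/2478$, $1357/2468$. Their Specht polynomials are denoted $Y_1,\dots,Y_{14}$; $\mathcal J$ is the ideal of all polynomial relations between them, so $\mathbb C[Y_1,\dots,Y_{14}]/\mathcal J$ is identified with the subring of $\mathbb C[X_1,\dots,X_8]$ generated by the $14$ Specht polynomials. $S_8$ acts by permuting the $X_i$; this preserves the span of $Y_1,\dots,Y_{14}$. There are $36$ even theta characteristics $m\in\mathbb F_2^6$ in genus $3$ with thetanullwerte $\vartheta[m]$. Thomae's theorem gives a ring homomorphism from the ring generated by the $\vartheta[m]^4$ (restricted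 to the component of the hyperelliptic locus of level two defined by $\vartheta[0]=0$) to $\mathbb C[Y_1,\dots,Y_{14}]/\mathcal J$, with $\vartheta[0]^4\mapsto0$ and such that the $35$ other even $\vartheta[m]^4$ are mapped bijectively onto the $35$ elements $$D(S)=\frac{\prod_{1\le i<j\le8}(X_i-X_j)}{\prod_{i\in S,\ j\notin S}(X_i-X_j)},$$ one for each partition $\{S,S^c\}$ of $\{1,\dots,8\}$ into two $4$-element subsets. Up to sign $D(S)$ is the product of all differences $X_i-X_j$ with $i<j$ both in $S$ or both in $S^c$; it is a product of three Specht polynomials. *)

theory Defs
  imports Complex_Main
    "HOL-Library.Poly_Mapping"
    "HOL-Combinatorics.Permutations"
    "HOL-Algebra.Ideal"
    "HOL-Algebra.QuotRing"
begin

section \<open>Polynomials in several variables\<close>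

text \<open>A monomial is a finitely supported exponent vector, a polynomial a finitely supported
  family of complex coefficients indexed by monomials; multiplication is convolution.\<close>

type_synonym mpoly = "(nat \<Rightarrow>\<^sub>0 nat) \<Rightarrow>\<^sub>0 complex"

definition Const :: "complex \<Rightarrow> mpoly" where
  "Const c = Poly_Mapping.single 0 c"

definition Var :: "nat \<Rightarrow> mpoly" where
  "Var i = Poly_Mapping.single (Poly_Mapping.single i 1) 1"

definition monom_eval :: "(nat \<Rightarrow> mpoly) \<Rightarrow> (nat \<Rightarrow>\<^sub>0 nat) \<Rightarrow> mpoly" where
  "monom_eval f m = (\<Prod>i\<in>Poly_Mapping.keys m. f i ^ Poly_Mapping.lookup m i)"

definition subst_poly :: "(nat \<Rightarrow> mpoly) \<Rightarrow> mpoly \<Rightarrow> mpoly" where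
  "subst_poly f p = (\<Sum>m\<in>Poly_Mapping.keys p. Const (Poly_Mapping.lookup p m) * monom_eval f m)"

definition ring_on :: "mpoly set \<Rightarrow> mpoly ring" where
  "ring_on A = \<lparr>carrier = A, mult = (*), one = 1, zero = 0, add = (+)\<rparr>"

definition poly_ring :: "nat set \<Rightarrow> mpoly ring" where
  "poly_ring V = ring_on {p. \<forall>m\<in>Poly_Mapping.keys p. Poly_Mapping.keys m \<subseteq> V}"

section \<open>The ring generated by the Specht polynomials\<close>

definition specht :: "nat list \<Rightarrow> nat list \<Rightarrow> mpoly" where
  "specht is js = (\<Prod>\<nu><4. Var (is ! \<nu>) - Var (js ! \<nu>))"

definition standard_tableaux :: "(nat list \<times> nat list) list" where
  "standard_tableaux =
    [([1,2,3,4], [5,6,7,8]), ([1,2,3,5], [4,6,7,8]), ([1,2,3,6], [4,5,7,8]),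
     ([1,2,3,7], [4,5,6,8]), ([1,2,4,5], [3,6,7,8]), ([1,2,4,6], [3,5,7,8]),
     ([1,2,4,7], [3,5,6,8]), ([1,2,5,6], [3,4,7,8]), ([1,2,5,7], [3,4,6,8]),
     ([1,3,4,5], [2,6,7,8]), ([1,3,4,6], [2,5,7,8]), ([1,3,4,7], [2,5,6,8]),
     ([1,3,5,6], [2,4,7,8]), ([1,3,5,7], [2,4,6,8])]"

text \<open>The index \<open>k\<close> runs from 1 to 14.\<close>

definition Y :: "nat \<Rightarrow> mpoly" where
  "Y k = (case standard_tableaux ! (k - 1) of (is, js) \<Rightarrow> specht is js)"

definition relations_ideal :: "mpoly set" where
  "relations_ideal = {q \<in> carrier (poly_ring {1..14}). subst_poly Y q = 0}"

text \<open>The subring of the polynomial ring in \<open>X\<^sub>1, \<dots>, X\<^sub>8\<close> with which the quotient of the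
  polynomial ring in \<open>Y\<^sub>1, \<dots>, Y\<^sub>1\<^sub>4\<close> by \<open>relations_ideal\<close> is identified;
  see \<open>quotient_iso_specht_ring\<close> below.\<close>

definition specht_ring :: "mpoly ring" where
  "specht_ring = ring_on (subst_poly Y ` carrier (poly_ring {1..14}))"

definition linear_forms :: "mpoly set" where
  "linear_forms = {\<Sum>k\<in>{1..14}. Const (c k) * Y k | c :: nat \<Rightarrow> complex. True}"

definition perm_act :: "(nat \<Rightarrow> nat) \<Rightarrow> mpoly \<Rightarrow> mpoly" where
  "perm_act \<sigma> = subst_poly (\<lambda>i. Var (\<sigma> i))"

text \<open>The quotient is taken in the integral domain of polynomials, where it is unique;
  it exists by \<open>D_quotient\<close> below.\<close>

definition D :: "nat set \<Rightarrow> mpoly" where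
  "D S = (THE q. q * (\<Prod>i\<in>S. \<Prod>j\<in>{1..8} - S. Var i - Var j)
               = (\<Prod>(i, j)\<in>{(i, j). 1 \<le> i \<and> i < j \<and> j \<le> 8}. Var i - Var j))"

section \<open>Consistency of the definitions\<close>

lemma Const_add: "Const (a + b) = Const a + Const b"
  by (simp add: Const_def single_add)

lemma Const_mult: "Const (a * b) = Const a * Const b"
  by (simp add: Const_def mult_single)

lemma monom_eval_superset:
  assumes "finite A" "Poly_Mapping.keys m \<subseteq> A"
  shows "monom_eval f m = (\<Prod>i\<in>A. f i ^ Poly_Mapping.lookup m i)"
  unfolding monom_eval_def using assms
  by (intro prod.mono_neutral_left) (auto simp: in_keys_iff)

lemma monom_eval_0: "monom_eval f 0 = 1"
  by (simp add: monom_eval_def)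

lemma monom_eval_add: "monom_eval f (m + n) = monom_eval f m * monom_eval f n"
proof -
  let ?A = "Poly_Mapping.keys m \<union> Poly_Mapping.keys n"
  have "Poly_Mapping.keys (m + n) \<subseteq> ?A" by (rule keys_add)
  then show ?thesis
    by (simp add: monom_eval_superset[of ?A] lookup_add power_add prod.distrib)
qed

lemma subst_poly_superset:
  assumes "finite A" "Poly_Mapping.keys p \<subseteq> A"
  shows "subst_poly f p = (\<Sum>m\<in>A. Const (Poly_Mapping.lookup p m) * monom_eval f m)"
  unfolding subst_poly_def using assms
  by (intro sum.mono_neutral_left) (auto simp: in_keys_iff Const_def)

lemma subst_poly_add: "subst_poly f (p + q) = subst_poly f p + subst_poly f q"
proof -
  let ?A = "Poly_Mapping.keys p \<union> Poly_Mapping.keys q"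
  have "Poly_Mapping.keys (p + q) \<subseteq> ?A" by (rule keys_add)
  then show ?thesis
    by (simp add: subst_poly_superset[of ?A] lookup_add Const_add distrib_right sum.distrib)
qed

lemma subst_poly_0: "subst_poly f 0 = 0"
  by (simp add: subst_poly_def)

lemma subst_poly_sum: "subst_poly f (sum g A) = (\<Sum>a\<in>A. subst_poly f (g a))"
  by (induction A rule: infinite_finite_induct) (simp_all add: subst_poly_0 subst_poly_add)

lemma subst_poly_single: "subst_poly f (Poly_Mapping.single m c) = Const c * monom_eval f m"
  by (cases "c = 0") (simp_all add: subst_poly_def Const_def)

lemma subst_poly_1: "subst_poly f 1 = 1"
  using subst_poly_single[of f 0 1] by (simp add: monom_eval_0 Const_def)

lemma subst_poly_Var: "subst_poly f (Var i) = f i"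
  by (simp add: Var_def subst_poly_single) (simp add: monom_eval_def Const_def)

lemma poly_as_sum: "p = (\<Sum>m\<in>Poly_Mapping.keys p. Poly_Mapping.single m (Poly_Mapping.lookup p m))"
  for p :: mpoly
  by (rule poly_mapping_eqI)
     (simp add: lookup_sum lookup_single when_def in_keys_iff)

lemma subst_poly_mult: "subst_poly f (p * q) = subst_poly f p * subst_poly f q"
proof -
  let ?s = "\<lambda>p m. Poly_Mapping.single m (Poly_Mapping.lookup p m) :: mpoly"
  have *: "subst_poly f (Poly_Mapping.single m a * Poly_Mapping.single n b)
      = subst_poly f (Poly_Mapping.single m a) * subst_poly f (Poly_Mapping.single n b)" for m n a b
    by (simp add: mult_single subst_poly_single monom_eval_add Const_mult mult_ac)
  have "p * q = (\<Sum>m\<in>Poly_Mapping.keys p. \<Sum>n\<in>Poly_Mapping.keys q. ?s p m * ?s q n)"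
    by (subst poly_as_sum[of p], subst poly_as_sum[of q]) (rule sum_product)
  then have "subst_poly f (p * q) =
      (\<Sum>m\<in>Poly_Mapping.keys p. \<Sum>n\<in>Poly_Mapping.keys q. subst_poly f (?s p m) * subst_poly f (?s q n))"
    by (simp only: subst_poly_sum *)
  also have "\<dots> = (\<Sum>m\<in>Poly_Mapping.keys p. subst_poly f (?s p m)) * (\<Sum>n\<in>Poly_Mapping.keys q. subst_poly f (?s q n))"
    by (rule sum_product[symmetric])
  also have "\<dots> = subst_poly f p * subst_poly f q"
    using poly_as_sum[of p] poly_as_sum[of q] by (metis subst_poly_sum)
  finally show ?thesis .
qed

lemma subst_poly_uminus: "subst_poly f (- p) = - subst_poly f p"
  using subst_poly_add[of f p "- p"] by (simp add: subst_poly_0 eq_neg_iff_add_eq_0 add.commute)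

lemma cring_ring_on:
  assumes "1 \<in> A" "\<And>p. p \<in> A \<Longrightarrow> - p \<in> A"
    and "\<And>p q. p \<in> A \<Longrightarrow> q \<in> A \<Longrightarrow> p + q \<in> A"
    and "\<And>p q. p \<in> A \<Longrightarrow> q \<in> A \<Longrightarrow> p * q \<in> A"
  shows "cring (ring_on A)"
proof (rule cringI)
  have 0: "0 \<in> A" using assms(1) assms(2)[of 1] assms(3)[of 1 "- 1"] by simp
  show "abelian_group (ring_on A)"
  proof (rule abelian_groupI, goal_cases)
    case (6 x)
    then show ?case using assms(2)[of x] by (auto simp: ring_on_def intro!: bexI[of _ "- x"])
  qed (auto simp: ring_on_def assms 0 algebra_simps)
  show "Group.comm_monoid (ring_on A)"
    by (rule comm_monoidI) (auto simp: ring_on_def assms algebra_simps)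
qed (auto simp: ring_on_def algebra_simps)

lemma poly_ring_closed:
  "1 \<in> carrier (poly_ring V)"
  "p \<in> carrier (poly_ring V) \<Longrightarrow> - p \<in> carrier (poly_ring V)"
  "p \<in> carrier (poly_ring V) \<Longrightarrow> q \<in> carrier (poly_ring V) \<Longrightarrow> p + q \<in> carrier (poly_ring V)"
  "p \<in> carrier (poly_ring V) \<Longrightarrow> q \<in> carrier (poly_ring V) \<Longrightarrow> p * q \<in> carrier (poly_ring V)"
proof -
  show "1 \<in> carrier (poly_ring V)"
    by (simp add: poly_ring_def ring_on_def)
  show "p \<in> carrier (poly_ring V) \<Longrightarrow> - p \<in> carrier (poly_ring V)"
    by (simp add: poly_ring_def ring_on_def in_keys_iff)
  show "p \<in> carrier (poly_ring V) \<Longrightarrow> q \<in> carrier (poly_ring V) \<Longrightarrow> p + q \<in> carrier (poly_ring V)"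
    using keys_add[of p q] by (simp add: poly_ring_def ring_on_def) blast
  assume pq: "p \<in> carrier (poly_ring V)" "q \<in> carrier (poly_ring V)"
  have "Poly_Mapping.keys m \<subseteq> V" if "m \<in> Poly_Mapping.keys (p * q)" for m
  proof -
    from that obtain a b where m: "m = a + b" "a \<in> Poly_Mapping.keys p" "b \<in> Poly_Mapping.keys q"
      using keys_mult[of p q] by blast
    then have "Poly_Mapping.keys a \<subseteq> V" "Poly_Mapping.keys b \<subseteq> V"
      using pq by (simp_all add: poly_ring_def ring_on_def)
    then show ?thesis using m(1) keys_add[of a b] by blast
  qed
  then show "p * q \<in> carrier (poly_ring V)"
    by (simp add: poly_ring_def ring_on_def)
qed

lemma poly_ring_eq: "poly_ring V = ring_on (carrier (poly_ring V))"
  by (simp add: poly_ring_def ring_on_def)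

lemma cring_poly_ring: "cring (poly_ring V)"
  by (subst poly_ring_eq, rule cring_ring_on) (simp_all add: poly_ring_closed)

lemma cring_image_subst_poly: "cring (ring_on (subst_poly f ` carrier (poly_ring V)))"
proof (rule cring_ring_on, goal_cases)
  case 1
  show ?case by (rule image_eqI[where x = 1]) (simp_all add: subst_poly_1 poly_ring_closed)
next
  case (2 p)
  then show ?case by (elim imageE) (simp add: subst_poly_uminus[symmetric] poly_ring_closed)
next
  case (3 p q)
  then show ?case by (elim imageE) (simp add: subst_poly_add[symmetric] poly_ring_closed)
next
  case (4 p q)
  then show ?case by (elim imageE) (simp add: subst_poly_mult[symmetric] poly_ring_closed)
qed

lemma cring_specht_ring: "cring specht_ring"
  unfolding specht_ring_def by (rule cring_image_subst_poly)

lemma quotient_iso_image_subst_poly: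
  "(poly_ring V Quot {q \<in> carrier (poly_ring V). subst_poly f q = 0})
    \<simeq> ring_on (subst_poly f ` carrier (poly_ring V))" (is "(?P Quot ?K) \<simeq> ?S")
proof -
  interpret P: cring ?P by (rule cring_poly_ring)
  interpret S: cring ?S by (rule cring_image_subst_poly)
  interpret h: ring_hom_ring ?P ?S "subst_poly f"
  proof (rule ring_hom_ringI2[OF P.ring_axioms S.ring_axioms])
    show "subst_poly f \<in> ring_hom ?P ?S"
    proof (rule ring_hom_memI)
      fix p q
      assume "p \<in> carrier ?P"
      then show "subst_poly f p \<in> carrier ?S" unfolding ring_on_def by simp
      show "subst_poly f (p \<otimes>\<^bsub>?P\<^esub> q) = subst_poly f p \<otimes>\<^bsub>?S\<^esub> subst_poly f q"
        unfolding poly_ring_def ring_on_def by (simp add: subst_poly_mult)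
      show "subst_poly f (p \<oplus>\<^bsub>?P\<^esub> q) = subst_poly f p \<oplus>\<^bsub>?S\<^esub> subst_poly f q"
        unfolding poly_ring_def ring_on_def by (simp add: subst_poly_add)
    next
      show "subst_poly f \<one>\<^bsub>?P\<^esub> = \<one>\<^bsub>?S\<^esub>"
        unfolding poly_ring_def ring_on_def by (simp add: subst_poly_1)
    qed
  qed
  have K: "?K = a_kernel ?P ?S (subst_poly f)"
    unfolding a_kernel_def' by (simp add: ring_on_def)
  have "subst_poly f ` carrier ?P = carrier ?S"
    by (simp add: ring_on_def)
  then have "(?P Quot a_kernel ?P ?S (subst_poly f)) \<simeq> ?S" by (rule h.FactRing_iso)
  then show ?thesis unfolding K .
qed

theorem quotient_iso_specht_ring:
  "(poly_ring {1..14} Quot relations_ideal) \<simeq> specht_ring"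
  unfolding relations_ideal_def specht_ring_def by (rule quotient_iso_image_subst_poly)

lemma Var_inject: "Var i = Var j \<longleftrightarrow> i = j"
proof
  assume "Var i = Var j"
  then have "Poly_Mapping.keys (Var i) = Poly_Mapping.keys (Var j)" by simp
  then have "Poly_Mapping.keys (Poly_Mapping.single i (1::nat)) = Poly_Mapping.keys (Poly_Mapping.single j (1::nat))"
    by (simp add: Var_def)
  then show "i = j" by simp
qed simp

lemma D_quotient:
  assumes "S \<subseteq> {1..8}"
  shows "D S * (\<Prod>i\<in>S. \<Prod>j\<in>{1..8} - S. Var i - Var j)
       = (\<Prod>(i, j)\<in>{(i, j). 1 \<le> i \<and> i < j \<and> j \<le> 8}. Var i - Var j)"
    (is "_ * ?d = ?n")
    and "D S = (\<Prod>(i, j)\<in>{(i, j). i \<in> S \<and> j \<in> {1..8} - S \<and> j < i}. - 1) *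
      (\<Prod>(i, j)\<in>{(i, j). 1 \<le> i \<and> i < j \<and> j \<le> 8 \<and> (i \<in> S \<longleftrightarrow> j \<in> S)}. Var i - Var j)"
    (is "_ = ?e * ?s")
proof -
  let ?v = "\<lambda>(i, j). Var i - Var j"
  let ?same = "{(i, j). 1 \<le> i \<and> i < j \<and> j \<le> 8 \<and> (i \<in> S \<longleftrightarrow> j \<in> S)}"
  let ?A = "{(i, j). i \<in> S \<and> j \<in> {1..8} - S \<and> i < j}"
  let ?B = "{(i, j). i \<in> S \<and> j \<in> {1..8} - S \<and> j < i}"
  let ?all = "{(i, j). 1 \<le> i \<and> i < j \<and> j \<le> (8::nat)}"
  have sub: "?same \<subseteq> {1..8} \<times> {1..8}" "?A \<subseteq> {1..8} \<times> {1..8}" "?B \<subseteq> {1..8} \<times> {1..8}"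
    using assms by auto
  have fin: "finite ?same" "finite ?A" "finite ?B"
    by (rule finite_subset[OF sub(1)] finite_subset[OF sub(2)] finite_subset[OF sub(3)]; simp)+
  have finS: "finite S" using assms finite_subset by blast
  have d: "?d = prod ?v ?A * prod ?v ?B"
  proof -
    have "?d = prod ?v (S \<times> ({1..8} - S))"
      using finS by (simp add: prod.cartesian_product)
    also have "S \<times> ({1..8} - S) = ?A \<union> ?B" by auto (metis linorder_neqE_nat)
    also have "prod ?v (?A \<union> ?B) = prod ?v ?A * prod ?v ?B"
      using fin by (intro prod.union_disjoint) auto
    finally show ?thesis .
  qed
  have swap: "prod ?v (prod.swap ` ?B) = ?e * prod ?v ?B"
  proof -
    have "prod ?v (prod.swap ` ?B) = prod (?v \<circ> prod.swap) ?B"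
      by (intro prod.reindex) (auto intro: inj_onI)
    also have "\<dots> = prod (\<lambda>x. (case x of (i, j) \<Rightarrow> - 1) * ?v x) ?B"
      by (intro prod.cong) auto
    finally show ?thesis by (simp only: prod.distrib)
  qed
  have n: "?n = ?s * (prod ?v ?A * prod ?v (prod.swap ` ?B))"
  proof -
    have "?all = ?same \<union> (?A \<union> prod.swap ` ?B)"
      using assms by (force simp: image_iff)
    moreover have "prod ?v (?same \<union> (?A \<union> prod.swap ` ?B))
        = ?s * (prod ?v ?A * prod ?v (prod.swap ` ?B))"
      using fin by (subst prod.union_disjoint, simp, simp, force, subst prod.union_disjoint) auto
    ultimately show ?thesis by simp
  qed
  have q: "(?e * ?s) * ?d = ?n"
    unfolding d n swap by (simp add: mult_ac)
  have nz: "?d \<noteq> 0"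
    using finS by (auto simp: Var_inject)
  have "D S = ?e * ?s"
    unfolding D_def
  proof (rule the_equality)
    fix x assume "x * ?d = ?n"
    then have "x * ?d = (?e * ?s) * ?d" unfolding q .
    then show "x = ?e * ?s" unfolding mult_right_cancel[OF nz] .
  qed (rule q)
  then show "D S = ?e * ?s" .
  then show "D S * ?d = ?n" by (simp only: q)
qed

end

theory Submission
  imports Defs
begin

text \<open>The ideal of a triple \<open>T\<close> of points consists of the elements of the Specht ring that vanish where
  the three points of \<open>T\<close> coincide. For \<open>T = {5, 6, 8}\<close> it contains the ten listed \<open>Y\<^sub>k\<close>, and the four
  remaining \<open>Y\<^sub>k\<close> are algebraically independent after restriction; so it is generated by these ten, and
  \<open>S\<^sub>8\<close> permutes the 56 ideals like the triples.

  Every \<open>D(S)\<close> lies in all of them, because two of three points are on the same side of \<open>S\<close>. Conversely, a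
  polynomial in eight variables vanishing on all triple diagonals lies in the ideal generated by the
  \<open>D(S)\<close> in the full polynomial ring, with control of the degree in each variable: specialise variables one by one to fixed
  constants and lift back, down to three variables, where Lagrange interpolation applies. If the
  polynomial is in addition an \<open>SL\<^sub>2\<close>-invariant, a Casimir projection makes the coefficients invariant. By
  the first fundamental theorem invariants are combinations of products of brackets \<open>X\<^sub>i - X\<^sub>j\<close> along the edges of regular
  graphs, and by Kempe's argument these are polynomials in the Specht polynomials.\<close>

section \<open>Substitution and degrees\<close>

text \<open>The Specht ring is the ring of \<open>SL\<^sub>2\<close>-invariants of eight points on
  the projective line, and the \<open>Y k\<close> span its lowest positive degree. Membership in the
  ideal of the \<open>D S\<close> requires coefficients in this ring, whereas division and
  interpolation only give polynomial coefficients. Projecting to invariants repairs this, but the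
  Lie algebra acts on polynomials of degree at most \<open>e\<close> in each of the eight variables;
  hence a bound for every single variable is carried through all steps. The degrees fit for a simple
  reason. On \<open>X\<^sub>a = X\<^sub>b\<close>, a polynomial vanishing on all triple diagonals
  has six forced roots, one at each other point, while its degree there is at most the sum of two
  bounds. Bounds 3 and 3 leave a quotient constant in the merged variable, bounds 2 and 3 leave only
  0. So 3, the degree of \<open>D S\<close> in each variable, is the first equal bound that admits
  such polynomials, and there the coefficients are constants. Fixing variables at distinct constants
  preserves this count, because the fixed points still belong to the eight.\<close>

lemma Var_power: "Var i ^ k = Poly_Mapping.single (Poly_Mapping.single i k) 1"
  by (induction k) (simp_all add: Var_def mult_single flip: single_add)

lemma monom_eval_Var: "monom_eval Var m = Poly_Mapping.single m 1"
proof -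
  have "(\<Prod>i\<in>A. Poly_Mapping.single (g i) (1::complex)) = Poly_Mapping.single (\<Sum>i\<in>A. g i) 1"
    if "finite A" for A and g :: "nat \<Rightarrow> nat \<Rightarrow>\<^sub>0 nat"
    using that by induction (simp_all add: mult_single)
  moreover have "(\<Sum>i\<in>Poly_Mapping.keys m. Poly_Mapping.single i (Poly_Mapping.lookup m i)) = m"
    by (rule poly_mapping_eqI) (simp add: lookup_sum lookup_single when_def in_keys_iff)
  ultimately show ?thesis
    by (simp add: monom_eval_def Var_power)
qed

lemma Const_0 [simp]: "Const 0 = 0" and Const_1 [simp]: "Const 1 = 1"
  by (simp_all add: Const_def)

lemma Const_uminus: "Const (- a) = - Const a"
  by (simp add: Const_def single_uminus)

lemma Const_diff: "Const (a - b) = Const a - Const b"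
  by (simp add: Const_def single_diff)

lemma Const_power: "Const (a ^ n) = Const a ^ n"
  by (induction n) (simp_all add: Const_mult)

lemma Const_sum: "Const (sum g A) = (\<Sum>a\<in>A. Const (g a))"
  by (induction A rule: infinite_finite_induct) (simp_all add: Const_add)

lemma Const_prod: "Const (prod g A) = (\<Prod>a\<in>A. Const (g a))"
  by (induction A rule: infinite_finite_induct) (simp_all add: Const_mult)

lemma Const_inject [simp]: "Const a = Const b \<longleftrightarrow> a = b"
  by (metis Const_def lookup_single_eq)

lemma Const_eq_0_iff [simp]: "Const a = 0 \<longleftrightarrow> a = 0"
  using Const_inject[of a 0] by simp

lemma single_conv: "Poly_Mapping.single m c = Const c * monom_eval Var m"
  by (simp add: monom_eval_Var Const_def mult_single)

text \<open>Reduces identities between ring homomorphisms or derivations to constants and variables,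
  from which every polynomial is built by sums and products.\<close>

lemma mpoly_induct [case_names Const Var add mult]:
  fixes p :: mpoly
  assumes Const: "\<And>c. P (Const c)" and Var: "\<And>i. P (Var i)"
    and add: "\<And>p q. P p \<Longrightarrow> P q \<Longrightarrow> P (p + q)" and mult: "\<And>p q. P p \<Longrightarrow> P q \<Longrightarrow> P (p * q)"
  shows "P p"
proof -
  have pow: "P (Var i ^ k)" for i k
    using Const[of 1] by (induction k) (auto intro: Var mult)
  have "P (\<Prod>i\<in>A. Var i ^ g i)" for A and g :: "nat \<Rightarrow> nat"
    using Const[of 1] by (induction A rule: infinite_finite_induct) (auto intro: pow mult)
  then have mono: "P (Poly_Mapping.single m c)" for m c
    unfolding single_conv monom_eval_def by (intro mult Const)
  have "P (\<Sum>m\<in>A. Poly_Mapping.single m (g m))" for A and g :: "_ \<Rightarrow> complex"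
    using Const[of 0] by (induction A rule: infinite_finite_induct) (auto intro: mono add)
  then show ?thesis by (subst poly_as_sum)
qed

lemma subst_poly_Const [simp]: "subst_poly f (Const c) = Const c"
  using subst_poly_single[of f 0 c] by (simp add: Const_def monom_eval_0)

declare subst_poly_Var [simp] subst_poly_0 [simp] subst_poly_1 [simp]

lemma subst_poly_diff: "subst_poly f (p - q) = subst_poly f p - subst_poly f q"
  using subst_poly_add[of f p "- q"] by (simp add: subst_poly_uminus)

lemma subst_poly_power: "subst_poly f (p ^ n) = subst_poly f p ^ n"
  by (induction n) (simp_all add: subst_poly_mult)

lemma subst_poly_prod: "subst_poly f (prod g A) = (\<Prod>a\<in>A. subst_poly f (g a))"
  by (induction A rule: infinite_finite_induct) (simp_all add: subst_poly_mult)

lemma subst_poly_prod_list: "subst_poly f (prod_list ps) = prod_list (map (subst_poly f) ps)"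
  by (induction ps) (simp_all add: subst_poly_mult)

lemmas subst_poly_hom = subst_poly_add subst_poly_diff subst_poly_mult subst_poly_uminus
  subst_poly_power subst_poly_prod subst_poly_sum subst_poly_prod_list

lemma subst_poly_subst: "subst_poly f (subst_poly g p) = subst_poly (\<lambda>i. subst_poly f (g i)) p"
  by (induction p rule: mpoly_induct) (simp_all add: subst_poly_hom)

lemma subst_poly_Var_id: "subst_poly Var p = p"
  by (induction p rule: mpoly_induct) (simp_all add: subst_poly_hom)

text \<open>A bound instead of a degree function: the zero polynomial satisfies every bound and
  needs no convention. \<open>dle i p 0\<close> says that \<open>X\<^sub>i\<close> does not occur in
  \<open>p\<close>.\<close>

definition dle :: "nat \<Rightarrow> mpoly \<Rightarrow> nat \<Rightarrow> bool" where
  "dle i p n \<longleftrightarrow> (\<forall>m\<in>Poly_Mapping.keys p. Poly_Mapping.lookup m i \<le> n)"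

lemma dle_0 [simp]: "dle i 0 n"
  by (simp add: dle_def)

lemma dle_mono: "dle i p n \<Longrightarrow> n \<le> n' \<Longrightarrow> dle i p n'"
  by (auto simp: dle_def)

lemma dle_Const [simp]: "dle i (Const c) n"
  by (simp add: dle_def Const_def)

lemma dle_1 [simp]: "dle i 1 n"
  using dle_Const[of i 1 n] by simp

lemma dle_Var: "dle i (Var j) (if i = j then 1 else 0)"
  by (simp add: dle_def Var_def lookup_single)

lemma dle_Var_same [simp]: "dle i (Var i) (Suc n)"
  by (rule dle_mono[OF dle_Var]) simp

lemma dle_Var_other [simp]: "i \<noteq> j \<Longrightarrow> dle i (Var j) n"
  by (rule dle_mono[OF dle_Var]) simp

lemma dle_add: "dle i p n \<Longrightarrow> dle i q n \<Longrightarrow> dle i (p + q) n"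
  using keys_add[of p q] unfolding dle_def by blast

lemma dle_uminus: "dle i p n \<Longrightarrow> dle i (- p) n"
  by (simp add: dle_def in_keys_iff)

lemma dle_diff: "dle i p n \<Longrightarrow> dle i q n \<Longrightarrow> dle i (p - q) n"
  using dle_add[of i p n "- q"] by (simp add: dle_uminus)

lemma dle_mult: "dle i p a \<Longrightarrow> dle i q b \<Longrightarrow> dle i (p * q) (a + b)"
  unfolding dle_def using keys_mult[of p q] by (fastforce simp: lookup_add intro: add_mono)

lemma dle_mult_le: "dle i p a \<Longrightarrow> dle i q b \<Longrightarrow> a + b \<le> n \<Longrightarrow> dle i (p * q) n"
  using dle_mult dle_mono by blast

lemma dle_sum: "(\<And>a. a \<in> A \<Longrightarrow> dle i (g a) n) \<Longrightarrow> dle i (sum g A) n"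
  by (induction A rule: infinite_finite_induct) (auto intro: dle_add)

lemma dle_prod: "(\<And>a. a \<in> A \<Longrightarrow> dle i (g a) (k a)) \<Longrightarrow> dle i (prod g A) (sum k A)"
  by (induction A rule: infinite_finite_induct) (auto intro: dle_mult)

lemma dle_power: "dle i p a \<Longrightarrow> dle i (p ^ k) (k * a)"
  by (induction k) (auto intro: dle_mult)

text \<open>Variables that do not occur in \<open>p\<close> contribute only trivial powers, so the
  substitutions may disagree there.\<close>

lemma subst_poly_cong:
  assumes "\<And>i. f i \<noteq> g i \<Longrightarrow> dle i p 0"
  shows "subst_poly f p = subst_poly g p"
  unfolding subst_poly_def
proof (rule sum.cong)
  fix m assume m: "m \<in> Poly_Mapping.keys p"
  have "monom_eval f m = monom_eval g m"
    unfolding monom_eval_def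
  proof (rule prod.cong)
    fix i assume "i \<in> Poly_Mapping.keys m"
    then have "\<not> dle i p 0"
      using m by (auto simp: dle_def in_keys_iff)
    with assms show "f i ^ Poly_Mapping.lookup m i = g i ^ Poly_Mapping.lookup m i" by metis
  qed simp
  then show "Const (Poly_Mapping.lookup p m) * monom_eval f m = Const (Poly_Mapping.lookup p m) * monom_eval g m"
    by simp
qed simp

lemma subst_poly_ident: "(\<And>i. f i \<noteq> Var i \<Longrightarrow> dle i p 0) \<Longrightarrow> subst_poly f p = p"
  using subst_poly_cong[of f Var p] by (simp add: subst_poly_Var_id)

lemma dle_subst:
  assumes "\<And>j. dle i (g j) (k j)" "\<And>m. m \<in> Poly_Mapping.keys p \<Longrightarrow> (\<Sum>j\<in>Poly_Mapping.keys m. Poly_Mapping.lookup m j * k j) \<le> n"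
  shows "dle i (subst_poly g p) n"
  unfolding subst_poly_def
proof (rule dle_sum)
  fix m assume m: "m \<in> Poly_Mapping.keys p"
  have "dle i (monom_eval g m) (\<Sum>j\<in>Poly_Mapping.keys m. Poly_Mapping.lookup m j * k j)"
    unfolding monom_eval_def by (intro dle_prod dle_power assms)
  then show "dle i (Const (Poly_Mapping.lookup p m) * monom_eval g m) n"
    using assms(2)[OF m] by (auto intro: dle_mult_le dle_mono)
qed

text \<open>The interesting case is a \<open>q\<close> that is linear in \<open>X\<^sub>i\<close>:
  each of at most \<open>n\<close> factors \<open>X\<^sub>v\<close> then adds at most one to the
  degree in \<open>X\<^sub>i\<close>. The nested conditional treats this together with a
  \<open>q\<close> free of \<open>X\<^sub>i\<close>.\<close>

lemma dle_subst_upd: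
  assumes "dle v p n" "dle i p k" "dle i q 0 \<or> i \<noteq> v \<and> dle i q 1 "
  shows "dle i (subst_poly (Var(v := q)) p) (if dle i q 0 then (if i = v then 0 else k) else n + k)"
\<comment> \<open>The weight of \<open>j\<close> bounds the degree in \<open>X\<^sub>i\<close> of
  the image of \<open>X\<^sub>j\<close>.\<close>
proof (rule dle_subst[where k = "\<lambda>j. if j = v then (if dle i q 0 then 0 else 1) else if j = i then 1 else 0"])
  show "dle i ((Var(v := q)) j) (if j = v then if dle i q 0 then 0 else 1 else if j = i then 1 else 0)" for j
    using assms(3) by auto
  fix m assume m: "m \<in> Poly_Mapping.keys p"
  let ?l = "Poly_Mapping.lookup m"
  have "(\<Sum>j\<in>Poly_Mapping.keys m. ?l j * (if j = v then if dle i q 0 then 0 else 1 else if j = i then 1 else 0))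
    \<le> (\<Sum>j\<in>Poly_Mapping.keys m. (if j = v then (if dle i q 0 then 0 else ?l v) else 0) + (if j = i then (if i = v then 0 else ?l i) else 0))"
    by (rule sum_mono) auto
  also have "\<dots> \<le> (if dle i q 0 then 0 else ?l v) + (if i = v then 0 else ?l i)"
    by (simp add: sum.distrib)
  finally show "(\<Sum>j\<in>Poly_Mapping.keys m. ?l j * (if j = v then if dle i q 0 then 0 else 1 else if j = i then 1 else 0))
     \<le> (if dle i q 0 then if i = v then 0 else k else n + k)"
    using m assms unfolding dle_def by (fastforce split: if_splits)
qed

section \<open>Division by linear factors\<close>

text \<open>Substituting \<open>q\<close> for \<open>X\<^sub>v\<close> is the identity modulo
  \<open>X\<^sub>v - q\<close>; in a product one factor is changed at a time.\<close>

lemma linear_factor_dvd: "(Var v - q) dvd p - subst_poly (Var(v := q)) p"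
proof (induction p rule: mpoly_induct)
  case (mult p p')
  have eq: "p * p' - subst_poly (Var(v := q)) (p * p')
    = (p - subst_poly (Var(v := q)) p) * p' + subst_poly (Var(v := q)) p * (p' - subst_poly (Var(v := q)) p')"
    by (simp add: subst_poly_mult algebra_simps)
  show ?case
    unfolding eq by (intro dvd_add dvd_mult2[OF mult.IH(1)] dvd_mult[OF mult.IH(2)])
next
  case (add p p')
  have "p + p' - subst_poly (Var(v := q)) (p + p')
    = (p - subst_poly (Var(v := q)) p) + (p' - subst_poly (Var(v := q)) p')"
    by (simp add: subst_poly_add algebra_simps)
  with add show ?case by (metis dvd_add)
qed auto

text \<open>In an integral domain the top parts of two factors have a nonzero product, so maximal
  weights add. The weight may be any additive function of the exponents; \<open>a\<close> is the
  exact maximal weight of \<open>p\<close>.\<close>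

lemma weight_cancel:
  fixes p q :: mpoly and w :: "(nat \<Rightarrow>\<^sub>0 nat) \<Rightarrow> nat"
  assumes w: "\<And>m n. w (m + n) = w m + w n"
    and p: "\<exists>m\<in>Poly_Mapping.keys p. w m = a" "\<And>m. m \<in> Poly_Mapping.keys p \<Longrightarrow> w m \<le> a"
    and pq: "\<And>m. m \<in> Poly_Mapping.keys (p * q) \<Longrightarrow> w m \<le> a + k"
    and m: "m \<in> Poly_Mapping.keys q"
  shows "w m \<le> k"
proof (rule ccontr)
  assume "\<not> w m \<le> k"
  define b where "b = Max (w ` Poly_Mapping.keys q)"
  have b: "w m \<le> b" if "m \<in> Poly_Mapping.keys q" for m
    using that by (simp add: b_def)
  have "b \<in> w ` Poly_Mapping.keys q"
    unfolding b_def using m by (intro Max_in) auto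
  then obtain mb where mb: "mb \<in> Poly_Mapping.keys q" "w mb = b" by auto
  have bk: "k < b" using b[OF m] \<open>\<not> w m \<le> k\<close> by simp
  define top :: "mpoly \<Rightarrow> nat \<Rightarrow> mpoly" where
    "top r c = (\<Sum>m\<in>{m\<in>Poly_Mapping.keys r. w m = c}. Poly_Mapping.single m (Poly_Mapping.lookup r m))" for r c
  have lookup_top: "Poly_Mapping.lookup (top r c) m = (if w m = c then Poly_Mapping.lookup r m else 0)" for r c m
    by (simp add: top_def lookup_sum lookup_single when_def in_keys_iff)
  have keys_top: "Poly_Mapping.keys (top r c) = {m\<in>Poly_Mapping.keys r. w m = c}" for r c
    by (simp add: set_eq_iff in_keys_iff lookup_top)
  have keys_low: "Poly_Mapping.keys (r - top r c) = {m\<in>Poly_Mapping.keys r. w m \<noteq> c}" for r c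
    by (auto simp: in_keys_iff lookup_top lookup_minus split: if_splits)
  \<comment> \<open>The product of the two top parts is nonzero, and all other contributions to
    \<open>p * q\<close> have smaller weight, so nothing can cancel it.\<close>
  have "top p a \<noteq> 0" "top q b \<noteq> 0"
    using p(1) mb by (metis (mono_tags, lifting) empty_iff keys_top keys_zero mem_Collect_eq)+
  then have "Poly_Mapping.keys (top p a * top q b) \<noteq> {}"
    by simp
  then obtain n where n: "n \<in> Poly_Mapping.keys (top p a * top q b)" by blast
  then have wn: "w n = a + b"
    using keys_mult[of "top p a" "top q b"] by (auto simp: keys_top w)
  have split: "p * q = top p a * top q b + ((p - top p a) * q + top p a * (q - top q b))"
    by (simp add: algebra_simps)
  have "w n' < a + b" if "n' \<in> Poly_Mapping.keys ((p - top p a) * q + top p a * (q - top q b))" for n'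
  proof -
    from that consider "n' \<in> Poly_Mapping.keys ((p - top p a) * q)" | "n' \<in> Poly_Mapping.keys (top p a * (q - top q b))"
      using keys_add[of "(p - top p a) * q" "top p a * (q - top q b)"] by blast
    then show ?thesis
    proof cases
      case 1
      then obtain x y where "n' = x + y" "x \<in> Poly_Mapping.keys (p - top p a)" "y \<in> Poly_Mapping.keys q"
        using keys_mult[of "p - top p a" q] by blast
      then show ?thesis using p(2)[of x] b[of y] by (auto simp: keys_low w)
    next
      case 2
      then obtain x y where "n' = x + y" "x \<in> Poly_Mapping.keys (top p a)" "y \<in> Poly_Mapping.keys (q - top q b)"
        using keys_mult[of "top p a" "q - top q b"] by blast
      then show ?thesis using b[of y] by (auto simp: keys_low keys_top w)
    qed
  qed
  from this[of n] have "n \<notin> Poly_Mapping.keys ((p - top p a) * q + top p a * (q - top q b))"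
    using wn by linarith
  then have "n \<in> Poly_Mapping.keys (p * q)"
    using n unfolding split in_keys_iff lookup_add by simp
  from pq[OF this] wn bk show False by simp
qed

text \<open>\<open>X\<^sub>v - q\<close> has exact degree 1 in \<open>X\<^sub>i\<close> if
  \<open>i = v\<close> or \<open>q\<close> contains \<open>X\<^sub>i\<close>, and 0 otherwise; exact
  degrees add. The second claim states what the truncated \<open>n - 1\<close> cannot express: for
  nonzero \<open>f\<close> the case \<open>n = 0\<close> is impossible.\<close>

lemma dle_cancel:
  assumes "i \<noteq> v \<Longrightarrow> dle i q (Suc 0)" "dle v q 0" "dle i ((Var v - q) * f) n" "f \<noteq> 0"
  shows "dle i f (if i = v \<or> \<not> dle i q 0 then n - 1 else n)"
    and "i = v \<or> \<not> dle i q 0 \<Longrightarrow> 0 < n"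
proof -
  let ?w = "\<lambda>m. Poly_Mapping.lookup m i :: nat"
  define a where "a = (if i = v \<or> \<not> dle i q 0 then 1 else 0::nat)"
  have kv: "Poly_Mapping.single v 1 \<in> Poly_Mapping.keys (Var v - q)"
  proof -
    have "Poly_Mapping.single v 1 \<notin> Poly_Mapping.keys q"
      using assms(2) by (metis dle_def lookup_single_eq le_0_eq zero_neq_one)
    then show ?thesis
      by (simp add: in_keys_iff lookup_minus Var_def)
  qed
  have le: "dle i (Var v - q) a"
    using assms(1,2) by (cases "i = v") (auto simp: a_def intro!: dle_diff intro: dle_mono)
  have ex: "\<exists>m\<in>Poly_Mapping.keys (Var v - q). ?w m = a"
  proof (cases "i = v \<or> dle i q 0")
    case True
    then show ?thesis
      using kv assms(2) by (intro bexI[OF _ kv]) (auto simp: a_def lookup_single)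
  next
    case False
    then obtain m where m: "m \<in> Poly_Mapping.keys q" "?w m > 0"
      by (auto simp: dle_def)
    moreover have "?w m \<le> 1" using assms(1) m False by (auto simp: dle_def)
    moreover have "m \<noteq> Poly_Mapping.single v 1"
      using m(2) False by (auto simp: lookup_single when_def split: if_splits)
    ultimately show ?thesis
      using False by (intro bexI[of _ m]) (auto simp: a_def in_keys_iff lookup_minus Var_def lookup_single when_def)
  qed
  have main: "dle i f k" if "n \<le> a + k" for k
    unfolding dle_def
  proof
    fix m assume "m \<in> Poly_Mapping.keys f"
    with ex le assms(3) that show "?w m \<le> k"
      by (intro weight_cancel[of ?w "Var v - q" a f k m]) (auto simp: lookup_add dle_def)
  qed
  show "dle i f (if i = v \<or> \<not> dle i q 0 then n - 1 else n)"
    by (rule main) (auto simp: a_def)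
  show "0 < n" if A: "i = v \<or> \<not> dle i q 0"
  proof (rule ccontr)
    assume "\<not> 0 < n"
    obtain m0 where m0: "m0 \<in> Poly_Mapping.keys f"
      using assms(4) by (metis all_not_in_conv keys_eq_empty)

    \<comment> \<open>The roles are exchanged: now \<open>f\<close> is the factor of known exact
      degree \<open>b\<close>, and the bound is derived for \<open>X\<^sub>v - q\<close>.\<close>
    define b where "b = Max (?w ` Poly_Mapping.keys f)"
    have "b \<in> ?w ` Poly_Mapping.keys f"
      unfolding b_def using m0 by (intro Max_in) auto
    then obtain mb where mb: "mb \<in> Poly_Mapping.keys f" "?w mb = b" by auto
    have bmax: "?w m \<le> b" if "m \<in> Poly_Mapping.keys f" for m
      using that by (simp add: b_def)
    have comm: "(Var v - q) * f = f * (Var v - q)" by simp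
    obtain m1 where m1: "m1 \<in> Poly_Mapping.keys (Var v - q)" "?w m1 = a" using ex by auto
    have "?w m1 \<le> 0"
      using mb bmax assms(3) \<open>\<not> 0 < n\<close> m1
      by (intro weight_cancel[of ?w f b "Var v - q" 0 m1]) (auto simp: lookup_add dle_def comm)
    then show False using m1(2) A by (simp add: a_def)
  qed
qed

lemma dle_Var_0_iff [simp]: "dle i (Var j) 0 \<longleftrightarrow> i \<noteq> j"
  by (auto simp: dle_def Var_def lookup_single)

lemma Var_neq_Const [simp]: "Var i \<noteq> Const c" "Const c \<noteq> Var i"
  using dle_Var_0_iff[of i i] dle_Const[of i c 0] by metis+

lemma dle_0_imp_Const:
  assumes "\<And>i. dle i p 0"
  shows "\<exists>c. p = Const c"
proof -
  have "m = 0" if "m \<in> Poly_Mapping.keys p" for m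
    using assms that by (intro poly_mapping_eqI) (auto simp: dle_def)
  then have "p = Poly_Mapping.single 0 (Poly_Mapping.lookup p 0)"
    by (intro poly_mapping_eqI) (metis in_keys_iff lookup_single_eq lookup_single_not_eq)
  then show ?thesis by (metis Const_def)
qed

text \<open>The roots are divided out one after another: at a further root \<open>q\<close> the
  factors already split off take the nonzero values \<open>q - q'\<close>, so the quotient inherits
  the root. Each factor costs one degree in \<open>X\<^sub>v\<close>, and one in
  \<open>X\<^sub>i\<close> if its root contains \<open>X\<^sub>i\<close>. The clause
  \<open>h = 0\<close> is the bound on the number of roots, which truncated subtraction would
  hide.\<close>

lemma linear_roots:
  assumes "finite Q"
    and Q: "\<And>q. q \<in> Q \<Longrightarrow> dle v q 0" "\<And>q i. q \<in> Q \<Longrightarrow> dle i q (Suc 0)"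
      "\<And>q. q \<in> Q \<Longrightarrow> subst_poly (Var(v := q)) f = 0"
    and k: "\<And>i. dle i f (k i)"
  shows "\<exists>h. f = (\<Prod>q\<in>Q. Var v - q) * h \<and> (k v < card Q \<longrightarrow> h = 0) \<and>
    (\<forall>i. dle i h (k i - (if i = v then card Q else card {q\<in>Q. \<not> dle i q 0})))"
  using assms(1) Q
proof (induction Q rule: finite_induct)
  case empty
  then show ?case using k by auto
next
  case (insert q Q)
  then obtain h where h: "f = (\<Prod>q\<in>Q. Var v - q) * h" "k v < card Q \<longrightarrow> h = 0"
    "\<And>i. dle i h (k i - (if i = v then card Q else card {q\<in>Q. \<not> dle i q 0}))"
    by auto
  have subst_q: "subst_poly (Var(v := q)) (\<Prod>q\<in>Q. Var v - q) = (\<Prod>q'\<in>Q. q - q')"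
    unfolding subst_poly_prod
  proof (rule prod.cong)
    fix q' assume "q' \<in> Q"
    then have "subst_poly (Var(v := q)) q' = q'"
      using insert.prems(1) by (intro subst_poly_ident) (auto split: if_splits)
    then show "subst_poly (Var(v := q)) (Var v - q') = q - q'"
      by (simp add: subst_poly_diff)
  qed simp
  have "(\<Prod>q'\<in>Q. q - q') * subst_poly (Var(v := q)) h = 0"
    using insert.prems(3)[OF insertI1] subst_q h(1) by (metis subst_poly_mult)
  moreover have "(\<Prod>q'\<in>Q. q - q') \<noteq> 0"
    using insert.hyps by auto
  ultimately have "subst_poly (Var(v := q)) h = 0"
    by simp
  with linear_factor_dvd[of v q h] obtain h' where h': "h = (Var v - q) * h'"
    by (auto elim: dvdE)
  have zero: "k v < card (insert q Q) \<longrightarrow> h' = 0"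
  proof (intro impI, rule ccontr)
    assume less: "k v < card (insert q Q)" and nz: "h' \<noteq> 0"
    have "0 < k v - card Q"
      using h(3)[of v] nz insert.prems(1)[of q]
      by (intro dle_cancel(2)[of v v q h']) (auto simp: h')
    with less insert.hyps show False by simp
  qed
  have card_q: "card {q'\<in>insert q Q. \<not> dle i q' 0} = card {q'\<in>Q. \<not> dle i q' 0} + (if dle i q 0 then 0 else 1)" for i
  proof -
    have "{q'\<in>insert q Q. \<not> dle i q' 0} = (if dle i q 0 then {q'\<in>Q. \<not> dle i q' 0} else insert q {q'\<in>Q. \<not> dle i q' 0})"
      by auto
    then show ?thesis using insert.hyps by simp
  qed
  have "dle i h' (k i - (if i = v then card (insert q Q) else card {q'\<in>insert q Q. \<not> dle i q' 0}))" for i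
  proof (cases "h' = 0")
    case False
    have "dle i h' (if i = v \<or> \<not> dle i q 0
      then k i - (if i = v then card Q else card {q\<in>Q. \<not> dle i q 0}) - 1
      else k i - (if i = v then card Q else card {q\<in>Q. \<not> dle i q 0}))"
      using h(3)[of i] insert.prems(1,2) False unfolding h'
      by (intro dle_cancel(1)) auto
    then show ?thesis
      by (rule dle_mono) (use insert.hyps in \<open>unfold card_q, auto\<close>)
  qed simp
  then show ?case
    using h(1) zero insert.hyps by (intro exI[of _ h']) (simp add: h' mult_ac)
qed

text \<open>Both sides have degree less than \<open>card N\<close> in \<open>X\<^sub>v\<close> and
  agree at all nodes, so their difference has too many roots.\<close>

lemma lagrange_interpolation:
  assumes "finite N" "dle v f n" "n < card N"
  shows "f = (\<Sum>z\<in>N. subst_poly (Var(v := Const z)) f * Const (1 / (\<Prod>u\<in>N - {z}. z - u)) *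
    (\<Prod>u\<in>N - {z}. Var v - Const u))"
    (is "f = ?g")
proof -
  let ?t = "\<lambda>z. subst_poly (Var(v := Const z)) f * Const (1 / (\<Prod>u\<in>N - {z}. z - u)) * (\<Prod>u\<in>N - {z}. Var v - Const u)"
  have "dle v (subst_poly (Var(v := Const z)) f) 0" for z
    using dle_subst_upd[OF assms(2) assms(2), of "Const z"] by simp
  moreover have "dle v (\<Prod>u\<in>N - {z}. Var v - Const u) (card N - 1)" if "z \<in> N" for z
    using dle_prod[of "N - {z}" v "\<lambda>u. Var v - Const u" "\<lambda>_. 1"] that assms(1)
    by (simp add: dle_diff)
  ultimately have t: "dle v (?t z) (card N - 1)" if "z \<in> N" for z
    using that by (intro dle_mult_le[where a = 0 and b = "card N - 1"] dle_mult_le[where a = 0 and b = 0]) auto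
  then have dle: "dle v (f - ?g) (card N - 1)"
    by (intro dle_diff dle_sum dle_mono[OF assms(2)]) (use assms(3) in auto)
  have root: "subst_poly (Var(v := Const z)) (f - ?g) = 0" if "z \<in> N" for z
  proof -
    have id: "subst_poly (Var(v := Const z)) (subst_poly (Var(v := Const u)) f) = subst_poly (Var(v := Const u)) f" for u
      unfolding subst_poly_subst by (rule arg_cong[of _ _ "\<lambda>g. subst_poly g f"]) auto
    have "subst_poly (Var(v := Const z)) (?t u) = (if u = z then subst_poly (Var(v := Const z)) f else 0)" if "u \<in> N" for u
    proof -
      have "(\<Prod>u'\<in>N - {u}. Const z - Const u') = Const (\<Prod>u'\<in>N - {u}. z - u')"
        by (simp add: Const_prod Const_diff)
      moreover have "(\<Prod>u'\<in>N - {u}. z - u') = 0" if "u \<noteq> z"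
        using that \<open>z \<in> N\<close> assms(1) by auto
      moreover have "(\<Prod>u'\<in>N - {z}. z - u') \<noteq> 0"
        using assms(1) by auto
      ultimately show ?thesis
        by (auto simp: subst_poly_mult id subst_poly_prod subst_poly_diff mult.assoc simp flip: Const_mult)
    qed
    then show ?thesis
      using that assms(1) by (simp add: subst_poly_diff subst_poly_sum)
  qed
  \<comment> \<open>The root count rests on the bound for \<open>v\<close>; the bounds for the other
    variables are just the actual degrees.\<close>
  let ?K = "\<lambda>i. if i = v then card N - 1 else Max (insert 0 ((\<lambda>m. Poly_Mapping.lookup m i) ` Poly_Mapping.keys (f - ?g)))"
  have "\<exists>h. f - ?g = (\<Prod>q\<in>Const ` N. Var v - q) * h \<and> (?K v < card (Const ` N) \<longrightarrow> h = 0) \<and>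
    (\<forall>i. dle i h (?K i - (if i = v then card (Const ` N) else card {q\<in>Const ` N. \<not> dle i q 0})))"
  proof (rule linear_roots)
    show "dle i (f - ?g) (?K i)" for i
      using dle by (auto simp: dle_def)
    show "subst_poly (Var(v := q)) (f - ?g) = 0" if "q \<in> Const ` N" for q
      using that root by blast
  qed (use assms(1) in auto)
  moreover have "card (Const ` N) = card N"
    by (intro card_image inj_onI) simp
  moreover have "card N - 1 < card N" using assms(3) by simp
  ultimately show ?thesis by auto
qed

section \<open>The ideal of the triple diagonals in the polynomial ring\<close>

text \<open>The variables outside \<open>W\<close> are specialised to pairwise distinct constants.\<close>

definition \<xi> :: "nat set \<Rightarrow> nat \<Rightarrow> mpoly" where
  "\<xi> W c = (if c \<in> W then Var c else Const (of_nat c))"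

text \<open>Third points \<open>c\<close> outside \<open>W\<close> are included: two free variables
  must not meet at a fixed constant either. Two fixed constants never meet, so these are all triple
  diagonals that survive the specialisation. The bound \<open>d\<close> depends on the variable
  because divisions lower it at one variable at a time.\<close>

definition vanishing :: "nat set \<Rightarrow> (nat \<Rightarrow> nat) \<Rightarrow> mpoly \<Rightarrow> bool" where
  "vanishing W d f \<longleftrightarrow> (\<forall>i. dle i f (if i \<in> W then d i else 0)) \<and>
    (\<forall>a\<in>W. \<forall>b\<in>W. \<forall>c\<in>{1..8}. a \<noteq> b \<longrightarrow> c \<noteq> a \<longrightarrow> c \<noteq> b \<longrightarrow> subst_poly (Var(a := \<xi> W c, b := \<xi> W c)) f = 0)"

definition quads :: "nat set set" where
  "quads = {S. S \<subseteq> {1..8} \<and> card S = 4}"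

lemma finite_quads [simp]: "finite quads"
  unfolding quads_def by (rule finite_subset[of _ "Pow {1..8}"]) auto

definition DW :: "nat set \<Rightarrow> nat set \<Rightarrow> mpoly" where
  "DW W S = subst_poly (\<xi> W) (D S)"

text \<open>The coefficients are scalars, since each \<open>DW W S\<close> already exhausts the
  degree bound 3 in every free variable.\<close>

definition span_D :: "nat set \<Rightarrow> mpoly \<Rightarrow> bool" where
  "span_D W f \<longleftrightarrow> (\<exists>c. f = (\<Sum>S\<in>quads. Const (c S) * DW W S))"

lemma span_D_0 [simp]: "span_D W 0"
  unfolding span_D_def by (rule exI[of _ "\<lambda>_. 0"]) simp

lemma span_D_add: "span_D W f \<Longrightarrow> span_D W g \<Longrightarrow> span_D W (f + g)"
  unfolding span_D_def
proof (elim exE)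
  fix c c' assume "f = (\<Sum>S\<in>quads. Const (c S) * DW W S)" "g = (\<Sum>S\<in>quads. Const (c' S) * DW W S)"
  then show "\<exists>c. f + g = (\<Sum>S\<in>quads. Const (c S) * DW W S)"
    by (intro exI[of _ "\<lambda>S. c S + c' S"]) (simp add: Const_add distrib_right sum.distrib)
qed

lemma span_D_Const: "span_D W f \<Longrightarrow> span_D W (Const k * f)"
  unfolding span_D_def
proof (elim exE)
  fix c assume "f = (\<Sum>S\<in>quads. Const (c S) * DW W S)"
  then show "\<exists>c. Const k * f = (\<Sum>S\<in>quads. Const (c S) * DW W S)"
    by (intro exI[of _ "\<lambda>S. k * c S"]) (simp add: Const_mult sum_distrib_left mult.assoc)
qed

lemma span_D_uminus: "span_D W f \<Longrightarrow> span_D W (- f)"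
  using span_D_Const[of W f "- 1"] by (simp add: Const_uminus)

lemma span_D_diff: "span_D W f \<Longrightarrow> span_D W g \<Longrightarrow> span_D W (f - g)"
  using span_D_add[of W f "- g"] span_D_uminus[of W g] by simp

lemma span_D_Const_cancel:
  assumes "span_D W (Const k * f)" "k \<noteq> 0"
  shows "span_D W f"
proof -
  have "Const (1 / k) * (Const k * f) = f"
    using assms(2) by (simp add: mult.assoc[symmetric] flip: Const_mult)
  with span_D_Const[OF assms(1), of "1 / k"] show ?thesis by simp
qed

lemma span_D_DW: "S \<in> quads \<Longrightarrow> span_D W (DW W S)"
  unfolding span_D_def
  by (rule exI[of _ "\<lambda>T. if T = S then 1 else 0"]) (simp add: if_distrib[of Const] if_distrib[of "\<lambda>c. c * _"] cong: if_cong)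

section \<open>Vandermonde form of the generators\<close>

definition vd :: "mpoly \<Rightarrow> mpoly \<Rightarrow> mpoly \<Rightarrow> mpoly \<Rightarrow> mpoly" where
  "vd a b c d = (a - b) * (a - c) * (a - d) * (b - c) * (b - d) * (c - d)"

lemma subst_poly_vd: "subst_poly f (vd a b c d) = vd (subst_poly f a) (subst_poly f b) (subst_poly f c) (subst_poly f d)"
  by (simp add: vd_def subst_poly_hom)

lemma vd_square:
  "(a - b) * (a - c) * (a - d) * ((b - a) * (b - c) * (b - d)) * ((c - a) * (c - b) * (c - d)) *
    ((d - a) * (d - b) * (d - c)) = vd a b c d * vd a b c d"
proof -
  have "b - a = - (a - b)" "c - a = - (a - c)" "d - a = - (a - d)" "c - b = - (b - c)" "d - b = - (b - d)"
    "d - c = - (c - d)" by simp_all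
  then show ?thesis
    unfolding vd_def by (simp only: mult_minus_left mult_minus_right minus_minus mult_ac)
qed

text \<open>Comparing squares identifies two products of differences up to a scalar without tracking
  the signs caused by their orderings. For \<open>s = - 1\<close> the factor involves the imaginary
  unit.\<close>

lemma square_eq_scaled:
  fixes p q :: mpoly
  assumes "p * p = Const s * (q * q)" "s = 1 \<or> s = - 1"
  shows "\<exists>k. k \<noteq> 0 \<and> q = Const k * p"
proof -
  obtain r where r: "r * r = s" "r \<noteq> 0"
    using assms(2) by (metis i_squared mult_1 mult_zero_left one_neq_zero zero_neq_neg_one)
  have "(p - Const r * q) * (p + Const r * q) = 0"
    using assms(1) by (simp add: algebra_simps flip: r(1)) (simp add: Const_mult)
  then consider "p = Const r * q" | "p = Const (- r) * q"
    by (auto simp: eq_neg_iff_add_eq_0 Const_uminus)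
  then show ?thesis
  proof cases
    case 1
    then show ?thesis using r(2)
      by (intro exI[of _ "1 / r"]) (simp add: mult.assoc[symmetric] flip: Const_mult)
  next
    case 2
    then show ?thesis using r(2)
      by (intro exI[of _ "- 1 / r"]) (simp add: mult.assoc[symmetric] Const_uminus flip: Const_mult)
  qed
qed

definition pair_prod :: "nat set \<Rightarrow> mpoly" where
  "pair_prod S = (\<Prod>(i, j)\<in>{(i, j). i \<in> S \<and> j \<in> S \<and> i < j}. Var i - Var j)"

text \<open>The product over all ordered pairs of different points is the square of
  \<open>vd\<close>, and up to sign also that of \<open>pair_prod\<close>, whatever the order of
  \<open>p, q, r, s\<close>.\<close>

lemma pair_prod_vd:
  assumes "distinct [p, q, r, s]"
  shows "\<exists>k. k \<noteq> 0 \<and> pair_prod {p, q, r, s} = Const k * vd (Var p) (Var q) (Var r) (Var s)"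
proof -
  let ?S = "{p, q, r, s}"
  let ?v = "\<lambda>(i, j). Var i - Var j"
  let ?up = "{(i, j). i \<in> ?S \<and> j \<in> ?S \<and> i < j}"
  have fin: "finite ?up" by (rule finite_subset[of _ "?S \<times> ?S"]) auto
  have "(\<Prod>i\<in>?S. \<Prod>j\<in>?S - {i}. Var i - Var j) = prod ?v (SIGMA i:?S. ?S - {i})"
    by (rule prod.Sigma) auto
  also have "(SIGMA i:?S. ?S - {i}) = ?up \<union> prod.swap ` ?up"
    by (auto simp: image_iff)
  also have "prod ?v \<dots> = prod ?v ?up * prod ?v (prod.swap ` ?up)"
    using fin by (intro prod.union_disjoint) auto
  also have "prod ?v (prod.swap ` ?up) = prod (?v \<circ> prod.swap) ?up"
    by (intro prod.reindex) (auto intro: inj_onI)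
  also have "\<dots> = prod (\<lambda>x. - 1 * ?v x) ?up"
    by (intro prod.cong) auto
  also have "\<dots> = (- 1) ^ card ?up * prod ?v ?up"
    unfolding prod.distrib by simp
  finally have "(\<Prod>i\<in>?S. \<Prod>j\<in>?S - {i}. Var i - Var j) = (- 1) ^ card ?up * (pair_prod ?S * pair_prod ?S)"
    by (simp add: pair_prod_def mult_ac)
  moreover have "?S - {p} = {q, r, s}" "?S - {q} = {p, r, s}" "?S - {r} = {p, q, s}" "?S - {s} = {p, q, r}"
    using assms by auto
  then have "(\<Prod>i\<in>?S. \<Prod>j\<in>?S - {i}. Var i - Var j)
    = (Var p - Var q) * (Var p - Var r) * (Var p - Var s) * ((Var q - Var p) * (Var q - Var r) * (Var q - Var s))
     * ((Var r - Var p) * (Var r - Var q) * (Var r - Var s)) * ((Var s - Var p) * (Var s - Var q) * (Var s - Var r))"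
    using assms by (simp add: mult.assoc)
  then have "(\<Prod>i\<in>?S. \<Prod>j\<in>?S - {i}. Var i - Var j) = vd (Var p) (Var q) (Var r) (Var s) * vd (Var p) (Var q) (Var r) (Var s)"
    by (simp only: vd_square)
  moreover have "(- 1 :: mpoly) ^ n = Const ((- 1) ^ n)" for n
    by (simp add: Const_power Const_uminus)
  ultimately show ?thesis
    by (intro square_eq_scaled[where s = "(- 1) ^ card ?up"]) (auto simp: neg_one_even_power neg_one_odd_power minus_one_power_iff)
qed

lemma D_pair_prod:
  assumes "S \<subseteq> {1..8}"
  shows "\<exists>k. k \<noteq> 0 \<and> D S = Const k * (pair_prod S * pair_prod ({1..8} - S))"
proof -
  let ?v = "\<lambda>(i, j). Var i - Var j"
  let ?same = "{(i, j). 1 \<le> i \<and> i < j \<and> j \<le> 8 \<and> (i \<in> S \<longleftrightarrow> j \<in> S)}"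
  let ?T = "{1..8} - S"
  have "finite S" using assms finite_subset by blast
  have "finite {(i, j). i \<in> A \<and> j \<in> A \<and> i < j}" if "finite A" for A :: "nat set"
    by (rule finite_subset[of _ "A \<times> A"]) (use that in auto)
  from this[of S] this[of ?T]
  have fin: "finite {(i, j). i \<in> S \<and> j \<in> S \<and> i < j}" "finite {(i, j). i \<in> ?T \<and> j \<in> ?T \<and> i < j}"
    using \<open>finite S\<close> by simp_all
  have "?same = {(i, j). i \<in> S \<and> j \<in> S \<and> i < j} \<union> {(i, j). i \<in> ?T \<and> j \<in> ?T \<and> i < j}"
    using assms by auto
  then have "prod ?v ?same = pair_prod S * pair_prod ?T"
    unfolding pair_prod_def using fin by (simp only:) (intro prod.union_disjoint, auto)
  moreover have "(\<Prod>(i, j)\<in>B. - 1) = Const ((- 1) ^ card B)" for B :: "(nat \<times> nat) set"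
    by (simp add: case_prod_unfold Const_power Const_uminus)
  ultimately show ?thesis
    using D_quotient(2)[OF assms] by (intro exI[of _ "(- 1) ^ card _"]) auto
qed

text \<open>Any enumeration of the two halves is allowed, so that every generator can later be
  written with its points in the convenient order.\<close>

lemma D_vd:
  assumes "distinct [p1, p2, p3, p4, q1, q2, q3, q4]" "{p1, p2, p3, p4, q1, q2, q3, q4} = {1..8}"
  shows "\<exists>k. k \<noteq> 0 \<and> D {p1, p2, p3, p4} =
    Const k * (vd (Var p1) (Var p2) (Var p3) (Var p4) * vd (Var q1) (Var q2) (Var q3) (Var q4))"
proof -
  have T: "{1..8} - {p1, p2, p3, p4} = {q1, q2, q3, q4}"
    unfolding assms(2)[symmetric] using assms(1) by auto
  have "{p1, p2, p3, p4} \<subseteq> {1..8}" unfolding assms(2)[symmetric] by auto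
  then obtain k where k: "k \<noteq> 0" "D {p1, p2, p3, p4} = Const k * (pair_prod {p1, p2, p3, p4} * pair_prod {q1, q2, q3, q4})"
    using D_pair_prod[of "{p1, p2, p3, p4}"] unfolding T by auto
  obtain k1 where k1: "k1 \<noteq> 0" "pair_prod {p1, p2, p3, p4} = Const k1 * vd (Var p1) (Var p2) (Var p3) (Var p4)"
    using pair_prod_vd[of p1 p2 p3 p4] assms(1) by auto
  obtain k2 where k2: "k2 \<noteq> 0" "pair_prod {q1, q2, q3, q4} = Const k2 * vd (Var q1) (Var q2) (Var q3) (Var q4)"
    using pair_prod_vd[of q1 q2 q3 q4] assms(1) by auto
  show ?thesis
    using k k1 k2 by (intro exI[of _ "k * k1 * k2"]) (simp add: Const_mult mult_ac)
qed

lemma span_D_vd: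
  assumes "distinct [p1, p2, p3, p4, q1, q2, q3, q4]" "{p1, p2, p3, p4, q1, q2, q3, q4} = {1..8}"
  shows "span_D W (vd (\<xi> W p1) (\<xi> W p2) (\<xi> W p3) (\<xi> W p4) * vd (\<xi> W q1) (\<xi> W q2) (\<xi> W q3) (\<xi> W q4))"
proof -
  obtain k where k: "k \<noteq> 0" "D {p1, p2, p3, p4} =
    Const k * (vd (Var p1) (Var p2) (Var p3) (Var p4) * vd (Var q1) (Var q2) (Var q3) (Var q4))"
    using D_vd[OF assms] by auto
  have "{p1, p2, p3, p4} \<in> quads"
    unfolding quads_def assms(2)[symmetric] using assms(1) by auto
  from span_D_DW[OF this, of W]
  have "span_D W (Const k * (vd (\<xi> W p1) (\<xi> W p2) (\<xi> W p3) (\<xi> W p4) * vd (\<xi> W q1) (\<xi> W q2) (\<xi> W q3) (\<xi> W q4)))"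
    unfolding DW_def k(2) by (simp add: subst_poly_mult subst_poly_vd)
  then show ?thesis by (rule span_D_Const_cancel[OF _ k(1)])
qed

lemma quads_explicit:
  assumes "S \<in> quads"
  obtains p1 p2 p3 p4 q1 q2 q3 q4 where "distinct [p1, p2, p3, p4, q1, q2, q3, q4]"
    "{p1, p2, p3, p4, q1, q2, q3, q4} = {1..8}" "S = {p1, p2, p3, p4}"
proof -
  have S: "S \<subseteq> {1..8}" "card S = 4" using assms by (auto simp: quads_def)
  then have fin: "finite S" using finite_subset by blast
  obtain ps where ps: "set ps = S" "distinct ps" using finite_distinct_list[OF fin] by auto
  obtain qs where qs: "set qs = {1..8} - S" "distinct qs" using finite_distinct_list[of "{1..8} - S"] by auto
  have "length ps = 4" using ps S distinct_card by metis
  then obtain p1 p2 p3 p4 where p: "ps = [p1, p2, p3, p4]"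
    by (auto simp: numeral_eq_Suc length_Suc_conv)
  have "length qs = 4" using qs S fin distinct_card[of qs] by (simp add: card_Diff_subset)
  then obtain q1 q2 q3 q4 where q: "qs = [q1, q2, q3, q4]"
    by (auto simp: numeral_eq_Suc length_Suc_conv)
  have "set (ps @ qs) = {1..8}" "distinct (ps @ qs)" using ps qs S by auto
  then show ?thesis using ps(1) unfolding p q by (intro that[of p1 p2 p3 p4 q1 q2 q3 q4]) auto
qed

abbreviation C :: "nat \<Rightarrow> mpoly" where "C i \<equiv> Const (of_nat i)"

lemma xi_in [simp]: "c \<in> W \<Longrightarrow> \<xi> W c = Var c" and xi_notin [simp]: "c \<notin> W \<Longrightarrow> \<xi> W c = C c"
  by (simp_all add: \<xi>_def)

lemma xi_inject [simp]: "\<xi> W c = \<xi> W c' \<longleftrightarrow> c = c'"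
  by (auto simp: \<xi>_def Var_inject)

lemma dle_exists: "\<exists>n. dle v f n"
proof -
  have "finite ((\<lambda>m. Poly_Mapping.lookup m v) ` Poly_Mapping.keys f)" by simp
  then obtain n where "\<forall>x\<in>(\<lambda>m. Poly_Mapping.lookup m v) ` Poly_Mapping.keys f. x \<le> n"
    using finite_nat_set_iff_bounded_le by blast
  then show ?thesis by (auto simp: dle_def)
qed

lemma dle_subst_Const: "dle i f k \<Longrightarrow> dle i (subst_poly (Var(v := Const z)) f) k"
proof -
  assume A: "dle i f k"
  obtain n where n: "dle v f n"
    using dle_exists by blast
  show ?thesis
    using dle_subst_upd[OF n A, of "Const z"] by (auto split: if_splits intro: dle_mono)
qed

lemma dle_subst_Const_same: "dle v (subst_poly (Var(v := Const z)) f) 0"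
proof -
  obtain n where n: "dle v f n"
    using dle_exists by blast
  show ?thesis
    using dle_subst_upd[OF n n, of "Const z"] by simp
qed

section \<open>Lagrange interpolation at two, three and four constant nodes\<close>

lemma affine_expand:
  assumes "dle v f 1" "a \<noteq> b"
  shows "\<exists>k l. f = Const k * subst_poly (Var(v := C a)) f * (Var v - C b)
    + Const l * subst_poly (Var(v := C b)) f * (Var v - C a)"
proof -
  let ?N = "{of_nat a, of_nat b :: complex}"
  have "?N - {of_nat a} = {of_nat b}" "?N - {of_nat b} = {of_nat a}" using assms(2) by auto
  note N = this
  define K where "K z = 1 / (\<Prod>u\<in>?N - {z}. z - u)" for z
  have "f = (\<Sum>z\<in>?N. subst_poly (Var(v := Const z)) f * Const (K z) * (\<Prod>u\<in>?N - {z}. Var v - Const u))"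
    unfolding K_def by (rule lagrange_interpolation[OF _ assms(1)]) (use assms(2) in auto)
  also have "\<dots> = Const (K (of_nat a)) * subst_poly (Var(v := C a)) f * (Var v - C b)
    + Const (K (of_nat b)) * subst_poly (Var(v := C b)) f * (Var v - C a)"
    using assms(2) by (simp add: N mult_ac)
  finally show ?thesis
    by (intro exI[of _ "K (of_nat a)"] exI[of _ "K (of_nat b)"])
qed

lemma quadratic_expand:
  assumes "dle v f 2" "distinct [a, b, c]"
  shows "\<exists>k l m. f = Const k * subst_poly (Var(v := C a)) f * ((Var v - C b) * (Var v - C c))
    + Const l * subst_poly (Var(v := C b)) f * ((Var v - C a) * (Var v - C c))
    + Const m * subst_poly (Var(v := C c)) f * ((Var v - C a) * (Var v - C b))"
proof -
  let ?N = "{of_nat a, of_nat b, of_nat c :: complex}"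
  have "?N - {of_nat a} = {of_nat b, of_nat c}" "?N - {of_nat b} = {of_nat a, of_nat c}"
    "?N - {of_nat c} = {of_nat a, of_nat b}" using assms(2) by auto
  note N = this
  define K where "K z = 1 / (\<Prod>u\<in>?N - {z}. z - u)" for z
  have "f = (\<Sum>z\<in>?N. subst_poly (Var(v := Const z)) f * Const (K z) * (\<Prod>u\<in>?N - {z}. Var v - Const u))"
    unfolding K_def by (rule lagrange_interpolation[OF _ assms(1)]) (use assms(2) in auto)
  also have "\<dots> = Const (K (of_nat a)) * subst_poly (Var(v := C a)) f * ((Var v - C b) * (Var v - C c))
    + Const (K (of_nat b)) * subst_poly (Var(v := C b)) f * ((Var v - C a) * (Var v - C c))
    + Const (K (of_nat c)) * subst_poly (Var(v := C c)) f * ((Var v - C a) * (Var v - C b))"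
    using assms(2) by (simp add: N mult_ac)
  finally show ?thesis
    by (intro exI[of _ "K (of_nat a)"] exI[of _ "K (of_nat b)"] exI[of _ "K (of_nat c)"])
qed

lemma cubic_expand:
  assumes "dle v f 3" "distinct [a, b, c, d]"
  shows "\<exists>k l m n. f = Const k * subst_poly (Var(v := C a)) f * ((Var v - C b) * (Var v - C c) * (Var v - C d))
    + Const l * subst_poly (Var(v := C b)) f * ((Var v - C a) * (Var v - C c) * (Var v - C d))
    + Const m * subst_poly (Var(v := C c)) f * ((Var v - C a) * (Var v - C b) * (Var v - C d))
    + Const n * subst_poly (Var(v := C d)) f * ((Var v - C a) * (Var v - C b) * (Var v - C c))"
proof -
  let ?N = "{of_nat a, of_nat b, of_nat c, of_nat d :: complex}"
  have "?N - {of_nat a} = {of_nat b, of_nat c, of_nat d}" "?N - {of_nat b} = {of_nat a, of_nat c, of_nat d}"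
    "?N - {of_nat c} = {of_nat a, of_nat b, of_nat d}" "?N - {of_nat d} = {of_nat a, of_nat b, of_nat c}"
    using assms(2) by auto
  note N = this
  define K where "K z = 1 / (\<Prod>u\<in>?N - {z}. z - u)" for z
  have "f = (\<Sum>z\<in>?N. subst_poly (Var(v := Const z)) f * Const (K z) * (\<Prod>u\<in>?N - {z}. Var v - Const u))"
    unfolding K_def by (rule lagrange_interpolation[OF _ assms(1)]) (use assms(2) in auto)
  also have "\<dots> = Const (K (of_nat a)) * subst_poly (Var(v := C a)) f * ((Var v - C b) * (Var v - C c) * (Var v - C d))
    + Const (K (of_nat b)) * subst_poly (Var(v := C b)) f * ((Var v - C a) * (Var v - C c) * (Var v - C d))
    + Const (K (of_nat c)) * subst_poly (Var(v := C c)) f * ((Var v - C a) * (Var v - C b) * (Var v - C d))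
    + Const (K (of_nat d)) * subst_poly (Var(v := C d)) f * ((Var v - C a) * (Var v - C b) * (Var v - C c))"
    using assms(2) by (simp add: N mult_ac)
  finally show ?thesis
    by (intro exI[of _ "K (of_nat a)"] exI[of _ "K (of_nat b)"] exI[of _ "K (of_nat c)"] exI[of _ "K (of_nat d)"])
qed

section \<open>The vanishing condition under specialisation, division and merging\<close>

lemma vanishingD:
  assumes "vanishing W d f"
  shows "i \<in> W \<Longrightarrow> dle i f (d i)" "i \<notin> W \<Longrightarrow> dle i f 0" "dle i f (if i \<in> W then d i else 0)"
    "a \<in> W \<Longrightarrow> b \<in> W \<Longrightarrow> c \<in> {1..8} \<Longrightarrow> a \<noteq> b \<Longrightarrow> c \<noteq> a \<Longrightarrow> c \<noteq> b \<Longrightarrow>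
      subst_poly (Var(a := \<xi> W c, b := \<xi> W c)) f = 0"
proof -
  show *: "dle i f (if i \<in> W then d i else 0)" for i
    using assms by (auto simp: vanishing_def)
  show "i \<in> W \<Longrightarrow> dle i f (d i)" "i \<notin> W \<Longrightarrow> dle i f 0"
    using *[of i] by simp_all
qed (use assms in \<open>auto simp: vanishing_def\<close>)

lemma vanishing_diff: "vanishing W d f \<Longrightarrow> vanishing W d g \<Longrightarrow> vanishing W d (f - g)"
  unfolding vanishing_def by (simp add: subst_poly_diff dle_diff)

lemma vanishing_sum: "(\<And>a. a \<in> A \<Longrightarrow> vanishing W d (g a)) \<Longrightarrow> vanishing W d (sum g A)"
  unfolding vanishing_def by (simp add: subst_poly_sum dle_sum)

lemma vanishing_mult:
  assumes "vanishing W d f" "\<And>i. dle i g (if i \<in> W then e i else 0)" "\<And>i. i \<in> W \<Longrightarrow> d i + e i \<le> n i"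
  shows "vanishing W n (f * g)"
  unfolding vanishing_def
proof (intro conjI allI ballI impI)
  show "dle i (f * g) (if i \<in> W then n i else 0)" for i
    using assms(2)[of i] assms(3)[of i] vanishingD(3)[OF assms(1), of i]
    by (intro dle_mult_le) auto
qed (simp add: subst_poly_mult vanishingD(4)[OF assms(1)])

lemma pair_prod_vanish:
  assumes "finite S" "i \<in> S" "j \<in> S" "i \<noteq> j" "\<phi> i = \<phi> j"
  shows "subst_poly \<phi> (pair_prod S) = 0"
proof -
  have fin: "finite {(i, j). i \<in> S \<and> j \<in> S \<and> i < j}"
    by (rule finite_subset[of _ "S \<times> S"]) (use assms(1) in auto)
  have "(min i j, max i j) \<in> {(i, j). i \<in> S \<and> j \<in> S \<and> i < j}"
    using assms by (auto simp: min_def max_def)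
  moreover have "subst_poly \<phi> (Var (min i j) - Var (max i j)) = 0"
    using assms(5) by (simp add: subst_poly_diff min_def max_def)
  ultimately show ?thesis
    unfolding pair_prod_def subst_poly_prod using fin
    by (intro prod_zero bexI[of _ "(min i j, max i j)"]) auto
qed

lemma D_vanish:
  assumes "S \<in> quads" "i \<in> {1..8}" "j \<in> {1..8}" "i \<noteq> j" "i \<in> S \<longleftrightarrow> j \<in> S" "\<phi> i = \<phi> j"
  shows "subst_poly \<phi> (D S) = 0"
proof -
  have S: "S \<subseteq> {1..8}" using assms(1) by (simp add: quads_def)
  then have "finite S" using finite_subset by blast
  then have "subst_poly \<phi> (pair_prod S) = 0 \<or> subst_poly \<phi> (pair_prod ({1..8} - S)) = 0"
    using pair_prod_vanish[of S i j \<phi>] pair_prod_vanish[of "{1..8} - S" i j \<phi>] assms by auto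
  then show ?thesis
    using D_pair_prod[OF S] by (auto simp: subst_poly_mult)
qed

lemma dle_xi: "dle i (\<xi> W p - \<xi> W q) (of_bool (i \<in> W \<and> i = p) + of_bool (i \<in> W \<and> i = q))"
proof -
  have "dle i (\<xi> W p) (of_bool (i \<in> W \<and> i = p))" for p
    by (auto simp: \<xi>_def)
  from this[of p] this[of q] show ?thesis by (intro dle_diff) (auto intro: dle_mono)
qed

lemma dle_vd_xi:
  fixes i W defines "a \<equiv> \<lambda>p. of_bool (i \<in> W \<and> i = p) :: nat"
  shows "dle i (vd (\<xi> W p) (\<xi> W q) (\<xi> W r) (\<xi> W s)) (3 * (a p + a q + a r + a s))"
proof -
  have "dle i (vd (\<xi> W p) (\<xi> W q) (\<xi> W r) (\<xi> W s))
    ((a p + a q) + (a p + a r) + (a p + a s) + (a q + a r) + (a q + a s) + (a r + a s))"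
    unfolding vd_def a_def by (intro dle_mult dle_xi)
  then show ?thesis by (rule dle_mono) simp
qed

text \<open>Each free variable meets exactly the three other points on its side of \<open>S\<close>;
  this is the degree 3.\<close>

lemma vanishing_DW:
  assumes "S \<in> quads" "W \<subseteq> {1..8}"
  shows "vanishing W (\<lambda>_. 3) (DW W S)"
  unfolding vanishing_def
proof (intro conjI allI ballI impI)
  fix i
  let ?a = "\<lambda>p. of_bool (i \<in> W \<and> i = p) :: nat"
  obtain p1 p2 p3 p4 q1 q2 q3 q4 where pq: "distinct [p1, p2, p3, p4, q1, q2, q3, q4]"
    "{p1, p2, p3, p4, q1, q2, q3, q4} = {1..8}" "S = {p1, p2, p3, p4}"
    using quads_explicit[OF assms(1)] .
  obtain k where k: "D S = Const k * (vd (Var p1) (Var p2) (Var p3) (Var p4) * vd (Var q1) (Var q2) (Var q3) (Var q4))"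
    using D_vd[OF pq(1,2)] pq(3) by auto
  have "dle i (DW W S) (0 + (3 * (?a p1 + ?a p2 + ?a p3 + ?a p4) + 3 * (?a q1 + ?a q2 + ?a q3 + ?a q4)))"
    unfolding DW_def k by (simp only: subst_poly_mult subst_poly_vd subst_poly_Var subst_poly_Const)
      (intro dle_mult dle_vd_xi dle_Const)
  moreover have "?a p1 + ?a p2 + ?a p3 + ?a p4 + ?a q1 + ?a q2 + ?a q3 + ?a q4 \<le> (if i \<in> W then 1 else 0)"
    using pq(1) by auto
  ultimately show "dle i (DW W S) (if i \<in> W then 3 else 0)"
    by (elim dle_mono) (auto split: if_splits)
next
  fix a b c
  assume A: "a \<in> W" "b \<in> W" "c \<in> {1..8}" "a \<noteq> b" "c \<noteq> a" "c \<noteq> b"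
  let ?\<phi> = "\<lambda>i. subst_poly (Var(a := \<xi> W c, b := \<xi> W c)) (\<xi> W i)"
  have \<phi>: "?\<phi> a = \<xi> W c" "?\<phi> b = \<xi> W c" "?\<phi> c = \<xi> W c"
    using A by (auto simp: \<xi>_def)
  consider "a \<in> S \<longleftrightarrow> b \<in> S" | "a \<in> S \<longleftrightarrow> c \<in> S" | "b \<in> S \<longleftrightarrow> c \<in> S" by blast
  then have "subst_poly ?\<phi> (D S) = 0"
  proof cases
    case 1 then show ?thesis using A assms(2) by (intro D_vanish[OF assms(1), of a b]) (auto simp only: \<phi>)
  next
    case 2 then show ?thesis using A assms(2) by (intro D_vanish[OF assms(1), of a c]) (auto simp only: \<phi>)
  next
    case 3 then show ?thesis using A assms(2) by (intro D_vanish[OF assms(1), of b c]) (auto simp only: \<phi>)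
  qed
  then show "subst_poly (Var(a := \<xi> W c, b := \<xi> W c)) (DW W S) = 0"
    by (simp add: DW_def subst_poly_subst)
qed

lemma span_D_vanishing:
  assumes "span_D W g" "W \<subseteq> {1..8}"
  shows "vanishing W (\<lambda>_. 3) g"
proof -
  obtain c where "g = (\<Sum>S\<in>quads. DW W S * Const (c S))"
    using assms(1) by (auto simp: span_D_def mult.commute)
  then show ?thesis
    using assms(2) by (auto intro!: vanishing_sum vanishing_mult[where e = "\<lambda>_. 0", OF vanishing_DW])
qed

lemma vanishing_restrict:
  assumes "vanishing W d f" "v \<in> W"
  shows "vanishing (W - {v}) d (subst_poly (Var(v := C v)) f)"
  unfolding vanishing_def
proof (intro conjI allI ballI impI)
  show "dle i (subst_poly (Var(v := C v)) f) (if i \<in> W - {v} then d i else 0)" for i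
    using dle_subst_Const[OF vanishingD(3)[OF assms(1), of i]] dle_subst_Const_same by auto
next
  fix a b c
  assume A: "a \<in> W - {v}" "b \<in> W - {v}" "c \<in> {1..8}" "a \<noteq> b" "c \<noteq> a" "c \<noteq> b"
  let ?q = "\<xi> (W - {v}) c"
  have "subst_poly (Var(a := ?q, b := ?q)) (subst_poly (Var(v := C v)) f)
    = subst_poly (Var(v := C v)) (subst_poly (Var(a := \<xi> W c, b := \<xi> W c)) f)"
    unfolding subst_poly_subst using A by (intro arg_cong[of _ _ "\<lambda>g. subst_poly g f"]) (auto simp: \<xi>_def)
  then show "subst_poly (Var(a := ?q, b := ?q)) (subst_poly (Var(v := C v)) f) = 0"
    using A vanishingD(4)[OF assms(1), of a b c] by simp
qed

lemma DW_restrict: "v \<in> W \<Longrightarrow> subst_poly (Var(v := C v)) (DW W S) = DW (W - {v}) S"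
  unfolding DW_def subst_poly_subst by (rule arg_cong[of _ _ "\<lambda>g. subst_poly g (D S)"]) (auto simp: \<xi>_def)

text \<open>On a triple diagonal \<open>X\<^sub>v\<close> is never replaced by the constant
  \<open>v\<close>, because the third point differs from \<open>v\<close>. So the factor stays
  nonzero there and the quotient inherits the vanishing.\<close>

lemma vanishing_cancel:
  assumes "vanishing W d ((Var v - C v) * f)" "v \<in> W"
  shows "vanishing W (d(v := d v - 1)) f"
proof (cases "f = 0")
  case True
  then show ?thesis by (simp add: vanishing_def)
next
  case False
  show ?thesis
    unfolding vanishing_def
  proof (intro conjI allI ballI impI)
    show "dle i f (if i \<in> W then (d(v := d v - 1)) i else 0)" for i
      using dle_cancel(1)[of i v "C v" f "if i \<in> W then d i else 0"] vanishingD(3)[OF assms(1), of i] assms(2) False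
      by (auto split: if_splits)
  next
    fix a b c
    assume A: "a \<in> W" "b \<in> W" "c \<in> {1..8}" "a \<noteq> b" "c \<noteq> a" "c \<noteq> b"
    have "subst_poly (Var(a := \<xi> W c, b := \<xi> W c)) (Var v - C v) \<noteq> 0"
      using A by (auto simp: subst_poly_diff \<xi>_def)
    with vanishingD(4)[OF assms(1) A] show "subst_poly (Var(a := \<xi> W c, b := \<xi> W c)) f = 0"
      by (simp add: subst_poly_mult)
  qed
qed

text \<open>The 6 counts the points other than \<open>a\<close> and \<open>b\<close>; each is a root
  in \<open>X\<^sub>b\<close>. If such a point \<open>i\<close> is free, its factor also contains
  \<open>X\<^sub>i\<close>, whence \<open>d i - 1\<close>.\<close>

lemma vanishing_merge:
  assumes f: "vanishing W d f" and W: "W \<subseteq> {1..8}" and ab: "a \<in> W" "b \<in> W" "a \<noteq> b"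
  shows "\<exists>h. subst_poly (Var(a := Var b)) f = (\<Prod>c\<in>{1..8} - {a, b}. Var b - \<xi> W c) * h \<and>
    (d a + d b < 6 \<longrightarrow> h = 0) \<and>
    (\<forall>i. dle i h (if i = b then d a + d b - 6 else if i \<in> W - {a} then d i - 1 else 0))"
proof -
  let ?Q = "\<xi> W ` ({1..8} - {a, b})"
  let ?f = "subst_poly (Var(a := Var b)) f"
  let ?k = "\<lambda>i. if i = b then d a + d b else if i \<in> W - {a} then d i else 0"
  have inj: "inj_on (\<xi> W) X" for X by (auto intro: inj_onI)
  have "card ({1..8} - {a, b}) = 6"
    using ab W by (subst card_Diff_subset) auto
  then have card_Q: "card ?Q = 6" by (simp add: card_image[OF inj])
  have k: "dle i ?f (?k i)" for i
    using dle_subst_upd[OF vanishingD(3)[OF f, of a] vanishingD(3)[OF f, of i], of "Var b"] ab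
    by (cases "i = b"; cases "i = a") (auto split: if_splits)
  have "\<exists>h. ?f = (\<Prod>q\<in>?Q. Var b - q) * h \<and> (?k b < card ?Q \<longrightarrow> h = 0) \<and>
    (\<forall>i. dle i h (?k i - (if i = b then card ?Q else card {q\<in>?Q. \<not> dle i q 0})))"
  proof (rule linear_roots)
    show "subst_poly (Var(b := q)) ?f = 0" if "q \<in> ?Q" for q
    proof -
      from that obtain c where c: "q = \<xi> W c" "c \<in> {1..8}" "c \<noteq> a" "c \<noteq> b" by blast
      have "subst_poly (Var(b := q)) ?f = subst_poly (Var(a := q, b := q)) f"
        unfolding subst_poly_subst by (rule arg_cong[of _ _ "\<lambda>g. subst_poly g f"]) (use ab in auto)
      then show ?thesis using vanishingD(4)[OF f ab(1,2) c(2) ab(3)] c by simp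
    qed
    show "dle i q (Suc 0)" if "q \<in> ?Q" for q i
      using that dle_mono[OF dle_Var, of i _ "Suc 0"] by (auto simp: \<xi>_def)
    show "dle b q 0" if "q \<in> ?Q" for q
      using that by (auto simp: \<xi>_def)
    show "dle i ?f (?k i)" for i by (rule k)
  qed simp
  then obtain h where h: "?f = (\<Prod>q\<in>?Q. Var b - q) * h" "?k b < 6 \<longrightarrow> h = 0"
    "\<And>i. dle i h (?k i - (if i = b then 6 else card {q\<in>?Q. \<not> dle i q 0}))"
    unfolding card_Q by blast
  have "dle i h (if i = b then d a + d b - 6 else if i \<in> W - {a} then d i - 1 else 0)" for i
  proof (cases "i \<in> W - {a, b}")
    case True
    then have "\<not> dle i (\<xi> W i) 0" "i \<in> {1..8} - {a, b}"
      using W by auto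
    then have "\<xi> W i \<in> {q\<in>?Q. \<not> dle i q 0}"
      by blast
    then have "{q\<in>?Q. \<not> dle i q 0} \<noteq> {}" "finite {q\<in>?Q. \<not> dle i q 0}"
      by (blast, simp)
    then have "1 \<le> card {q\<in>?Q. \<not> dle i q 0}"
      by (simp add: Suc_le_eq card_gt_0_iff)
    then show ?thesis
      using True by (intro dle_mono[OF h(3)[of i]]) auto
  next
    case False
    then show ?thesis using ab by (intro dle_mono[OF h(3)[of i]]) auto
  qed
  moreover have "(\<Prod>q\<in>?Q. Var b - q) = (\<Prod>c\<in>{1..8} - {a, b}. Var b - \<xi> W c)"
    by (simp add: prod.reindex[OF inj])
  ultimately show ?thesis
    using h(1,2) by (intro exI[of _ h]) auto
qed

lemma complement_list:
  assumes "distinct ws" "set ws \<subseteq> {1..8::nat}"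
  shows "\<exists>xs. distinct (ws @ xs) \<and> set (ws @ xs) = {1..8} \<and> length xs = 8 - length ws"
proof -
  obtain xs where xs: "set xs = {1..8} - set ws" "distinct xs" using finite_distinct_list[of "{1..8} - set ws"] by auto
  moreover from this have "length xs = 8 - length ws"
    using assms distinct_card[of xs] distinct_card[of ws] by (simp add: card_Diff_subset)
  ultimately show ?thesis using assms by (intro exI[of _ xs]) auto
qed

lemma xi_explicit [simp]:
  "x \<noteq> p \<Longrightarrow> \<xi> {x} p = C p" "x \<noteq> p \<Longrightarrow> y \<noteq> p \<Longrightarrow> \<xi> {x, y} p = C p"
  "x \<noteq> p \<Longrightarrow> y \<noteq> p \<Longrightarrow> w \<noteq> p \<Longrightarrow> \<xi> {x, y, w} p = C p"
  by (simp_all add: \<xi>_def)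

lemma span_D_times_Const:
  assumes "span_D W g" "\<And>i. dle i p 0"
  shows "span_D W (g * p)" "span_D W (p * g)"
proof -
  obtain c where "p = Const c" using dle_0_imp_Const[OF assms(2)] by blast
  then show "span_D W (p * g)" using span_D_Const[OF assms(1), of c] by simp
  then show "span_D W (g * p)" by (simp only: mult.commute)
qed

text \<open>Interpolation inside the span: with a fixed multiplier \<open>M\<close>, the variables
  of the cofactor are replaced by nodes one at a time until only a constant is left.\<close>

lemma affine_span:
  assumes "dle v f 1" "a \<noteq> b"
    "span_D W (M * (Var v - C b) * subst_poly (Var(v := C a)) f)"
    "span_D W (M * (Var v - C a) * subst_poly (Var(v := C b)) f)"
  shows "span_D W (M * f)"
proof -
  obtain k l where "f = Const k * subst_poly (Var(v := C a)) f * (Var v - C b)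
    + Const l * subst_poly (Var(v := C b)) f * (Var v - C a)"
    using affine_expand[OF assms(1,2)] by blast
  then have "M * f = M * (Const k * subst_poly (Var(v := C a)) f * (Var v - C b)
    + Const l * subst_poly (Var(v := C b)) f * (Var v - C a))" by (rule arg_cong)
  also have "\<dots> = Const k * (M * (Var v - C b) * subst_poly (Var(v := C a)) f)
    + Const l * (M * (Var v - C a) * subst_poly (Var(v := C b)) f)"
    by (simp only: distrib_left mult_ac)
  also have "span_D W \<dots>" using assms(3,4) by (intro span_D_add span_D_Const)
  finally show ?thesis .
qed

lemma quadratic_span:
  assumes "dle v f 2" "distinct [a, b, c]"
    "span_D W (M * ((Var v - C b) * (Var v - C c)) * subst_poly (Var(v := C a)) f)"
    "span_D W (M * ((Var v - C a) * (Var v - C c)) * subst_poly (Var(v := C b)) f)"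
    "span_D W (M * ((Var v - C a) * (Var v - C b)) * subst_poly (Var(v := C c)) f)"
  shows "span_D W (M * f)"
proof -
  obtain k l m where "f = Const k * subst_poly (Var(v := C a)) f * ((Var v - C b) * (Var v - C c))
    + Const l * subst_poly (Var(v := C b)) f * ((Var v - C a) * (Var v - C c))
    + Const m * subst_poly (Var(v := C c)) f * ((Var v - C a) * (Var v - C b))"
    using quadratic_expand[OF assms(1,2)] by blast
  then have "M * f = M * (Const k * subst_poly (Var(v := C a)) f * ((Var v - C b) * (Var v - C c))
    + Const l * subst_poly (Var(v := C b)) f * ((Var v - C a) * (Var v - C c))
    + Const m * subst_poly (Var(v := C c)) f * ((Var v - C a) * (Var v - C b)))" by (rule arg_cong)
  also have "\<dots> = Const k * (M * ((Var v - C b) * (Var v - C c)) * subst_poly (Var(v := C a)) f)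
    + Const l * (M * ((Var v - C a) * (Var v - C c)) * subst_poly (Var(v := C b)) f)
    + Const m * (M * ((Var v - C a) * (Var v - C b)) * subst_poly (Var(v := C c)) f)"
    by (simp only: distrib_left mult_ac)
  also have "span_D W \<dots>" using assms(3-5) by (intro span_D_add span_D_Const)
  finally show ?thesis .
qed

section \<open>The specialised problem in at most three free variables\<close>

lemma span_D_0vars:
  assumes "vanishing {} d f"
  shows "span_D {} f"
proof -
  let ?k = "\<lambda>a b. (of_nat a - of_nat b) :: complex"
  let ?K = "\<lambda>a b c d. ?k a b * ?k a c * ?k a d * ?k b c * ?k b d * ?k c d"
  have K: "vd (C a) (C b) (C c) (C d) = Const (?K a b c d)" for a b c d
    by (simp add: vd_def Const_mult Const_diff)
  \<comment> \<open>With all points fixed, any \<open>D S\<close> becomes a nonzero constant; this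
    \<open>S\<close> is an arbitrary choice.\<close>
  have "span_D {} (vd (\<xi> {} 1) (\<xi> {} 2) (\<xi> {} 3) (\<xi> {} 4) * vd (\<xi> {} 5) (\<xi> {} 6) (\<xi> {} 7) (\<xi> {} 8))"
    by (rule span_D_vd) auto
  then have "span_D {} (Const (?K 1 2 3 4 * ?K 5 6 7 8) * 1)"
    by (simp only: xi_notin empty_iff not_False_eq_True K Const_mult mult_1_right)
  then have one: "span_D {} 1"
    by (rule span_D_Const_cancel) simp
  have "dle i f 0" for i using vanishingD(2)[OF assms] by simp
  from span_D_times_Const(1)[OF one this] show ?thesis by simp
qed

lemma span_D_1var_gen:
  assumes "distinct [x, a, b, c, q1, q2, q3, q4]" "{x, a, b, c, q1, q2, q3, q4} = {1..8}"
  shows "span_D {x} ((Var x - C a) * (Var x - C b) * (Var x - C c))"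
proof -
  let ?k = "\<lambda>a b. (of_nat a - of_nat b) :: complex"
  have "span_D {x} (vd (Var x) (C a) (C b) (C c) * vd (C q1) (C q2) (C q3) (C q4))"
    using span_D_vd[OF assms, of "{x}"] assms(1) by simp
  also have "vd (Var x) (C a) (C b) (C c) * vd (C q1) (C q2) (C q3) (C q4) =
    Const (?k a b * ?k a c * ?k b c * (?k q1 q2 * ?k q1 q3 * ?k q1 q4 * ?k q2 q3 * ?k q2 q4 * ?k q3 q4)) *
      ((Var x - C a) * (Var x - C b) * (Var x - C c))"
    by (simp only: vd_def Const_mult Const_diff mult_ac)
  finally show ?thesis
    by (rule span_D_Const_cancel) (use assms(1) in simp)
qed

text \<open>The generators provide all products of three of the seven linear factors; four of these
  products form the Lagrange basis of the cubics for the nodes \<open>a, b, c, d\<close>.\<close>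

lemma span_D_1var:
  assumes f: "vanishing {x} (\<lambda>_. 3) f" and x: "x \<in> {1..8}"
  shows "span_D {x} f"
proof -
  obtain xs where xs: "distinct ([x] @ xs)" "set ([x] @ xs) = {1..8}" "length xs = 7"
    using complement_list[of "[x]"] x by auto
  then obtain a b c d e g h where xs': "xs = [a, b, c, d, e, g, h]"
    by (auto simp: numeral_eq_Suc length_Suc_conv)
  have dist: "distinct [x, a, b, c, d, e, g, h]" and all: "{x, a, b, c, d, e, g, h} = {1..8}"
    using xs(1,2) unfolding xs' by (simp_all only: append_Cons append_Nil list.set)
  have const: "dle i (subst_poly (Var(x := C u)) f) 0" for i u
    using dle_subst_Const_same[of x] dle_subst_Const[OF vanishingD(2)[OF f, of i]] by (cases "i = x") auto
  have gen: "span_D {x} (Const k * subst_poly (Var(x := C u)) f * ((Var x - C p) * (Var x - C q) * (Var x - C r)))"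
    if "distinct [x, p, q, r, s1, s2, s3, s4]" "{x, p, q, r, s1, s2, s3, s4} = {x, a, b, c, d, e, g, h}" for k u p q r s1 s2 s3 s4
  proof -
    have "span_D {x} ((Var x - C p) * (Var x - C q) * (Var x - C r))"
      by (rule span_D_1var_gen[OF that(1)]) (simp only: that(2) all)
    then show ?thesis
      unfolding mult.assoc[of "Const k"] by (rule span_D_Const[OF span_D_times_Const(2)[OF _ const]])
  qed
  obtain k l m n where "f = Const k * subst_poly (Var(x := C a)) f * ((Var x - C b) * (Var x - C c) * (Var x - C d))
    + Const l * subst_poly (Var(x := C b)) f * ((Var x - C a) * (Var x - C c) * (Var x - C d))
    + Const m * subst_poly (Var(x := C c)) f * ((Var x - C a) * (Var x - C b) * (Var x - C d))
    + Const n * subst_poly (Var(x := C d)) f * ((Var x - C a) * (Var x - C b) * (Var x - C c))"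
    using cubic_expand[of x f a b c d] vanishingD(1)[OF f, of x] dist by auto
  also have "span_D {x} \<dots>"
    using dist
    by (intro span_D_add gen[of b c d a e g h] gen[of a c d b e g h] gen[of a b d c e g h] gen[of a b c d e g h]) auto
  finally show ?thesis .
qed

text \<open>These generators come from the \<open>S\<close> that separate the two free
  points.\<close>

lemma span_D_2var_gen:
  assumes "distinct [x, y, a, b, c, d, e, g]" "{x, y, a, b, c, d, e, g} = {1..8}"
  shows "span_D {x, y} ((Var x - C a) * (Var x - C b) * (Var x - C c) * ((Var y - C d) * (Var y - C e) * (Var y - C g)))"
proof -
  let ?k = "\<lambda>a b. (of_nat a - of_nat b) :: complex"
  have "span_D {x, y} (vd (\<xi> {x, y} x) (\<xi> {x, y} a) (\<xi> {x, y} b) (\<xi> {x, y} c) *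
      vd (\<xi> {x, y} y) (\<xi> {x, y} d) (\<xi> {x, y} e) (\<xi> {x, y} g))"
    by (rule span_D_vd) (use assms in auto)
  then have "span_D {x, y} (vd (Var x) (C a) (C b) (C c) * vd (Var y) (C d) (C e) (C g))"
    using assms(1) by simp
  also have "vd (Var x) (C a) (C b) (C c) * vd (Var y) (C d) (C e) (C g) =
    Const (?k a b * ?k a c * ?k b c * (?k d e * ?k d g * ?k e g)) *
      ((Var x - C a) * (Var x - C b) * (Var x - C c) * ((Var y - C d) * (Var y - C e) * (Var y - C g)))"
    by (simp only: vd_def Const_mult Const_diff mult_ac)
  finally show ?thesis
    by (rule span_D_Const_cancel) (use assms(1) in simp)
qed

lemma swap_identity:
  "p * q * (x - c) * (r * s * (y - g)) - p * q * (x - g) * (r * s * (y - c)) = (c - g) * ((x - y) * (p * q) * (r * s))"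
  for c g x y :: mpoly
  by (simp add: algebra_simps)

text \<open>Exchanging \<open>c\<close> and \<open>g\<close> between the two sides changes a
  separating generator by a multiple of \<open>X\<^sub>x - X\<^sub>y\<close>; this produces elements
  that vanish on the diagonal.\<close>

lemma span_D_2var_gen':
  assumes "distinct [x, y, a, b, c, d, e, g]" "{x, y, a, b, c, d, e, g} = {1..8}"
  shows "span_D {x, y} ((Var x - Var y) * ((Var x - C a) * (Var x - C b)) * ((Var y - C d) * (Var y - C e)))"
proof -
  let ?g = "(Var x - Var y) * ((Var x - C a) * (Var x - C b)) * ((Var y - C d) * (Var y - C e))"
  have "span_D {x, y} ((Var x - C a) * (Var x - C b) * (Var x - C c) * ((Var y - C d) * (Var y - C e) * (Var y - C g))
    - (Var x - C a) * (Var x - C b) * (Var x - C g) * ((Var y - C d) * (Var y - C e) * (Var y - C c)))"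
    by (intro span_D_diff span_D_2var_gen) (use assms in auto)
  also have "\<dots> = Const (of_nat c - of_nat g) * ?g"
    unfolding Const_diff by (rule swap_identity)
  finally show ?thesis
    by (rule span_D_Const_cancel) (use assms(1) in simp)
qed

text \<open>On the diagonal only a scalar multiple of the product of six differences is possible,
  and a separating generator realises it. What remains is \<open>X\<^sub>x - X\<^sub>y\<close> times
  a polynomial of degree 2 in both variables, interpolated at three nodes in each.\<close>

lemma span_D_2vars:
  assumes f: "vanishing {x, y} (\<lambda>_. 3) f" and xy: "x \<noteq> y" "{x, y} \<subseteq> {1..8}"
  shows "span_D {x, y} f"
proof -
  let ?W = "{x, y}"
  obtain xs where xs: "distinct ([x, y] @ xs)" "set ([x, y] @ xs) = {1..8}" "length xs = 6"
    using complement_list[of "[x, y]"] xy by auto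
  then obtain a b c d e g where xs': "xs = [a, b, c, d, e, g]"
    by (auto simp: numeral_eq_Suc length_Suc_conv)
  have dist: "distinct [x, y, a, b, c, d, e, g]" and all: "{x, y, a, b, c, d, e, g} = {1..8}"
    using xs(1,2) unfolding xs' by (simp_all only: append_Cons append_Nil list.set)
  have rest: "{1..8} - ?W = {a, b, c, d, e, g}"
    unfolding all[symmetric] using dist by auto
  obtain h where h: "subst_poly (Var(x := Var y)) f = (\<Prod>c\<in>{1..8} - {x, y}. Var y - \<xi> ?W c) * h"
    "\<And>i. dle i h (if i = y then 3 + 3 - 6 else if i \<in> ?W - {x} then 3 - 1 else 0)"
    using vanishing_merge[OF f xy(2), of x y] xy(1) by auto
  have "dle i h 0" for i using h(2)[of i] by (auto split: if_splits)
  then obtain k where k: "h = Const k" using dle_0_imp_Const by blast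
  define f0 where "f0 = Const k * ((Var x - C a) * (Var x - C b) * (Var x - C c) * ((Var y - C d) * (Var y - C e) * (Var y - C g)))"
  have f0: "span_D ?W f0"
    unfolding f0_def by (intro span_D_Const span_D_2var_gen dist all)
  have "subst_poly (Var(x := Var y)) f0 = subst_poly (Var(x := Var y)) f"
    unfolding h(1) k rest f0_def using dist xy(1)
    by (simp add: subst_poly_hom mult_ac)
  then have zero: "subst_poly (Var(x := Var y)) (f - f0) = 0" by (simp add: subst_poly_diff)
  have "\<exists>h. f - f0 = (\<Prod>q\<in>{Var y}. Var x - q) * h \<and> ((if x \<in> ?W then 3 else 0) < card {Var y} \<longrightarrow> h = 0) \<and>
    (\<forall>i. dle i h ((if i \<in> ?W then 3 else 0) - (if i = x then card {Var y} else card {q\<in>{Var y}. \<not> dle i q 0})))"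
  proof (rule linear_roots)
    show "dle i (f - f0) (if i \<in> ?W then 3 else 0)" for i
      by (rule vanishingD(3)[OF vanishing_diff[OF f span_D_vanishing[OF f0 xy(2)]]])
    show "dle i q (Suc 0)" if "q \<in> {Var y}" for q i
      using that dle_mono[OF dle_Var, of i y "Suc 0"] by auto
  qed (use xy zero in auto)
  then obtain h' where h': "f - f0 = (Var x - Var y) * h'"
    and dle': "\<And>i. dle i h' ((if i \<in> ?W then 3 else 0) - (if i = x then card {Var y} else card {q\<in>{Var y}. \<not> dle i q 0}))"
    by auto
  have y1: "{q. q = Var y \<and> \<not> dle y q 0} = {Var y}" by auto
  have dle_h': "dle x h' 2" "dle y h' 2" "i \<notin> ?W \<Longrightarrow> dle i h' 0" for i
    using dle'[of x] dle'[of y] dle'[of i] xy(1) by (auto simp: y1)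
  have "span_D ?W ((Var x - Var y) * h')"
  proof -
    have const: "dle i (subst_poly (Var(y := C u)) (subst_poly (Var(x := C v)) h')) 0" for i u v
      using dle_h'(3)[of i] dle_subst_Const_same
      by (cases "i = x"; cases "i = y") (auto intro: dle_subst_Const)
    \<comment> \<open>The nodes for \<open>x\<close> and for \<open>y\<close> come from disjoint
      triples. Each basis product omits one point of either triple, and these two are the pair
      exchanged in \<open>span_D_2var_gen'\<close>.\<close>
    have gen: "span_D ?W ((Var x - Var y) * ((Var x - C p) * (Var x - C q)) * ((Var y - C r) * (Var y - C s)) *
      subst_poly (Var(y := C u)) (subst_poly (Var(x := C v)) h'))"
      if "distinct [x, y, p, q, t, r, s, t']" "{x, y, p, q, t, r, s, t'} = {x, y, a, b, c, d, e, g}" for p q r s u v t t'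
    proof (rule span_D_times_Const(1)[OF _ const])
      show "span_D ?W ((Var x - Var y) * ((Var x - C p) * (Var x - C q)) * ((Var y - C r) * (Var y - C s)))"
        by (rule span_D_2var_gen'[OF that(1)]) (simp only: that(2) all)
    qed
    have gen': "span_D ?W ((Var x - Var y) * ((Var x - C p) * (Var x - C q)) * subst_poly (Var(x := C v)) h')"
      if "distinct [x, y, p, q, v, d, e, g]" "{x, y, p, q, v, d, e, g} = {x, y, a, b, c, d, e, g}" for p q v
    proof (rule quadratic_span[of y _ d e g])
      show "dle y (subst_poly (Var(x := C v)) h') 2" by (rule dle_subst_Const[OF dle_h'(2)])
      show "distinct [d, e, g]" using dist by simp
    qed (rule gen[of p q v e g d] gen[of p q v d g e] gen[of p q v d e g]; use that in auto)+
    show ?thesis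
    proof (rule quadratic_span[of x _ a b c])
      show "distinct [a, b, c]" using dist by simp
    qed (rule dle_h'(1) gen'[of b c a] gen'[of a c b] gen'[of a b c]; use dist in auto)+
  qed
  with f0 have "span_D ?W (f0 + (Var x - Var y) * h')" by (rule span_D_add)
  also have "f0 + (Var x - Var y) * h' = f" by (simp flip: h')
  finally show ?thesis .
qed

text \<open>Obtained from the \<open>S\<close> that contains two free and two fixed points.\<close>

lemma span_D_3var_gen:
  assumes "W = {x, y, w}" "distinct [x, y, w, a, b, c, d, e]" "{x, y, w, a, b, c, d, e} = {1..8}"
  shows "span_D W ((Var x - Var y) * ((Var x - C a) * (Var x - C b)) * ((Var y - C a) * (Var y - C b)) *
    ((Var w - C c) * (Var w - C d) * (Var w - C e)))" (is "span_D W ?g")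
proof -
  let ?k = "\<lambda>a b. (of_nat a - of_nat b) :: complex"
  have "span_D W (vd (\<xi> W x) (\<xi> W y) (\<xi> W a) (\<xi> W b) * vd (\<xi> W w) (\<xi> W c) (\<xi> W d) (\<xi> W e))"
    by (rule span_D_vd) (use assms in auto)
  then have "span_D W (vd (Var x) (Var y) (C a) (C b) * vd (Var w) (C c) (C d) (C e))"
    using assms(2) by (simp add: assms(1))
  also have "vd (Var x) (Var y) (C a) (C b) * vd (Var w) (C c) (C d) (C e) =
    Const (?k a b * (?k c d * ?k c e * ?k d e)) * ?g"
    by (simp only: vd_def Const_mult Const_diff mult_ac)
  finally show ?thesis
    by (rule span_D_Const_cancel) (use assms(2) in simp)
qed

text \<open>Obtained from the \<open>S\<close> that contains all three free points.\<close>

lemma span_D_3var_gen_same: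
  assumes "W = {x, y, w}" "distinct [x, y, w, a, b, c, d, e]" "{x, y, w, a, b, c, d, e} = {1..8}"
  shows "span_D W ((Var x - Var y) * (Var x - Var w) * (Var y - Var w) *
    (Var x - C a) * (Var y - C a) * (Var w - C a))" (is "span_D W ?g")
proof -
  let ?k = "\<lambda>a b. (of_nat a - of_nat b) :: complex"
  have "span_D W (vd (\<xi> W x) (\<xi> W y) (\<xi> W w) (\<xi> W a) * vd (\<xi> W b) (\<xi> W c) (\<xi> W d) (\<xi> W e))"
    by (rule span_D_vd) (use assms in auto)
  then have "span_D W (vd (Var x) (Var y) (Var w) (C a) * vd (C b) (C c) (C d) (C e))"
    using assms(2) by (simp add: assms(1))
  also have "vd (Var x) (Var y) (Var w) (C a) * vd (C b) (C c) (C d) (C e) =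
    Const (?k b c * ?k b d * ?k b e * ?k c d * ?k c e * ?k d e) * ?g"
    by (simp only: vd_def Const_mult Const_diff mult_ac)
  finally show ?thesis
    by (rule span_D_Const_cancel) (use assms(2) in simp)
qed

text \<open>The identity is Lagrange interpolation at \<open>b, c, d\<close> of the quadratic polynomial
  \<open>t \<mapsto> (x - t) (y - t)\<close>, evaluated at \<open>w\<close>.\<close>

lemma span_D_3var_gen_two:
  assumes "W = {x, y, w}" "distinct [x, y, w, a, b, c, d, e]" "{x, y, w, a, b, c, d, e} = {1..8}"
  shows "span_D W ((Var x - Var y) * (Var x - Var w) * (Var y - Var w) *
    (Var x - C a) * (Var y - C a) * (Var w - C e))" (is "span_D W ?g")
proof -
  let ?k = "\<lambda>a b. (of_nat a - of_nat b) :: complex"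
  let ?T = "\<lambda>b c d. (Var x - Var y) * ((Var x - C a) * (Var x - C b)) * ((Var y - C a) * (Var y - C b)) *
    ((Var w - C c) * (Var w - C d) * (Var w - C e))"
  have "span_D W (Const (?k c d) * ?T b c d + Const (?k d b) * ?T c d b + Const (?k b c) * ?T d b c)"
    by (intro span_D_add span_D_Const span_D_3var_gen) (use assms in auto)
  also have "Const (?k c d) * ?T b c d + Const (?k d b) * ?T c d b + Const (?k b c) * ?T d b c =
    (Var x - Var y) * (Var x - C a) * (Var y - C a) * (Var w - C e) *
    ((C c - C d) * ((Var x - C b) * (Var y - C b) * (Var w - C c) * (Var w - C d)) +
     (C d - C b) * ((Var x - C c) * (Var y - C c) * (Var w - C d) * (Var w - C b)) +
     (C b - C c) * ((Var x - C d) * (Var y - C d) * (Var w - C b) * (Var w - C c)))"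
    by (simp only: distrib_left Const_diff mult_ac)
  also have "(C c - C d) * ((Var x - C b) * (Var y - C b) * (Var w - C c) * (Var w - C d)) +
     (C d - C b) * ((Var x - C c) * (Var y - C c) * (Var w - C d) * (Var w - C b)) +
     (C b - C c) * ((Var x - C d) * (Var y - C d) * (Var w - C b) * (Var w - C c)) =
     (C c - C d) * (C b - C c) * (C b - C d) * ((Var x - Var w) * (Var y - Var w))"
    by (simp add: algebra_simps)
  also have "(Var x - Var y) * (Var x - C a) * (Var y - C a) * (Var w - C e) *
     ((C c - C d) * (C b - C c) * (C b - C d) * ((Var x - Var w) * (Var y - Var w))) =
     Const (?k c d * ?k b c * ?k b d) * ?g"
    by (simp only: Const_diff Const_mult mult_ac)
  finally show ?thesis
    by (rule span_D_Const_cancel) (use assms(2) in simp)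
qed

text \<open>The correction vanishes for \<open>x = w\<close>. So after a correction for
  \<open>x = y\<close>, the same construction with \<open>y\<close> and \<open>w\<close> exchanged
  does not destroy what has been achieved. On \<open>x = y\<close> the quotient of \<open>f\<close>
  by the six differences is a quadratic polynomial in \<open>X\<^sub>w\<close>, and suitable
  generators restrict to its Lagrange basis.\<close>

lemma kill_diagonal:
  assumes f: "vanishing W (\<lambda>_. 3) f" and W: "W = {x, y, w}"
    and dist: "distinct [x, y, w, a, b, c, d, e]" and all: "{x, y, w, a, b, c, d, e} = {1..8}"
  shows "\<exists>g. span_D W g \<and> subst_poly (Var(x := Var w)) g = 0 \<and> subst_poly (Var(x := Var y)) (f - g) = 0"
proof -
  have ne: "x \<noteq> y" "y \<noteq> x" "x \<noteq> w" "w \<noteq> x" "y \<noteq> w" "w \<noteq> y" using dist by auto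
  have sub: "W \<subseteq> {1..8}" unfolding W all[symmetric] by auto
  have rest: "{1..8} - {x, y} = {w, a, b, c, d, e}"
    unfolding all[symmetric] using dist by auto
  obtain h where h: "subst_poly (Var(x := Var y)) f = (\<Prod>c\<in>{1..8} - {x, y}. Var y - \<xi> W c) * h"
    "\<And>i. dle i h (if i = y then 3 + 3 - 6 else if i \<in> W - {x} then 3 - 1 else 0)"
    using vanishing_merge[OF f sub, of x y] dist by (auto simp: W)
  have h0: "dle i h 0" if "i \<noteq> w" for i using h(2)[of i] that by (auto simp: W split: if_splits)
  have h2: "dle w h 2" using h(2)[of w] dist by (auto simp: W split: if_splits)
  have const: "\<exists>t. subst_poly (Var(w := C u)) h = Const t" for u
  proof (rule dle_0_imp_Const)
    fix i show "dle i (subst_poly (Var(w := C u)) h) 0"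
      using h0[of i] by (cases "i = w") (auto intro: dle_subst_Const dle_subst_Const_same)
  qed
  obtain ta tb tc where t: "subst_poly (Var(w := C a)) h = Const ta" "subst_poly (Var(w := C b)) h = Const tb"
    "subst_poly (Var(w := C c)) h = Const tc" using const by metis
  obtain k l m where klm: "h = Const k * Const ta * ((Var w - C b) * (Var w - C c))
    + Const l * Const tb * ((Var w - C a) * (Var w - C c))
    + Const m * Const tc * ((Var w - C a) * (Var w - C b))"
    using quadratic_expand[OF h2, of a b c] dist unfolding t by auto
  \<comment> \<open>Here \<open>x\<close> and \<open>w\<close> lie on one side together with
    \<open>p\<close> and \<open>q\<close>. The factor \<open>X\<^sub>x - X\<^sub>w\<close> kills
    \<open>x = w\<close>; for \<open>x = y\<close> all factors containing \<open>X\<^sub>y\<close>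
    have the same product for all three choices.\<close>
  define T where "T p q r = (Var x - Var w) * ((Var x - C p) * (Var x - C q)) * ((Var w - C p) * (Var w - C q)) *
    ((Var y - C r) * (Var y - C d) * (Var y - C e))" for p q r
  define g where "g = Const (k * ta) * T b c a + Const (l * tb) * T a c b + Const (m * tc) * T a b c"
  have "span_D W (T b c a)" "span_D W (T a c b)" "span_D W (T a b c)"
    unfolding T_def by (rule span_D_3var_gen; use W dist all in auto)+
  then have g: "span_D W g"
    unfolding g_def by (intro span_D_add span_D_Const)
  have "subst_poly (Var(x := Var w)) (T p q r) = 0" for p q r
    using dist ne by (simp add: T_def subst_poly_hom)
  then have gw: "subst_poly (Var(x := Var w)) g = 0"
    by (simp add: g_def subst_poly_hom)
  have Ty: "subst_poly (Var(x := Var y)) (T p q r) = (Var y - Var w) * ((Var y - C p) * (Var y - C q)) * ((Var w - C p) * (Var w - C q)) *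
    ((Var y - C r) * (Var y - C d) * (Var y - C e))" for p q r
    using dist ne by (simp add: T_def subst_poly_hom)
  have "(\<Prod>c\<in>{w, a, b, c, d, e}. Var y - \<xi> W c) =
    (Var y - Var w) * (Var y - C a) * (Var y - C b) * (Var y - C c) * (Var y - C d) * (Var y - C e)"
    using dist ne by (simp add: W mult.assoc)
  then have fy: "subst_poly (Var(x := Var y)) f = (Var y - Var w) * (Var y - C a) * (Var y - C b) * (Var y - C c) * (Var y - C d) * (Var y - C e) * h"
    unfolding h(1) rest by simp
  have "subst_poly (Var(x := Var y)) g = subst_poly (Var(x := Var y)) f"
    unfolding fy klm g_def subst_poly_add subst_poly_mult Ty subst_poly_Const Const_mult
    by (simp only: distrib_left mult_ac)
  then show ?thesis
    using g gw by (intro exI[of _ g]) (simp add: subst_poly_diff)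
qed

text \<open>After two corrections the remainder is divisible by the Vandermonde product of the three
  free points, with a cofactor of degree 1 in each. Interpolating this cofactor at \<open>a\<close>
  and \<open>b\<close> leaves products with three linear factors, each of which is a
  generator.\<close>

lemma span_D_3vars:
  assumes f: "vanishing W (\<lambda>_. 3) f" and W: "W = {x, y, w}" and xyw: "distinct [x, y, w]" "W \<subseteq> {1..8}"
  shows "span_D W f"
proof -
  obtain xs where xs: "distinct ([x, y, w] @ xs)" "set ([x, y, w] @ xs) = {1..8}" "length xs = 5"
    using complement_list[of "[x, y, w]"] xyw W by auto
  then obtain a b c d e where xs': "xs = [a, b, c, d, e]"
    by (auto simp: numeral_eq_Suc length_Suc_conv)
  have dist: "distinct [x, y, w, a, b, c, d, e]" and all: "{x, y, w, a, b, c, d, e} = {1..8}"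
    using xs(1,2) unfolding xs' by (simp_all only: append_Cons append_Nil list.set)
  have ne: "x \<noteq> y" "y \<noteq> x" "x \<noteq> w" "w \<noteq> x" "y \<noteq> w" "w \<noteq> y" using dist by auto
  obtain g1 where g1: "span_D W g1" "subst_poly (Var(x := Var y)) (f - g1) = 0"
    using kill_diagonal[OF f W dist all] by auto
  have f1: "vanishing W (\<lambda>_. 3) (f - g1)"
    by (rule vanishing_diff[OF f span_D_vanishing[OF g1(1) xyw(2)]])
  have "W = {x, w, y}" "distinct [x, w, y, a, b, c, d, e]" "{x, w, y, a, b, c, d, e} = {1..8}"
    using W dist all by auto
  from kill_diagonal[OF f1 this]
  obtain g2 where g2: "span_D W g2" "subst_poly (Var(x := Var y)) g2 = 0" "subst_poly (Var(x := Var w)) (f - g1 - g2) = 0"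
    by auto
  define f2 where "f2 = f - g1 - g2"
  have f2: "vanishing W (\<lambda>_. 3) f2"
    unfolding f2_def by (rule vanishing_diff[OF f1 span_D_vanishing[OF g2(1) xyw(2)]])
  have f2x: "subst_poly (Var(x := Var y)) f2 = 0" "subst_poly (Var(x := Var w)) f2 = 0"
    using g1(2) g2(2,3) by (simp_all add: f2_def subst_poly_diff)
  have "\<exists>h. f2 = (\<Prod>q\<in>{Var y, Var w}. Var x - q) * h \<and> ((if x \<in> W then 3 else 0) < card {Var y, Var w} \<longrightarrow> h = 0) \<and>
    (\<forall>i. dle i h ((if i \<in> W then 3 else 0) - (if i = x then card {Var y, Var w} else card {q\<in>{Var y, Var w}. \<not> dle i q 0})))"
  proof (rule linear_roots)
    show "dle i f2 (if i \<in> W then 3 else 0)" for i by (rule vanishingD(3)[OF f2])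
    show "dle i q (Suc 0)" if "q \<in> {Var y, Var w}" for q i
      using that dle_mono[OF dle_Var, of i _ "Suc 0"] by auto
  qed (use dist f2x in auto)
  then obtain h where "f2 = (\<Prod>q\<in>{Var y, Var w}. Var x - q) * h"
    and dle_h: "\<And>i. dle i h ((if i \<in> W then 3 else 0) - (if i = x then card {Var y, Var w} else card {q\<in>{Var y, Var w}. \<not> dle i q 0}))"
    by blast
  then have h: "f2 = (Var x - Var y) * (Var x - Var w) * h"
    using dist ne by (simp add: Var_inject mult.assoc)
  have sets: "{q\<in>{Var y, Var w}. \<not> dle y q 0} = {Var y}" "{q\<in>{Var y, Var w}. \<not> dle w q 0} = {Var w}"
    using dist by auto
  have dle_h': "dle x h 1" "dle y h 2" "dle w h 2" "i \<notin> W \<Longrightarrow> dle i h 0" for i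
    using dle_h[of x] dle_h[of y] dle_h[of w] dle_h[of i] dist unfolding sets by (auto simp: W Var_inject)

  \<comment> \<open>Restricted to \<open>y = w\<close>, \<open>f2\<close> contains the square of
    \<open>X\<^sub>x - X\<^sub>w\<close>, while the product from \<open>vanishing_merge\<close>
    accounts for one such factor only. So the quotient \<open>r\<close> vanishes for
    \<open>x = w\<close>; being free of \<open>X\<^sub>w\<close>, it is zero.\<close>
  have hy: "subst_poly (Var(y := Var w)) h = 0"
  proof -
    have rest: "{1..8} - {y, w} = {x, a, b, c, d, e}"
      unfolding all[symmetric] using dist by auto
    obtain r where r: "subst_poly (Var(y := Var w)) f2 = (\<Prod>c\<in>{1..8} - {y, w}. Var w - \<xi> W c) * r"
      "\<And>i. dle i r (if i = w then 3 + 3 - 6 else if i \<in> W - {y} then 3 - 1 else 0)"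
      using vanishing_merge[OF f2 xyw(2), of y w] dist by (auto simp: W)
    let ?Q = "(Var w - C a) * (Var w - C b) * (Var w - C c) * (Var w - C d) * (Var w - C e)"
    have "(\<Prod>c\<in>{x, a, b, c, d, e}. Var w - \<xi> W c) = (Var w - Var x) * ?Q"
      using dist ne by (simp add: W mult.assoc)
    then have "(Var x - Var w) * (Var x - Var w) * subst_poly (Var(y := Var w)) h = (Var w - Var x) * ?Q * r"
      using r(1) dist ne unfolding rest h by (simp add: subst_poly_hom)
    also have "(Var w - Var x) * ?Q * r = (Var x - Var w) * (- ?Q * r)"
      by (simp add: algebra_simps)
    finally have "(Var x - Var w) * ((Var x - Var w) * subst_poly (Var(y := Var w)) h) = (Var x - Var w) * (- ?Q * r)"
      by (simp only: mult.assoc)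
    moreover have nz: "Var x - Var w \<noteq> 0" using ne by (simp add: Var_inject)
    ultimately have eq: "(Var x - Var w) * subst_poly (Var(y := Var w)) h = - ?Q * r"
      by (simp only: mult_left_cancel[OF nz])
    have "subst_poly (Var(x := Var w)) (- ?Q * r) = 0"
      unfolding eq[symmetric] using dist ne by (simp add: subst_poly_hom)
    moreover have "subst_poly (Var(x := Var w)) (- ?Q * r) = - ?Q * subst_poly (Var(x := Var w)) r"
      using dist ne by (simp add: subst_poly_hom)
    ultimately have "subst_poly (Var(x := Var w)) r = 0"
      by simp
    then have "subst_poly (Var(w := Var x)) (subst_poly (Var(x := Var w)) r) = 0" by simp
    also have "subst_poly (Var(w := Var x)) (subst_poly (Var(x := Var w)) r) = r"
      unfolding subst_poly_subst using dist r(2)[of w] by (intro subst_poly_ident) (auto split: if_splits)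
    finally have "r = 0" .
    with eq show ?thesis using dist ne by (simp add: Var_inject)
  qed
  have "\<exists>h'. h = (\<Prod>q\<in>{Var w}. Var y - q) * h' \<and> ((if y = x then 1 else if y \<in> W then 2 else 0) < card {Var w} \<longrightarrow> h' = 0) \<and>
    (\<forall>i. dle i h' ((if i = x then 1 else if i \<in> W then 2 else 0) - (if i = y then card {Var w} else card {q\<in>{Var w}. \<not> dle i q 0})))"
  proof (rule linear_roots)
    show "dle i h (if i = x then 1 else if i \<in> W then 2 else 0)" for i
      using dle_h' by (auto simp: W)
    show "dle i q (Suc 0)" if "q \<in> {Var w}" for q i
      using that dle_mono[OF dle_Var, of i w "Suc 0"] by auto
  qed (use dist hy in auto)
  then obtain h' where h': "h = (Var y - Var w) * h'"
    and dle_h1: "\<And>i. dle i h' ((if i = x then 1 else if i \<in> W then 2 else 0) - (if i = y then card {Var w} else card {q\<in>{Var w}. \<not> dle i q 0}))"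
    by auto
  have sets': "{q\<in>{Var w}. \<not> dle w q 0} = {Var w}" "{q\<in>{Var w}. \<not> dle x q 0} = {}"
    using dist by auto
  have dle_h2: "dle x h' 1" "dle y h' 1" "dle w h' 1" "i \<notin> W \<Longrightarrow> dle i h' 0" for i
  proof -
    show "dle x h' 1" "dle y h' 1" "dle w h' 1"
      using dle_h1[of x] dle_h1[of y] dle_h1[of w] ne unfolding sets' W by simp_all
    assume "i \<notin> W"
    then have "i \<noteq> x" "i \<notin> W" by (auto simp: W)
    then show "dle i h' 0" using dle_h1[of i] by (simp only: if_False diff_0_eq_0)
  qed

  let ?V = "(Var x - Var y) * (Var x - Var w) * (Var y - Var w)"
  have gen: "span_D W (?V * (Var x - C p) * (Var y - C q) * (Var w - C r))"
    if "{p, q, r} \<subseteq> {a, b}" for p q r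
  proof -
    have two: "span_D W ((Var x' - Var y') * (Var x' - Var w') * (Var y' - Var w') * (Var x' - C p') * (Var y' - C p') * (Var w' - C q'))"
      if "(p', q') = (a, b) \<or> (p', q') = (b, a)" "W = {x', y', w'}" "distinct [x', y', w', a, b, c, d, e]" for x' y' w' p' q'
    proof (rule span_D_3var_gen_two[OF that(2), of p' c d e q'])
      have "{x', y', w'} = {x, y, w}" using that(2) W by simp
      then show "{x', y', w', p', c, d, e, q'} = {1..8}"
        using that(1) unfolding all[symmetric] by auto
    qed (use that in auto)
    have same: "span_D W (?V * (Var x - C p') * (Var y - C p') * (Var w - C p'))" if "p' \<in> {a, b}" for p'
      by (rule span_D_3var_gen_same[OF W, of p' "if p' = a then b else a" c d e]) (use that dist all in auto)
    \<comment> \<open>Among three nodes taken from \<open>a\<close> and \<open>b\<close> two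
      coincide; the two kinds of generators cover exactly this.\<close>
    have "p = q \<or> p = r \<or> q = r" using that by auto
    then consider "p = q" "q = r" | "p = q" "q \<noteq> r" | "p = r" "p \<noteq> q" | "q = r" "p \<noteq> q" by blast
    then show ?thesis
    proof cases
      case 1
      then show ?thesis using same[of p] that by simp
    next
      case 2
      have "span_D W (?V * (Var x - C p) * (Var y - C p) * (Var w - C r))"
        using two[of p r x y w] 2 that dist W by auto
      then show ?thesis using 2 by simp
    next
      case 3
      have "span_D W (- ((Var x - Var w) * (Var x - Var y) * (Var w - Var y) * (Var x - C p) * (Var w - C p) * (Var y - C q)))"
        by (rule span_D_uminus, rule two) (use 3 that dist W in auto)
      also have "- ((Var x - Var w) * (Var x - Var y) * (Var w - Var y) * (Var x - C p) * (Var w - C p) * (Var y - C q))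
        = ?V * (Var x - C p) * (Var y - C q) * (Var w - C p)"
        using minus_diff_eq[of "Var y" "Var w"] by (simp only: mult_minus_left mult_minus_right mult_ac flip: minus_diff_eq[of "Var y" "Var w"]) simp
      finally show ?thesis using 3 by simp
    next
      case 4
      have "span_D W ((Var y - Var w) * (Var y - Var x) * (Var w - Var x) * (Var y - C q) * (Var w - C q) * (Var x - C p))"
        by (rule two) (use 4 that dist W in auto)
      also have "(Var y - Var w) * (Var y - Var x) * (Var w - Var x) * (Var y - C q) * (Var w - C q) * (Var x - C p)
        = ?V * (Var x - C p) * (Var y - C q) * (Var w - C q)"
        by (simp only: mult_minus_left mult_minus_right minus_minus mult_ac flip: minus_diff_eq[of "Var x" "Var y"] minus_diff_eq[of "Var x" "Var w"])
      finally show ?thesis using 4 by simp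
    qed
  qed
  have ab: "a \<noteq> b" using dist by simp
  have const: "dle i (subst_poly (Var(w := C r)) (subst_poly (Var(y := C q)) (subst_poly (Var(x := C p)) h'))) 0" for i p q r
  proof -
    consider "i = x" | "i = y" | "i = w" | "i \<notin> W" by (auto simp: W)
    then show ?thesis
    proof cases
      case 1
      show ?thesis unfolding 1 by (rule dle_subst_Const, rule dle_subst_Const, rule dle_subst_Const_same)
    next
      case 2
      show ?thesis unfolding 2 by (rule dle_subst_Const, rule dle_subst_Const_same)
    next
      case 3
      show ?thesis unfolding 3 by (rule dle_subst_Const_same)
    next
      case 4
      then show ?thesis by (intro dle_subst_Const dle_h2(4))
    qed
  qed
  have s1: "span_D W (?V * (Var x - C p) * (Var y - C q) * subst_poly (Var(y := C q')) (subst_poly (Var(x := C p')) h'))"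
    if "{p, q} \<subseteq> {a, b}" for p q p' q'
    by (rule affine_span[OF _ ab, of w]; (intro dle_subst_Const dle_h2 span_D_times_Const gen const)?) (use that in auto)
  have s2: "span_D W (?V * (Var x - C p) * subst_poly (Var(x := C p')) h')" if "p \<in> {a, b}" for p p'
    by (rule affine_span[OF _ ab, of y]; (intro dle_subst_Const dle_h2 s1)?) (use that in auto)
  have "span_D W (?V * h')"
    by (rule affine_span[OF _ ab, of x]; (intro dle_h2 s2)?) auto
  also have "?V * h' = f2" unfolding h h' by (simp only: mult.assoc)
  finally have "span_D W (f2 + g1 + g2)" using g1(1) g2(1) by (intro span_D_add)
  then show ?thesis by (simp add: f2_def)
qed

section \<open>Lifting to eight variables and to arbitrary degree bounds\<close>

lemma restrict_eq_imp_dvd: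
  assumes "subst_poly (Var(v := q)) f = subst_poly (Var(v := q)) g"
  shows "\<exists>h. f - g = (Var v - q) * h"
proof -
  have "subst_poly (Var(v := q)) (f - g) = 0" using assms by (simp add: subst_poly_diff)
  with linear_factor_dvd[of v q "f - g"] show ?thesis by (auto elim: dvdE)
qed

text \<open>A representation for fixed \<open>X\<^sub>v\<close> lifts with the same scalars, because
  specialisation maps \<open>DW W S\<close> to \<open>DW (W - {v}) S\<close>. The difference is
  \<open>X\<^sub>v - v\<close> times a polynomial \<open>h\<close>, which has no room left once
  there are four free variables.\<close>

lemma vanishing_imp_span_D:
  assumes "W \<subseteq> {1..8}" "vanishing W (\<lambda>_. 3) f"
  shows "span_D W f"
  using assms
proof (induction "card W" arbitrary: W f)
  case 0
  then have "W = {}" using finite_subset[of W "{1..8}"] by auto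
  then show ?case using 0 span_D_0vars by blast
next
  case (Suc n)
  have fin: "finite W" using Suc.prems(1) finite_subset by blast
  consider "card W = 1" | "card W = 2" | "card W = 3" | "4 \<le> card W"
    using Suc.hyps(2) by linarith
  then show ?case
  proof cases
    case 1
    then obtain x where "W = {x}" by (auto simp: card_1_singleton_iff)
    then show ?thesis using Suc.prems span_D_1var by auto
  next
    case 2
    then obtain x y where "W = {x, y}" "x \<noteq> y" by (auto simp: card_2_iff)
    then show ?thesis using Suc.prems span_D_2vars by auto
  next
    case 3
    then obtain x y w where "W = {x, y, w}" "distinct [x, y, w]" by (auto simp: card_3_iff)
    then show ?thesis using Suc.prems span_D_3vars by auto
  next
    case 4
    then obtain v where v: "v \<in> W" by fastforce
    have "span_D (W - {v}) (subst_poly (Var(v := C v)) f)"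
      using Suc.hyps(2) Suc.prems v fin by (intro Suc.hyps(1) vanishing_restrict) auto
    then obtain c where c: "subst_poly (Var(v := C v)) f = (\<Sum>S\<in>quads. Const (c S) * DW (W - {v}) S)"
      by (auto simp: span_D_def)
    define g where "g = (\<Sum>S\<in>quads. Const (c S) * DW W S)"
    have g: "span_D W g" by (auto simp: span_D_def g_def)
    have "subst_poly (Var(v := C v)) f = subst_poly (Var(v := C v)) g"
      by (simp add: c g_def subst_poly_sum subst_poly_mult DW_restrict[OF v] del: fun_upd_apply)
    then obtain h where h: "f - g = (Var v - C v) * h"
      using restrict_eq_imp_dvd by blast
    have "vanishing W (\<lambda>_. 3) (f - g)"
      by (intro vanishing_diff Suc.prems span_D_vanishing[OF g])
    then have van: "vanishing W ((\<lambda>_. 3)(v := 3 - 1)) h"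
      unfolding h by (rule vanishing_cancel[OF _ v])
    \<comment> \<open>The bounds are now 2 at \<open>v\<close> and 3 at \<open>a\<close>, and 2 + 3
      < 6.\<close>
    have root: "subst_poly (Var(v := Var a)) h = 0" if "a \<in> W - {v}" for a
      using vanishing_merge[OF van Suc.prems(1) v, of a] that by auto
    have inj: "inj_on Var X" for X by (auto intro: inj_onI simp: Var_inject)
    have "\<exists>h'. h = (\<Prod>q\<in>Var ` (W - {v}). Var v - q) * h' \<and> ((if v \<in> W then ((\<lambda>_. 3)(v := 3 - 1)) v else 0) < card (Var ` (W - {v})) \<longrightarrow> h' = 0) \<and>
      (\<forall>i. dle i h' ((if i \<in> W then ((\<lambda>_. 3)(v := 3 - 1)) i else 0) - (if i = v then card (Var ` (W - {v})) else card {q\<in>Var ` (W - {v}). \<not> dle i q 0})))"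
    proof (rule linear_roots)
      show "dle i h (if i \<in> W then ((\<lambda>_. 3)(v := 3 - 1)) i else 0)" for i
        by (rule vanishingD(3)[OF van])
      show "dle i q (Suc 0)" if "q \<in> Var ` (W - {v})" for q i
        using that dle_mono[OF dle_Var, of i _ "Suc 0"] by auto
      show "subst_poly (Var(v := q)) h = 0" if "q \<in> Var ` (W - {v})" for q
        using that root by blast
    qed (use fin in auto)
    moreover have "card (Var ` (W - {v})) = card W - 1"
      using v fin by (simp add: card_image[OF inj])
    \<comment> \<open>\<open>h\<close> has degree at most 2 in \<open>v\<close> but at least three roots\<close>
    ultimately have "h = 0" using 4 v by auto
    with h g show ?thesis by simp
  qed
qed

lemma vanishing_mono:
  assumes "vanishing W d f" "\<And>i. i \<in> W \<Longrightarrow> d i \<le> d' i"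
  shows "vanishing W d' f"
  using vanishing_mult[OF assms(1), of 1 "\<lambda>_. 0" d'] assms(2) by simp

text \<open>If some bound exceeds 3, that variable is fixed, the representation is lifted, and the
  difference is divided by \<open>X\<^sub>v - v\<close>, which lowers the bound by one. Both
  subproblems are smaller in the number of free variables plus the sum of the bounds. The recursion
  ends when all bounds are 3 and the coefficients are constants.\<close>

lemma vanishing_rep:
  assumes "W \<subseteq> {1..8}" "\<And>i. i \<in> W \<Longrightarrow> 3 \<le> d i" "vanishing W d f"
  shows "\<exists>g. f = (\<Sum>S\<in>quads. DW W S * g S) \<and> (\<forall>S i. dle i (g S) (if i \<in> W then d i - 3 else 0))"
  using assms
proof (induction "card W + sum d W" arbitrary: W d f rule: less_induct)
  case less
  have fin: "finite W" using less.prems(1) finite_subset by blast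
  show ?case
  proof (cases "\<exists>v\<in>W. 4 \<le> d v")
    case False
    have d: "d i = 3" if "i \<in> W" for i
    proof -
      have "\<not> 4 \<le> d i" using False that by blast
      then show ?thesis using less.prems(2)[OF that] by linarith
    qed
    then have "vanishing W (\<lambda>_. 3) f"
      using less.prems(3) unfolding vanishing_def by (simp cong: if_cong)
    then obtain c where c: "f = (\<Sum>S\<in>quads. Const (c S) * DW W S)"
      using vanishing_imp_span_D[OF less.prems(1)] by (auto simp: span_D_def)
    then have "f = (\<Sum>S\<in>quads. DW W S * Const (c S))"
      by (simp only: mult.commute)
    then show ?thesis
      by (intro exI[of _ "\<lambda>S. Const (c S)"]) simp
  next
    case True
    then obtain v where v: "v \<in> W" "4 \<le> d v" by blast
    have sum_v: "sum d W = d v + sum d (W - {v})" using v fin by (simp add: sum.remove)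
    have "card (W - {v}) + sum d (W - {v}) < card W + sum d W"
      using v fin by (simp add: sum_v card_Diff1_less add_less_le_mono less_imp_le)
    then have "\<exists>g. subst_poly (Var(v := C v)) f = (\<Sum>S\<in>quads. DW (W - {v}) S * g S) \<and>
      (\<forall>S i. dle i (g S) (if i \<in> W - {v} then d i - 3 else 0))"
      using less.prems v by (intro less.hyps vanishing_restrict) auto
    then obtain g where g: "subst_poly (Var(v := C v)) f = (\<Sum>S\<in>quads. DW (W - {v}) S * g S)"
      "\<And>S i. dle i (g S) (if i \<in> W - {v} then d i - 3 else 0)" by blast
    define f0 where "f0 = (\<Sum>S\<in>quads. DW W S * g S)"
    have g': "dle i (g S) (if i \<in> W then (d(v := 3)) i - 3 else 0)" for S i
      using g(2)[of i S] by (auto split: if_splits)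
    \<comment> \<open>The lifted coefficients are free of \<open>X\<^sub>v\<close>, so
      \<open>f0\<close> has degree at most 3 there and stays within \<open>d\<close>.\<close>
    have "vanishing W (d(v := 3)) f0"
      unfolding f0_def
      by (intro vanishing_sum vanishing_mult[OF vanishing_DW[OF _ less.prems(1)] g'])
        (use less.prems(2) in auto)
    then have f0: "vanishing W d f0"
      by (rule vanishing_mono) (use v less.prems(2) in auto)
    have "subst_poly (Var(v := C v)) (g S) = g S" for S
      using g(2)[of v S] by (intro subst_poly_ident) (auto split: if_splits)
    then have "subst_poly (Var(v := C v)) f = subst_poly (Var(v := C v)) f0"
      by (simp add: g(1) f0_def subst_poly_sum subst_poly_mult DW_restrict[OF v(1)] del: fun_upd_apply)
    then obtain h where h: "f - f0 = (Var v - C v) * h"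
      using restrict_eq_imp_dvd by blast
    have "vanishing W d (f - f0)"
      by (intro vanishing_diff less.prems f0)
    then have van: "vanishing W (d(v := d v - 1)) h"
      unfolding h by (rule vanishing_cancel[OF _ v(1)])
    have "sum (d(v := d v - 1)) W = (d v - 1) + sum d (W - {v})"
      using v fin by (simp add: sum.remove)
    then have "card W + sum (d(v := d v - 1)) W < card W + sum d W"
      using v sum_v by simp
    then have "\<exists>g'. h = (\<Sum>S\<in>quads. DW W S * g' S) \<and> (\<forall>S i. dle i (g' S) (if i \<in> W then (d(v := d v - 1)) i - 3 else 0))"
      by (rule less.hyps[OF _ less.prems(1) _ van]) (use less.prems(2) v in auto)
    then obtain h' where h': "h = (\<Sum>S\<in>quads. DW W S * h' S)"
      "\<And>S i. dle i (h' S) (if i \<in> W then (d(v := d v - 1)) i - 3 else 0)" by blast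
    have "f = f0 + (Var v - C v) * h" by (simp flip: h)
    also have "\<dots> = (\<Sum>S\<in>quads. DW W S * (g S + (Var v - C v) * h' S))"
      by (simp add: f0_def h'(1) sum_distrib_left distrib_left sum.distrib mult_ac)
    finally have "f = (\<Sum>S\<in>quads. DW W S * (g S + (Var v - C v) * h' S))" .
    moreover have "dle i (g S + (Var v - C v) * h' S) (if i \<in> W then d i - 3 else 0)" for S i
    proof (rule dle_add)
      show "dle i (g S) (if i \<in> W then d i - 3 else 0)"
        by (rule dle_mono[OF g(2)]) auto
      show "dle i ((Var v - C v) * h' S) (if i \<in> W then d i - 3 else 0)"
      proof (cases "i = v")
        case True
        then show ?thesis using h'(2)[of v S] v
          by (intro dle_mult_le[where a = 1 and b = "d v - 4"] dle_diff) auto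
      next
        case False
        then show ?thesis using h'(2)[of i S]
          by (intro dle_mult_le[where a = 0] dle_diff) auto
      qed
    qed
    ultimately show ?thesis
      by (intro exI[of _ "\<lambda>S. g S + (Var v - C v) * h' S"] conjI allI)
  qed
qed

text \<open>The case in which nothing is specialised, so that \<open>\<xi>\<close> is the identity
  on all eight points.\<close>

lemma triple_diagonal_rep:
  assumes "\<And>i. dle i f (if i \<in> {1..8} then d else 0)" "3 \<le> d"
    and "\<And>a b c. {a, b, c} \<subseteq> {1..8} \<Longrightarrow> distinct [a, b, c] \<Longrightarrow> subst_poly (Var(a := Var c, b := Var c)) f = 0"
  shows "\<exists>g. f = (\<Sum>S\<in>quads. D S * g S) \<and> (\<forall>S i. dle i (g S) (if i \<in> {1..8} then d - 3 else 0))"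
proof -
  have "vanishing {1..8} (\<lambda>_. d) f"
    unfolding vanishing_def using assms(1,3) by auto
  then have "\<exists>g. f = (\<Sum>S\<in>quads. DW {1..8} S * g S) \<and> (\<forall>S i. dle i (g S) (if i \<in> {1..8} then d - 3 else 0))"
    using vanishing_rep[of "{1..8}" "\<lambda>_. d" f] assms(2) by blast
  moreover have "DW {1..8} S = D S" if quad: "S \<in> quads" for S
  proof -
    obtain p1 p2 p3 p4 q1 q2 q3 q4 where pq: "distinct [p1, p2, p3, p4, q1, q2, q3, q4]"
      "{p1, p2, p3, p4, q1, q2, q3, q4} = {1..8}" "S = {p1, p2, p3, p4}"
      using quads_explicit[OF quad] .
    then have "p \<in> {1..8}" if "p \<in> {p1, p2, p3, p4, q1, q2, q3, q4}" for p using that by blast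
    then have xi: "\<xi> {1..8} p1 = Var p1" "\<xi> {1..8} p2 = Var p2" "\<xi> {1..8} p3 = Var p3" "\<xi> {1..8} p4 = Var p4"
      "\<xi> {1..8} q1 = Var q1" "\<xi> {1..8} q2 = Var q2" "\<xi> {1..8} q3 = Var q3" "\<xi> {1..8} q4 = Var q4"
      by (simp_all only: xi_in insert_iff simp_thms)
    obtain k where "D S = Const k * (vd (Var p1) (Var p2) (Var p3) (Var p4) * vd (Var q1) (Var q2) (Var q3) (Var q4))"
      using D_vd[OF pq(1,2)] pq(3) by auto
    then show ?thesis
      by (simp only: DW_def subst_poly_mult subst_poly_vd subst_poly_Var subst_poly_Const xi)
  qed
  ultimately show ?thesis by (metis (no_types, lifting) sum.cong)
qed

section \<open>Derivations\<close>

lemma Const_times_single: "Const c * Poly_Mapping.single m a = Poly_Mapping.single m (c * a)"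
  by (simp only: Const_def mult_single add_0)

text \<open>The formal partial derivative. Truncated subtraction in the exponent is harmless: where
  it truncates, the coefficient is zero.\<close>

definition pd :: "nat \<Rightarrow> mpoly \<Rightarrow> mpoly" where
  "pd i p = (\<Sum>m\<in>Poly_Mapping.keys p.
    Poly_Mapping.single (m - Poly_Mapping.single i 1) (of_nat (Poly_Mapping.lookup m i) * Poly_Mapping.lookup p m))"

lemma pd_superset:
  assumes "finite A" "Poly_Mapping.keys p \<subseteq> A"
  shows "pd i p = (\<Sum>m\<in>A.
    Poly_Mapping.single (m - Poly_Mapping.single i 1) (of_nat (Poly_Mapping.lookup m i) * Poly_Mapping.lookup p m))"
  unfolding pd_def using assms by (intro sum.mono_neutral_left) (auto simp: in_keys_iff)

lemma pd_add: "pd i (p + q) = pd i p + pd i q"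
proof -
  let ?A = "Poly_Mapping.keys p \<union> Poly_Mapping.keys q"
  have "Poly_Mapping.keys (p + q) \<subseteq> ?A" by (rule keys_add)
  then show ?thesis
    by (simp add: pd_superset[of ?A] lookup_add distrib_left single_add sum.distrib)
qed

lemma pd_0 [simp]: "pd i 0 = 0"
  by (simp add: pd_def)

lemma pd_sum: "pd i (sum g A) = (\<Sum>a\<in>A. pd i (g a))"
  by (induction A rule: infinite_finite_induct) (simp_all add: pd_add)

lemma pd_single: "pd i (Poly_Mapping.single m c) =
    Poly_Mapping.single (m - Poly_Mapping.single i 1) (of_nat (Poly_Mapping.lookup m i) * c)"
  by (cases "c = 0") (simp_all add: pd_def)

lemma pd_mult: "pd i (p * q) = pd i p * q + p * pd i q"
proof -
  let ?s = "\<lambda>p m. Poly_Mapping.single m (Poly_Mapping.lookup p m) :: mpoly"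
  let ?e = "Poly_Mapping.single i (1::nat)"
  have shift: "m - ?e + n = m + n - ?e" if "Poly_Mapping.lookup m i \<noteq> 0" for m n :: "nat \<Rightarrow>\<^sub>0 nat"
    using that by (intro poly_mapping_eqI) (auto simp: lookup_add lookup_minus lookup_single when_def)
  have *: "pd i (Poly_Mapping.single m a * Poly_Mapping.single n b)
      = pd i (Poly_Mapping.single m a) * Poly_Mapping.single n b + Poly_Mapping.single m a * pd i (Poly_Mapping.single n b)" for m n a b
    using shift[of m n] shift[of n m]
    by (cases "Poly_Mapping.lookup m i = 0"; cases "Poly_Mapping.lookup n i = 0")
      (simp_all add: mult_single pd_single lookup_add algebra_simps flip: single_add)
  have "p * q = (\<Sum>m\<in>Poly_Mapping.keys p. \<Sum>n\<in>Poly_Mapping.keys q. ?s p m * ?s q n)"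
    by (subst poly_as_sum[of p], subst poly_as_sum[of q]) (rule sum_product)
  then have "pd i (p * q) = (\<Sum>m\<in>Poly_Mapping.keys p. \<Sum>n\<in>Poly_Mapping.keys q. pd i (?s p m) * ?s q n + ?s p m * pd i (?s q n))"
    by (simp only: pd_sum *)
  also have "\<dots> = (\<Sum>m\<in>Poly_Mapping.keys p. pd i (?s p m)) * (\<Sum>n\<in>Poly_Mapping.keys q. ?s q n) +
    (\<Sum>m\<in>Poly_Mapping.keys p. ?s p m) * (\<Sum>n\<in>Poly_Mapping.keys q. pd i (?s q n))"
    by (simp add: sum_product sum.distrib)
  also have "\<dots> = pd i p * q + p * pd i q"
    using poly_as_sum[of p] poly_as_sum[of q] by (simp flip: pd_sum)
  finally show ?thesis .
qed

lemma pd_Const [simp]: "pd i (Const c) = 0"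
  by (simp add: Const_def pd_single)

lemma pd_1 [simp]: "pd i 1 = 0"
  using pd_Const[of i 1] by simp

lemma pd_Var: "pd i (Var j) = (if i = j then 1 else 0)"
  by (simp add: Var_def pd_single lookup_single when_def flip: Const_1)

lemma pd_Const_mult: "pd i (Const c * p) = Const c * pd i p"
  by (simp add: pd_mult)

lemma pd_uminus: "pd i (- p) = - pd i p"
  using pd_Const_mult[of i "- 1" p] by (simp add: Const_uminus)

lemma pd_diff: "pd i (p - q) = pd i p - pd i q"
  using pd_add[of i p "- q"] by (simp add: pd_uminus)

lemma pd_commute: "pd i (pd j p) = pd j (pd i p)"
  by (induction p rule: mpoly_induct) (simp_all add: pd_add pd_mult pd_Var algebra_simps)

lemma keys_pd: "m' \<in> Poly_Mapping.keys (pd i p) \<Longrightarrow>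
    \<exists>m\<in>Poly_Mapping.keys p. Poly_Mapping.lookup m i \<noteq> 0 \<and> m' = m - Poly_Mapping.single i 1"
proof -
  assume m': "m' \<in> Poly_Mapping.keys (pd i p)"
  let ?t = "\<lambda>m. Poly_Mapping.single (m - Poly_Mapping.single i 1) (of_nat (Poly_Mapping.lookup m i) * Poly_Mapping.lookup p m)"
  have "\<exists>m\<in>Poly_Mapping.keys p. Poly_Mapping.lookup (?t m) m' \<noteq> 0"
  proof (rule ccontr)
    assume "\<not> ?thesis"
    then have "Poly_Mapping.lookup (pd i p) m' = 0"
      unfolding pd_def lookup_sum by (intro sum.neutral) blast
    with m' show False by (simp add: in_keys_iff)
  qed
  then obtain m where m: "m \<in> Poly_Mapping.keys p" "Poly_Mapping.lookup (?t m) m' \<noteq> 0" ..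
  then have "m' = m - Poly_Mapping.single i 1" "Poly_Mapping.lookup m i \<noteq> 0"
    by (simp_all add: lookup_single when_def split: if_splits)
  with m(1) show ?thesis by blast
qed

lemma dle_pd: "dle j p n \<Longrightarrow> dle j (pd i p) n"
proof -
  assume p: "dle j p n"
  have "Poly_Mapping.lookup m' j \<le> n" if m': "m' \<in> Poly_Mapping.keys (pd i p)" for m'
  proof -
    obtain m where m: "m \<in> Poly_Mapping.keys p" "m' = m - Poly_Mapping.single i 1"
      using keys_pd[OF m'] by blast
    have "Poly_Mapping.lookup m j \<le> n" using p m(1) by (simp add: dle_def)
    then show ?thesis by (simp add: m(2) lookup_minus)
  qed
  then show ?thesis by (simp add: dle_def)
qed

section \<open>The operators of the infinitesimal group action\<close>

definition EE :: "mpoly \<Rightarrow> mpoly" where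
  "EE p = (\<Sum>i\<in>{1..8}. pd i p)"

text \<open>In an affine coordinate of the line, \<open>EE\<close> is the infinitesimal translation,
  and \<open>FF d\<close> is the infinitesimal Moebius transformation that moves infinity, acting on
  binary forms of degree \<open>d i\<close> in the variable \<open>i\<close>. The Euler operator
  \<open>Th\<close> gives the grading element up to scaling and a shift.\<close>

definition FF :: "(nat \<Rightarrow> nat) \<Rightarrow> mpoly \<Rightarrow> mpoly" where
  "FF d p = (\<Sum>i\<in>{1..8}. C (d i) * Var i * p - Var i * Var i * pd i p)"

definition Th :: "mpoly \<Rightarrow> mpoly" where
  "Th p = (\<Sum>i\<in>{1..8}. Var i * pd i p)"

lemma EE_add: "EE (p + q) = EE p + EE q" and EE_diff: "EE (p - q) = EE p - EE q"
  and EE_mult: "EE (p * q) = EE p * q + p * EE q" and EE_Const [simp]: "EE (Const c) = 0" and EE_0 [simp]: "EE 0 = 0"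
  by (simp_all add: EE_def pd_add pd_diff pd_mult sum.distrib sum_subtractf sum_distrib_left sum_distrib_right)

lemma EE_Var: "i \<in> {1..8} \<Longrightarrow> EE (Var i) = 1"
  by (simp add: EE_def pd_Var)

lemma EE_Const_mult: "EE (Const c * p) = Const c * EE p"
  by (simp add: EE_mult)

lemma EE_sum: "EE (sum g A) = (\<Sum>a\<in>A. EE (g a))"
  by (induction A rule: infinite_finite_induct) (simp_all add: EE_add)

lemma EE_pd: "EE (pd i p) = pd i (EE p)"
  by (simp add: EE_def pd_sum pd_commute[of i])

lemma Th_diff: "Th (p - q) = Th p - Th q"
  by (simp add: Th_def pd_diff right_diff_distrib sum_subtractf)

lemma Th_Const [simp]: "Th (Const c) = 0"
  by (simp add: Th_def)

lemma Th_mult: "Th (p * q) = Th p * q + p * Th q"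
  by (simp add: Th_def pd_mult sum.distrib sum_distrib_left sum_distrib_right distrib_left mult_ac)

lemma Th_Const_mult: "Th (Const c * p) = Const c * Th p"
  by (simp add: Th_mult)

lemma Th_sum: "Th (sum g A) = (\<Sum>a\<in>A. Th (g a))"
  unfolding Th_def pd_sum sum_distrib_left by (rule sum.swap)

lemma Th_Var: "i \<in> {1..8} \<Longrightarrow> Th (Var i) = Var i"
  by (simp add: Th_def pd_Var if_distrib[of "\<lambda>x. _ * x"] cong: if_cong)

lemma EE_Th: "EE (Th p) = EE p + Th (EE p)"
proof -
  have "EE (Th p) = (\<Sum>i\<in>{1..8}. pd i p + Var i * pd i (EE p))"
    unfolding Th_def EE_sum by (intro sum.cong) (auto simp: EE_mult EE_Var EE_pd)
  then show ?thesis by (simp add: sum.distrib EE_def Th_def)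
qed

lemma pd_Th: "i \<in> {1..8} \<Longrightarrow> pd i (Th p) = pd i p + Th (pd i p)"
proof -
  assume i: "i \<in> {1..8}"
  have "pd i (Th p) = (\<Sum>j\<in>{1..8}. (if i = j then pd j p else 0) + Var j * pd j (pd i p))"
    unfolding Th_def pd_sum by (intro sum.cong) (auto simp: pd_mult pd_Var pd_commute[of i])
  then show ?thesis using i by (simp add: sum.distrib Th_def)
qed

lemma FF_add: "FF d (p + q) = FF d p + FF d q"
  by (simp add: FF_def pd_add algebra_simps sum.distrib sum_subtractf)

lemma FF_Const_mult: "FF d (Const c * p) = Const c * FF d p"
  unfolding FF_def pd_Const_mult by (simp add: sum_distrib_left right_diff_distrib mult_ac)

lemma FF_0 [simp]: "FF d 0 = 0"
  by (simp add: FF_def)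

lemma FF_sum: "FF d (sum g A) = (\<Sum>a\<in>A. FF d (g a))"
  by (induction A rule: infinite_finite_induct) (simp_all add: FF_add)

text \<open>The Leibniz rule of the Lie algebra action; the parameters add like the degrees of
  binary forms.\<close>

lemma FF_mult: "FF (\<lambda>i. d i + e i) (p * q) = FF d p * q + p * FF e q"
proof -
  have "FF (\<lambda>i. d i + e i) (p * q) = (\<Sum>i\<in>{1..8}. (C (d i) * Var i * p - Var i * Var i * pd i p) * q +
      p * (C (e i) * Var i * q - Var i * Var i * pd i q))"
    unfolding FF_def by (intro sum.cong) (simp_all add: pd_mult Const_add algebra_simps)
  then show ?thesis by (simp add: FF_def sum.distrib sum_distrib_left sum_distrib_right)
qed

text \<open>The commutator acts on homogeneous polynomials of degree \<open>k\<close> as the scalar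
  \<open>8 * d - 2 * k\<close>; weight zero is therefore degree \<open>4 * d\<close>.\<close>

lemma EE_FF: "EE (FF (\<lambda>_. d) p) = FF (\<lambda>_. d) (EE p) + (Const (of_nat (8 * d)) * p - 2 * Th p)"
proof -
  have "EE (FF (\<lambda>_. d) p) = (\<Sum>i\<in>{1..8}. (C d * Var i * EE p - Var i * Var i * pd i (EE p)) +
      (C d * p - 2 * (Var i * pd i p)))"
    unfolding FF_def EE_sum
    by (intro sum.cong) (auto simp: EE_diff EE_mult EE_Var EE_pd algebra_simps)
  also have "\<dots> = FF (\<lambda>_. d) (EE p) + (Const (of_nat (8 * d)) * p - 2 * Th p)"
    by (simp add: sum.distrib sum_subtractf FF_def Th_def sum_distrib_left Const_mult)
      (simp add: Const_def flip: single_of_nat)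
  finally show ?thesis .
qed

lemma Th_FF: "Th (FF d p) = FF d (Th p) + FF d p"
proof -
  have "Th (FF d p) = (\<Sum>i\<in>{1..8}. (C (d i) * Var i * Th p - Var i * Var i * pd i (Th p)) +
      (C (d i) * Var i * p - Var i * Var i * pd i p))"
    unfolding FF_def Th_sum
    by (intro sum.cong) (auto simp: Th_diff Th_mult Th_Var pd_Th algebra_simps)
  then show ?thesis by (simp add: sum.distrib FF_def)
qed

text \<open>A monomial with exponent \<open>k\<close> in \<open>X\<^sub>i\<close> acquires the
  coefficient \<open>e - k\<close>. It vanishes for \<open>k = e\<close>, which is exactly when the
  exponent would exceed \<open>e\<close>.\<close>

lemma dle_FF_summand:
  assumes "dle i p e"
  shows "dle i (C e * Var i * p - Var i * Var i * pd i p) e"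
proof -
  let ?s = "\<lambda>m. Poly_Mapping.single m (Poly_Mapping.lookup p m) :: mpoly"
  let ?e = "Poly_Mapping.single i (1::nat)"
  have one: "C e * Var i * Poly_Mapping.single m c - Var i * Var i * pd i (Poly_Mapping.single m c)
    = Poly_Mapping.single (?e + m) ((of_nat e - of_nat (Poly_Mapping.lookup m i)) * c)" for m c
  proof (cases "Poly_Mapping.lookup m i = 0")
    case True
    then show ?thesis by (simp add: Const_times_single Var_def mult_single pd_single)
  next
    case False
    then have "?e + ?e + (m - ?e) = ?e + m"
      by (intro poly_mapping_eqI) (auto simp: lookup_add lookup_minus lookup_single when_def)
    then show ?thesis
      by (simp add: Const_times_single Var_def mult_single pd_single left_diff_distrib single_diff add.assoc)
  qed
  have "C e * Var i * p - Var i * Var i * pd i p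
    = C e * Var i * (\<Sum>m\<in>Poly_Mapping.keys p. ?s m) - Var i * Var i * pd i (\<Sum>m\<in>Poly_Mapping.keys p. ?s m)"
    by (simp flip: poly_as_sum)
  also have "\<dots> = (\<Sum>m\<in>Poly_Mapping.keys p. Poly_Mapping.single (?e + m)
      ((of_nat e - of_nat (Poly_Mapping.lookup m i)) * Poly_Mapping.lookup p m))"
    unfolding pd_sum sum_distrib_left sum_subtractf[symmetric] one ..
  also have "dle i \<dots> e"
  proof (rule dle_sum)
    fix m assume "m \<in> Poly_Mapping.keys p"
    then have "Poly_Mapping.lookup m i \<le> e" using assms by (simp add: dle_def)
    then show "dle i (Poly_Mapping.single (?e + m) ((of_nat e - of_nat (Poly_Mapping.lookup m i)) * Poly_Mapping.lookup p m)) e"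
      by (cases "Poly_Mapping.lookup m i = e") (auto simp: dle_def lookup_add lookup_single)
  qed
  finally show ?thesis .
qed

lemma dle_FF:
  assumes "dle i p (if i \<in> {1..8} then e else 0)"
  shows "dle i (FF (\<lambda>_. e) p) (if i \<in> {1..8} then e else 0)"
  unfolding FF_def
proof (rule dle_sum)
  fix j :: nat assume j: "j \<in> {1..8}"
  show "dle i (C e * Var j * p - Var j * Var j * pd j p) (if i \<in> {1..8} then e else 0)"
  proof (cases "i = j")
    case True
    then show ?thesis using assms j dle_FF_summand by simp
  next
    case False
    then show ?thesis using assms
      by (intro dle_diff dle_mult_le[where a = 0] dle_pd) auto
  qed
qed

lemma dle_EE: "dle i p n \<Longrightarrow> dle i (EE p) n"
  unfolding EE_def by (intro dle_sum dle_pd)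

section \<open>Homogeneous components\<close>

text \<open>The index 0 is included so that substituting \<open>Var 0\<close> for some of the variables preserves the weight.\<close>

definition weight :: "(nat \<Rightarrow>\<^sub>0 nat) \<Rightarrow> nat" where
  "weight m = (\<Sum>i\<le>8. Poly_Mapping.lookup m i)"

definition homog :: "nat \<Rightarrow> mpoly \<Rightarrow> bool" where
  "homog k p \<longleftrightarrow> (\<forall>m\<in>Poly_Mapping.keys p. weight m = k)"

definition hc :: "nat \<Rightarrow> mpoly \<Rightarrow> mpoly" where
  "hc k p = (\<Sum>m\<in>{m\<in>Poly_Mapping.keys p. weight m = k}. Poly_Mapping.single m (Poly_Mapping.lookup p m))"

lemma weight_add: "weight (m + n) = weight m + weight n"
  by (simp add: weight_def lookup_add sum.distrib)

lemma lookup_hc: "Poly_Mapping.lookup (hc k p) m = (if weight m = k then Poly_Mapping.lookup p m else 0)"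
  by (simp add: hc_def lookup_sum lookup_single when_def in_keys_iff)

lemma keys_hc: "Poly_Mapping.keys (hc k p) = {m\<in>Poly_Mapping.keys p. weight m = k}"
  by (simp add: set_eq_iff in_keys_iff lookup_hc)

lemma homog_hc: "homog k (hc k p)"
  by (simp add: homog_def keys_hc)

lemma dle_hc: "dle i p n \<Longrightarrow> dle i (hc k p) n"
  by (simp add: dle_def keys_hc)

lemma hc_homog: "homog j p \<Longrightarrow> hc k p = (if j = k then p else 0)"
  by (intro poly_mapping_eqI) (auto simp: lookup_hc homog_def in_keys_iff)

lemma hc_0 [simp]: "hc k 0 = 0"
  by (simp add: hc_def)

lemma hc_add: "hc k (p + q) = hc k p + hc k q"
  by (intro poly_mapping_eqI) (simp add: lookup_hc lookup_add)

lemma hc_sum: "hc k (sum g A) = (\<Sum>a\<in>A. hc k (g a))"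
  by (induction A rule: infinite_finite_induct) (simp_all add: hc_add)

lemma homog_0 [simp]: "homog k 0"
  by (simp add: homog_def)

lemma homog_add: "homog k p \<Longrightarrow> homog k q \<Longrightarrow> homog k (p + q)"
  using keys_add[of p q] unfolding homog_def by blast

lemma homog_uminus: "homog k p \<Longrightarrow> homog k (- p)"
  by (simp add: homog_def in_keys_iff)

lemma homog_diff: "homog k p \<Longrightarrow> homog k q \<Longrightarrow> homog k (p - q)"
  using homog_add[of k p "- q"] by (simp add: homog_uminus)

lemma homog_mult: "homog a p \<Longrightarrow> homog b q \<Longrightarrow> homog (a + b) (p * q)"
  unfolding homog_def using keys_mult[of p q] by (fastforce simp: weight_add)

lemma homog_sum: "(\<And>a. a \<in> A \<Longrightarrow> homog k (g a)) \<Longrightarrow> homog k (sum g A)"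
  by (induction A rule: infinite_finite_induct) (auto intro: homog_add)

lemma homog_Const: "homog 0 (Const c)"
  by (simp add: homog_def Const_def weight_def)

lemma homog_Var: "i \<le> 8 \<Longrightarrow> homog 1 (Var i)"
  by (simp add: homog_def Var_def weight_def lookup_single when_def)

lemma sum_hc: "\<exists>J. finite J \<and> p = (\<Sum>k\<in>J. hc k p)"
proof (intro exI conjI)
  show "p = (\<Sum>k\<in>weight ` Poly_Mapping.keys p. hc k p)"
    by (intro poly_mapping_eqI) (auto simp: lookup_sum lookup_hc in_keys_iff)
qed simp

lemma hc_mult_homog:
  assumes "homog a h"
  shows "hc (a + k) (h * p) = h * hc k p"
proof -
  obtain J where J: "finite J" "p = (\<Sum>k\<in>J. hc k p)" using sum_hc by blast
  have "hc (a + k) (h * hc j p) = (if j = k then h * hc k p else 0)" for j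
    using hc_homog[OF homog_mult[OF assms homog_hc[of j p]], of "a + k"] by auto
  then have "hc (a + k) (h * (\<Sum>k\<in>J. hc k p)) = (if k \<in> J then h * hc k p else 0)"
    using J(1) by (simp add: sum_distrib_left hc_sum)
  moreover have "hc k p = 0" if "k \<notin> J"
  proof -
    have "hc k (\<Sum>j\<in>J. hc j p) = 0"
      unfolding hc_sum using that by (intro sum.neutral ballI) (auto simp: hc_homog[OF homog_hc])
    then show ?thesis using J(2) by simp
  qed
  ultimately show ?thesis using J(2) by (auto split: if_splits)
qed

lemma homog_pd: 
  assumes "homog k p" "i \<in> {1..8}"
  shows "homog (k - 1) (pd i p)" "k = 0 \<Longrightarrow> pd i p = 0"
proof -
  have *: "weight m' + 1 = k" if m': "m' \<in> Poly_Mapping.keys (pd i p)" for m'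
  proof -
    obtain m where m: "m \<in> Poly_Mapping.keys p" "Poly_Mapping.lookup m i \<noteq> 0" "m' = m - Poly_Mapping.single i 1"
      using keys_pd[OF m'] by blast
    then have "m = m' + Poly_Mapping.single i 1"
      by (intro poly_mapping_eqI) (auto simp: lookup_add lookup_minus lookup_single when_def)
    moreover have "weight (Poly_Mapping.single i 1) = 1"
      using assms(2) by (simp add: weight_def lookup_single when_def)
    ultimately show ?thesis using assms(1) m(1) by (auto simp: homog_def weight_add)
  qed
  then show "homog (k - 1) (pd i p)" by (fastforce simp: homog_def)
  show "pd i p = 0" if "k = 0"
    using * that by (metis add_is_0 all_not_in_conv keys_eq_empty one_neq_zero)
qed

lemma homog_EE: "homog k p \<Longrightarrow> homog (k - 1) (EE p)"
  unfolding EE_def by (intro homog_sum homog_pd(1))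

lemma EE_homog_0: "homog 0 p \<Longrightarrow> EE p = 0"
  unfolding EE_def by (intro sum.neutral ballI homog_pd(2)[of 0]) simp_all

lemma EE_nilpotent: "homog k p \<Longrightarrow> (EE ^^ Suc k) p = 0"
proof (induction k arbitrary: p)
  case 0
  then show ?case by (simp add: EE_homog_0)
next
  case (Suc k)
  then show ?case using homog_EE[of "Suc k" p] by (simp del: funpow.simps add: funpow_Suc_right)
qed

text \<open>Euler's identity. \<open>weight\<close> counts the index 0 whereas \<open>Th\<close>
  does not, hence the condition on \<open>X\<^sub>0\<close>.\<close>

lemma Th_homog:
  assumes "homog k p" "dle 0 p 0"
  shows "Th p = C k * p"
proof -
  let ?s = "\<lambda>m. Poly_Mapping.single m (Poly_Mapping.lookup p m) :: mpoly"
  have one: "Th (Poly_Mapping.single m c) = C (\<Sum>i\<in>{1..8}. Poly_Mapping.lookup m i) * Poly_Mapping.single m c" for m c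
  proof -
    have "Var i * pd i (Poly_Mapping.single m c) = C (Poly_Mapping.lookup m i) * Poly_Mapping.single m c" for i
    proof (cases "Poly_Mapping.lookup m i = 0")
      case True
      then show ?thesis by (simp add: pd_single)
    next
      case False
      then have "Poly_Mapping.single i 1 + (m - Poly_Mapping.single i 1) = m"
        by (intro poly_mapping_eqI) (auto simp: lookup_add lookup_minus lookup_single when_def)
      then show ?thesis by (simp add: pd_single Var_def Const_times_single mult_single)
    qed
    then show ?thesis by (simp add: Th_def of_nat_sum Const_sum sum_distrib_right)
  qed
  have "Th (?s m) = C k * ?s m" if "m \<in> Poly_Mapping.keys p" for m
  proof -
    have "weight m = Poly_Mapping.lookup m 0 + (\<Sum>i\<in>{1..8}. Poly_Mapping.lookup m i)"
      unfolding weight_def by (simp add: atMost_atLeast0 sum.atLeast_Suc_atMost)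
    then show ?thesis using that assms by (simp add: one homog_def dle_def)
  qed
  then have "Th (\<Sum>m\<in>Poly_Mapping.keys p. ?s m) = C k * (\<Sum>m\<in>Poly_Mapping.keys p. ?s m)"
    by (simp add: Th_sum sum_distrib_left)
  then show ?thesis by (simp flip: poly_as_sum)
qed

lemma Const_2: "Const 2 = 2"
  using Const_add[of 1 1] by simp

section \<open>Bracket monomials\<close>

text \<open>A multigraph on \<open>{1..8}\<close> is given by its list of edges.\<close>

definition edge_prod :: "(nat \<times> nat) list \<Rightarrow> mpoly" where
  "edge_prod es = (\<Prod>(i, j)\<leftarrow>es. Var i - Var j)"

definition edge_deg :: "(nat \<times> nat) list \<Rightarrow> nat \<Rightarrow> nat" where
  "edge_deg es v = (\<Sum>(i, j)\<leftarrow>es. of_bool (v = i) + of_bool (v = j))"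

definition edges :: "(nat \<times> nat) list \<Rightarrow> bool" where
  "edges es \<longleftrightarrow> (\<forall>(i, j)\<in>set es. i \<in> {1..8} \<and> j \<in> {1..8} \<and> i \<noteq> j)"

lemma edge_prod_simps [simp]: "edge_prod [] = 1" "edge_prod ((i, j) # es) = (Var i - Var j) * edge_prod es"
  "edge_prod (es @ es') = edge_prod es * edge_prod es'"
  by (simp_all add: edge_prod_def)

lemma edge_deg_simps [simp]: "edge_deg [] v = 0"
  "edge_deg ((i, j) # es) v = of_bool (v = i) + of_bool (v = j) + edge_deg es v"
  "edge_deg (es @ es') v = edge_deg es v + edge_deg es' v"
  by (simp_all add: edge_deg_def)

lemma edges_simps [simp]: "edges []"
  "edges ((i, j) # es) \<longleftrightarrow> i \<in> {1..8} \<and> j \<in> {1..8} \<and> i \<noteq> j \<and> edges es"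
  "edges (es @ es') \<longleftrightarrow> edges es \<and> edges es'"
  by (auto simp: edges_def)

lemma edge_deg_outside: "edges es \<Longrightarrow> v \<notin> {1..8} \<Longrightarrow> edge_deg es v = 0"
  by (induction es) auto

lemma dle_edge_prod: "dle v (edge_prod es) (edge_deg es v)"
proof (induction es)
  case (Cons e es)
  obtain i j where e: "e = (i, j)" by fastforce
  have "dle v (Var i - Var j) (of_bool (v = i) + of_bool (v = j))"
    by (intro dle_diff) (auto intro: dle_mono[OF dle_Var])
  with Cons show ?case by (simp add: e dle_mult)
qed simp

lemma homog_edge_prod: "edges es \<Longrightarrow> homog (length es) (edge_prod es)"
proof (induction es)
  case Nil
  then show ?case using homog_Const[of 1] by simp
next
  case (Cons e es)
  obtain i j where e: "e = (i, j)" by fastforce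
  have "homog (1 + length es) ((Var i - Var j) * edge_prod es)"
    using Cons by (intro homog_mult homog_diff homog_Var) (auto simp: e)
  then show ?case by (simp add: e)
qed

lemma EE_edge_prod: "edges es \<Longrightarrow> EE (edge_prod es) = 0"
proof (induction es)
  case Nil
  then show ?case using EE_Const[of 1] by simp
next
  case (Cons e es)
  obtain i j where e: "e = (i, j)" by fastforce
  show ?case using Cons by (simp add: e EE_mult EE_diff EE_Var)
qed

lemma FF_1: "(\<And>i. i \<in> {1..8} \<Longrightarrow> d i = 0) \<Longrightarrow> FF d 1 = 0"
  by (simp add: FF_def)

text \<open>The two contributions
  \<open>X\<^sub>i * (X\<^sub>i - X\<^sub>j) - X\<^sub>i\<^sup>2\<close> and
  \<open>X\<^sub>j * (X\<^sub>i - X\<^sub>j) + X\<^sub>j\<^sup>2\<close> cancel: a bracket is an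
  invariant of degree 1 at both ends.\<close>

lemma FF_edge:
  assumes "i \<in> {1..8}" "j \<in> {1..8}" "i \<noteq> j"
  shows "FF (\<lambda>v. of_bool (v = i) + of_bool (v = j)) (Var i - Var j) = 0"
proof -
  let ?p = "Var i - Var j"
  have "FF (\<lambda>v. of_bool (v = i) + of_bool (v = j)) ?p =
    (\<Sum>v\<in>{1..8}. (if v = i then Var i * ?p - Var i * Var i else 0) + (if v = j then Var j * ?p + Var j * Var j else 0))"
    unfolding FF_def using assms(3) by (intro sum.cong) (auto simp: pd_diff pd_Var)
  also have "\<dots> = 0"
    using assms by (simp add: sum.distrib) (simp add: algebra_simps)
  finally show ?thesis .
qed

lemma FF_edge_prod: "edges es \<Longrightarrow> FF (edge_deg es) (edge_prod es) = 0"
proof (induction es)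
  case Nil
  then show ?case by (simp add: FF_1)
next
  case (Cons e es)
  obtain i j where e: "e = (i, j)" by fastforce
  have "edge_deg (e # es) = (\<lambda>v. (of_bool (v = i) + of_bool (v = j)) + edge_deg es v)"
    by (simp add: fun_eq_iff e)
  then show ?case using Cons FF_edge[of i j]
    by (simp add: e FF_mult)
qed

lemma FF_cong: "(\<And>i. i \<in> {1..8} \<Longrightarrow> d i = e i) \<Longrightarrow> FF d p = FF e p"
  by (simp add: FF_def)

text \<open>The graph consists of two disjoint complete graphs on four vertices, one for each side
  of \<open>S\<close>.\<close>

lemma D_edge_prod:
  assumes "S \<in> quads"
  shows "\<exists>k es. k \<noteq> 0 \<and> D S = Const k * edge_prod es \<and> edges es \<and> length es = 12 \<and> (\<forall>v\<in>{1..8}. edge_deg es v = 3)"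
proof -
  obtain p1 p2 p3 p4 q1 q2 q3 q4 where pq: "distinct [p1, p2, p3, p4, q1, q2, q3, q4]"
    "{p1, p2, p3, p4, q1, q2, q3, q4} = {1..8}" "S = {p1, p2, p3, p4}"
    using quads_explicit[OF assms] .
  obtain k where k: "k \<noteq> 0" "D S = Const k * (vd (Var p1) (Var p2) (Var p3) (Var p4) * vd (Var q1) (Var q2) (Var q3) (Var q4))"
    using D_vd[OF pq(1,2)] pq(3) by auto
  let ?es = "\<lambda>p1 p2 p3 p4. [(p1, p2), (p1, p3), (p1, p4), (p2, p3), (p2, p4), (p3, p4)] :: (nat \<times> nat) list"
  have in_S: "p \<in> {1..8}" if "p \<in> {p1, p2, p3, p4, q1, q2, q3, q4}" for p using that unfolding pq(2) .
  have "vd (Var p1) (Var p2) (Var p3) (Var p4) = edge_prod (?es p1 p2 p3 p4)" for p1 p2 p3 p4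
    by (simp add: vd_def mult.assoc)
  then have "D S = Const k * edge_prod (?es p1 p2 p3 p4 @ ?es q1 q2 q3 q4)"
    by (simp only: k(2) edge_prod_simps(3))
  moreover have "edges (?es p1 p2 p3 p4 @ ?es q1 q2 q3 q4)"
    using pq(1) by (simp add: in_S[simplified])
  moreover have "edge_deg (?es p1 p2 p3 p4 @ ?es q1 q2 q3 q4) v = 3" if "v \<in> {1..8}" for v
    using that pq(1) unfolding pq(2)[symmetric] by auto
  ultimately show ?thesis
    using k(1) by (intro exI[of _ k] exI[of _ "?es p1 p2 p3 p4 @ ?es q1 q2 q3 q4"]) simp
qed

section \<open>Projection to the invariants\<close>

text \<open>On polynomials of degree at most \<open>e\<close> in each of the eight variables, \<open>EE\<close> and \<open>FF\<close> generate an action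
  of \<open>sl\<^sub>2\<close>, and on weight zero the operator \<open>FF \<circ> EE\<close> has the eigenvalues \<open>m (m + 1)\<close>.\<close>

definition proj_step :: "nat \<Rightarrow> nat \<Rightarrow> mpoly \<Rightarrow> mpoly" where
  "proj_step e m g = g - Const (1 / of_nat (m * (m + 1))) * FF (\<lambda>_. e) (EE g)"

text \<open>The spectral projection to eigenvalue 0, written as the product of the factors that
  remove the eigenvalues \<open>k * (k + 1)\<close> for \<open>k = m\<close> down to 1.\<close>

fun proj :: "nat \<Rightarrow> nat \<Rightarrow> mpoly \<Rightarrow> mpoly" where
  "proj e 0 g = g"
| "proj e (Suc m) g = proj e m (proj_step e (Suc m) g)"

text \<open>The usual \<open>sl\<^sub>2\<close> commutation of a power of \<open>EE\<close> with
  \<open>FF\<close>. The assumption places \<open>u\<close> one degree below weight zero, where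
  \<open>EE g\<close> lives. The commutators on the successive powers are the scalars 2, 4, 6 and so
  on, with sum \<open>(m + 1) * (m + 2)\<close>.\<close>

lemma EE_pow_FF:
  assumes u: "Th u = Const (4 * of_nat e - 1) * u"
  shows "(EE ^^ Suc m) (FF (\<lambda>_. e) u) = FF (\<lambda>_. e) ((EE ^^ Suc m) u) +
    Const (of_nat ((m + 1) * (m + 2))) * (EE ^^ m) u"
proof -
  have Th: "Th ((EE ^^ m) u) = Const (4 * of_nat e - 1 - of_nat m) * (EE ^^ m) u" for m
  proof (induction m)
    case (Suc m)
    have "Th (EE ((EE ^^ m) u)) = EE (Th ((EE ^^ m) u)) - EE ((EE ^^ m) u)"
      by (simp add: EE_Th)
    also have "\<dots> = Const (4 * of_nat e - 1 - of_nat (Suc m)) * EE ((EE ^^ m) u)"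
      unfolding Suc EE_Const_mult by (simp add: Const_diff Const_add Const_2 algebra_simps)
    finally show ?case by simp
  qed (simp add: u)
  have step: "EE (FF (\<lambda>_. e) ((EE ^^ m) u)) = FF (\<lambda>_. e) ((EE ^^ Suc m) u) + Const (of_nat (2 * m + 2)) * (EE ^^ m) u" for m
  proof -
    have "(2 :: mpoly) = Const 2" using Const_add[of 1 1] by simp
    then have "Const (of_nat (8 * e)) * (EE ^^ m) u - 2 * Th ((EE ^^ m) u) =
      Const (of_nat (8 * e) - 2 * (4 * of_nat e - 1 - of_nat m)) * (EE ^^ m) u"
      unfolding Th by (simp only: Const_diff Const_mult left_diff_distrib mult.assoc)
    also have "(of_nat (8 * e) - 2 * (4 * of_nat e - 1 - of_nat m) :: complex) = of_nat (2 * m + 2)"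
      by simp
    finally show ?thesis by (simp only: EE_FF funpow.simps o_apply)
  qed
  show ?thesis
  proof (induction m)
    case 0
    then show ?case using step[of 0] by (simp add: Const_2)
  next
    case (Suc m)
    have "(EE ^^ Suc (Suc m)) (FF (\<lambda>_. e) u) = EE ((EE ^^ Suc m) (FF (\<lambda>_. e) u))" by simp
    also have "\<dots> = FF (\<lambda>_. e) ((EE ^^ Suc (Suc m)) u) +
        (Const (of_nat (2 * Suc m + 2)) * (EE ^^ Suc m) u + Const (of_nat ((m + 1) * (m + 2))) * EE ((EE ^^ m) u))"
      unfolding Suc EE_add EE_Const_mult step[of "Suc m"] by (simp only: add.assoc)
    also have "EE ((EE ^^ m) u) = (EE ^^ Suc m) u" by simp
    also have "Const (of_nat (2 * Suc m + 2)) * (EE ^^ Suc m) u + Const (of_nat ((m + 1) * (m + 2))) * (EE ^^ Suc m) u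
      = Const (of_nat (2 * Suc m + 2) + of_nat ((m + 1) * (m + 2))) * (EE ^^ Suc m) u"
      by (simp only: Const_add distrib_right)
    also have "(of_nat (2 * Suc m + 2) + of_nat ((m + 1) * (m + 2)) :: complex) = of_nat ((Suc m + 1) * (Suc m + 2))"
      by (simp flip: of_nat_add) (simp add: algebra_simps)
    finally show ?case .
  qed
qed

lemma EE_pow_simps: "(EE ^^ m) (p - q) = (EE ^^ m) p - (EE ^^ m) q" "(EE ^^ m) (Const c * p) = Const c * (EE ^^ m) p"
  by (induction m) (simp_all add: EE_diff EE_Const_mult)

lemma Th_proj_step:
  assumes "Th g = Const (4 * of_nat e) * g"
  shows "Th (proj_step e m g) = Const (4 * of_nat e) * proj_step e m g"
proof -
  have "Th (EE g) = Const (4 * of_nat e) * EE g - EE g"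
    using EE_Th[of g] assms by (simp add: EE_Const_mult)
  then have "Th (FF (\<lambda>_. e) (EE g)) = FF (\<lambda>_. e) (Const (4 * of_nat e - 1) * EE g) + FF (\<lambda>_. e) (EE g)"
    by (simp add: Th_FF Const_diff left_diff_distrib)
  also have "\<dots> = Const (4 * of_nat e) * FF (\<lambda>_. e) (EE g)"
    unfolding FF_Const_mult by (simp add: Const_diff algebra_simps)
  finally have FE: "Th (FF (\<lambda>_. e) (EE g)) = Const (4 * of_nat e) * FF (\<lambda>_. e) (EE g)" .
  show ?thesis
    unfolding proj_step_def Th_diff Th_Const_mult assms FE by (simp only: right_diff_distrib mult_ac)
qed

text \<open>For \<open>u = EE g\<close> in the commutation formula the term with \<open>FF\<close>
  disappears, and the normalisation cancels the remaining multiple of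
  \<open>(EE ^^ Suc m) g\<close>. Each step thus lowers the order of nilpotency of \<open>EE\<close>
  on the vector by one.\<close>

lemma EE_pow_proj_step:
  assumes "Th g = Const (4 * of_nat e) * g" "(EE ^^ Suc (Suc m)) g = 0"
  shows "(EE ^^ Suc m) (proj_step e (Suc m) g) = 0"
proof -
  have "Th (EE g) = Const (4 * of_nat e - 1) * EE g"
    using EE_Th[of g] assms by (simp add: EE_Const_mult Const_diff left_diff_distrib)
  from EE_pow_FF[OF this, of m]
  have "(EE ^^ Suc m) (FF (\<lambda>_. e) (EE g)) = FF (\<lambda>_. e) ((EE ^^ Suc (Suc m)) g) +
    Const (of_nat ((m + 1) * (m + 2))) * (EE ^^ Suc m) g"
    by (simp only: funpow_Suc_right o_apply)
  then have "(EE ^^ Suc m) (FF (\<lambda>_. e) (EE g)) = Const (of_nat ((m + 1) * (m + 2))) * (EE ^^ Suc m) g"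
    by (simp only: assms(2) FF_0 add_0)
  moreover have "Const (1 / of_nat (Suc m * (Suc m + 1))) * (Const (of_nat ((m + 1) * (m + 2))) * p) = p" for p
  proof -
    have "(1 / of_nat (Suc m * (Suc m + 1)) * of_nat ((m + 1) * (m + 2)) :: complex) = 1"
      by (simp del: of_nat_Suc of_nat_add of_nat_mult)
    then show ?thesis unfolding mult.assoc[symmetric] Const_mult[symmetric] by simp
  qed
  ultimately show ?thesis
    unfolding proj_step_def EE_pow_simps by simp
qed

lemma EE_proj:
  assumes "Th g = Const (4 * of_nat e) * g" "(EE ^^ Suc m) g = 0"
  shows "EE (proj e m g) = 0"
  using assms
proof (induction m arbitrary: g)
  case (Suc m)
  show ?case
    using Suc.IH[OF Th_proj_step[OF Suc.prems(1)] EE_pow_proj_step[OF Suc.prems]] by simp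
qed simp

lemma Th_proj: "Th g = Const (4 * of_nat e) * g \<Longrightarrow> Th (proj e m g) = Const (4 * of_nat e) * proj e m g"
  by (induction m arbitrary: g) (simp_all add: Th_proj_step)

lemma dle_proj:
  assumes "dle i g (if i \<in> {1..8} then e else 0)"
  shows "dle i (proj e m g) (if i \<in> {1..8} then e else 0)"
  using assms
proof (induction m arbitrary: g)
  case (Suc m)
  have "dle i (proj_step e (Suc m) g) (if i \<in> {1..8} then e else 0)"
    unfolding proj_step_def
    by (intro dle_diff Suc.prems dle_mult_le[where a = 0 and b = "if i \<in> {1..8} then e else 0"]
      dle_Const dle_FF dle_EE) simp
  with Suc.IH show ?case by simp
qed simp

lemma proj_step_sum: "proj_step e m (sum g A) = (\<Sum>a\<in>A. proj_step e m (g a))"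
  by (simp add: proj_step_def EE_sum FF_sum sum_distrib_left sum_subtractf)

lemma proj_sum: "proj e m (sum g A) = (\<Sum>a\<in>A. proj e m (g a))"
  by (induction m arbitrary: g) (simp_all add: proj_step_sum)

lemma proj_invariant: "EE f = 0 \<Longrightarrow> proj e m f = f"
  by (induction m arbitrary: f) (simp_all add: proj_step_def)

text \<open>As \<open>EE\<close> and \<open>FF\<close> annihilate \<open>h\<close>, they act on the
  other factor only. This moves the projection from a combination of the \<open>D S\<close> to its
  coefficients.\<close>

lemma proj_mult_invariant:
  assumes "EE h = 0" "FF (\<lambda>_. a) h = 0"
  shows "proj (a + e) m (h * g) = h * proj e m g"
proof (induction m arbitrary: g)
  case (Suc m)
  have "FF (\<lambda>_. a + e) (h * EE g) = h * FF (\<lambda>_. e) (EE g)"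
    using FF_mult[of "\<lambda>_. a" "\<lambda>_. e" h "EE g"] assms(2) by simp
  then have "proj_step (a + e) (Suc m) (h * g) = h * proj_step e (Suc m) g"
    using assms(1) by (simp add: proj_step_def EE_mult right_diff_distrib mult.left_commute)
  with Suc show ?case by simp
qed simp

text \<open>The \<open>SL\<^sub>2\<close>-invariants among the polynomials of degree at most
  \<open>e\<close> at each of eight points. Degree \<open>4 * e\<close>, half of
  \<open>8 * e\<close>, is weight zero; in a finite-dimensional representation a weight zero vector
  killed by \<open>EE\<close> is invariant.\<close>

definition invariant :: "nat \<Rightarrow> mpoly \<Rightarrow> bool" where
  "invariant e p \<longleftrightarrow> EE p = 0 \<and> homog (4 * e) p \<and> (\<forall>i. dle i p (if i \<in> {1..8} then e else 0))"

text \<open>Homogeneous components are eigenvectors of \<open>Th\<close> for different eigenvalues,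
  so only one of them can survive.\<close>

lemma homog_if_Th:
  assumes "Th p = C k * p" "dle 0 p 0"
  shows "homog k p"
proof -
  obtain J where J: "finite J" "p = (\<Sum>j\<in>J. hc j p)" using sum_hc by blast
  have "hc j p = 0" if "j \<noteq> k" for j
  proof -
    have "Th (hc i p) = C i * hc i p" for i
      by (intro Th_homog homog_hc dle_hc assms(2))
    then have "Th p = (\<Sum>i\<in>J. C i * hc i p)"
      using J by (metis (no_types, lifting) Th_sum sum.cong)
    moreover have "C k * p = (\<Sum>i\<in>J. C k * hc i p)"
      using J by (metis sum_distrib_left)
    ultimately have "(\<Sum>i\<in>J. (C i - C k) * hc i p) = 0"
      using assms(1) by (simp add: left_diff_distrib sum_subtractf)
    then have "0 = hc j (\<Sum>i\<in>J. (C i - C k) * hc i p)" by simp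
    also have "\<dots> = (\<Sum>i\<in>J. if i = j then (C j - C k) * hc j p else 0)"
      unfolding hc_sum
    proof (rule sum.cong)
      fix i
      have "homog (0 + i) (Const (of_nat i - of_nat k) * hc i p)"
        by (intro homog_mult homog_Const homog_hc)
      then show "hc j ((C i - C k) * hc i p) = (if i = j then (C j - C k) * hc j p else 0)"
        using hc_homog[of i "(C i - C k) * hc i p" j] by (simp only: Const_diff add_0) auto
    qed simp
    also have "\<dots> = (if j \<in> J then (C j - C k) * hc j p else 0)" using J(1) by simp
    finally have *: "j \<in> J \<Longrightarrow> hc j p = 0" using that by (auto split: if_splits)
    show ?thesis
    proof (cases "j \<in> J")
      case False
      have "hc j (\<Sum>i\<in>J. hc i p) = 0"
        unfolding hc_sum using False by (intro sum.neutral ballI) (auto simp: hc_homog[OF homog_hc])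
      then show ?thesis using J(2) by simp
    qed (rule *)
  qed
  then have "p = hc k p"
    by (intro poly_mapping_eqI) (metis lookup_hc lookup_zero)
  then show ?thesis using homog_hc by metis
qed

lemma invariant_rep:
  assumes f: "invariant d f"
    and triple: "\<And>a b c. {a, b, c} \<subseteq> {1..8} \<Longrightarrow> distinct [a, b, c] \<Longrightarrow> subst_poly (Var(a := Var c, b := Var c)) f = 0"
  shows "\<exists>e g. f = (\<Sum>S\<in>quads. D S * g S) \<and> (\<forall>S. invariant e (g S))"
proof -
  \<comment> \<open>\<open>triple_diagonal_rep\<close> asks for a bound of at least 3; a smaller
    \<open>d\<close> is padded and turns out to force \<open>f = 0\<close>.\<close>
  define d' where "d' = max d 3"
  define e where "e = d' - 3"
  have d': "d' = 3 + e" "3 \<le> d'" "d \<le> d'" by (simp_all add: d'_def e_def)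
  have "dle i f (if i \<in> {1..8} then d' else 0)" for i
  proof (rule dle_mono)
    show "dle i f (if i \<in> {1..8} then d else 0)" using f unfolding invariant_def by blast
  qed (use d'(3) in simp)
  then have "\<exists>g. f = (\<Sum>S\<in>quads. D S * g S) \<and> (\<forall>S i. dle i (g S) (if i \<in> {1..8} then d' - 3 else 0))"
    by (rule triple_diagonal_rep[OF _ d'(2) triple])
  then obtain g0 where g0: "f = (\<Sum>S\<in>quads. D S * g0 S)" "\<And>S i. dle i (g0 S) (if i \<in> {1..8} then e else 0)"
    unfolding e_def by blast
  have D: "homog 12 (D S)" "EE (D S) = 0" "FF (\<lambda>_. 3) (D S) = 0" if S: "S \<in> quads" for S
  proof -
    obtain k es where k: "D S = Const k * edge_prod es" "edges es" "length es = 12" "\<forall>v\<in>{1..8}. edge_deg es v = 3"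
      using D_edge_prod[OF S] by blast
    show "homog 12 (D S)"
      using homog_mult[OF homog_Const homog_edge_prod[OF k(2)], of k] by (simp add: k)
    show "EE (D S) = 0" by (simp add: k(1) EE_Const_mult EE_edge_prod[OF k(2)])
    show "FF (\<lambda>_. 3) (D S) = 0"
      using FF_edge_prod[OF k(2)] FF_cong[of "edge_deg es" "\<lambda>_. 3" "edge_prod es"] k(4)
      by (simp add: k(1) FF_Const_mult)
  qed
  have f': "homog (4 * d) f" "EE f = 0" using f by (simp_all add: invariant_def)
  show ?thesis
  proof (cases "d < 3")
    case True
    have const: "homog 0 (g0 S)" for S
    proof -
      have "e = 0" using True by (simp add: e_def d'_def)
      then have "dle i (g0 S) 0" for i using g0(2)[of i S] by (simp split: if_splits)
      then show ?thesis using dle_0_imp_Const homog_Const by metis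
    qed
    \<comment> \<open>With constant coefficients the sum has degree 12, whereas \<open>f\<close> has
      degree \<open>4 * d < 12\<close>.\<close>
    have "homog (12 + 0) (\<Sum>S\<in>quads. D S * g0 S)"
      by (intro homog_sum homog_mult D const)
    then have "homog 12 f" using g0(1) by simp
    then have "f = 0" using hc_homog[of 12 f "4 * d"] hc_homog[OF f'(1), of "4 * d"] True by auto
    then show ?thesis
      by (intro exI[of _ 0] exI[of _ "\<lambda>_. 0"]) (simp add: invariant_def)
  next
    case False
    then have d: "d = 3 + e" by (simp add: e_def d'_def)
    define g1 where "g1 S = hc (4 * e) (g0 S)" for S
    have "f = hc (12 + 4 * e) f" using hc_homog[OF f'(1), of "12 + 4 * e"] d by simp
    also have "\<dots> = (\<Sum>S\<in>quads. D S * g1 S)"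
      by (subst g0(1)) (simp add: hc_sum g1_def hc_mult_homog[OF D(1)])
    finally have f1: "f = (\<Sum>S\<in>quads. D S * g1 S)" .
    have dle1: "dle i (g1 S) (if i \<in> {1..8} then e else 0)" for i S
      unfolding g1_def by (intro dle_hc g0(2))
    have hom1: "homog (4 * e) (g1 S)" for S unfolding g1_def by (rule homog_hc)
    have Th1: "Th (g1 S) = Const (4 * of_nat e) * g1 S" for S
      using Th_homog[OF hom1[of S]] dle1[of 0 S] by simp
    \<comment> \<open>The coefficients have degree \<open>4 * e\<close>, so the power
      \<open>4 * e + 1\<close> of \<open>EE\<close> kills them and \<open>4 * e\<close> projection
      steps reach the invariants. The same number of steps fixes \<open>f\<close>.\<close>
    define g where "g S = proj e (4 * e) (g1 S)" for S
    have "f = proj d (4 * e) f" using proj_invariant[OF f'(2)] by simp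
    also have "\<dots> = (\<Sum>S\<in>quads. proj (3 + e) (4 * e) (D S * g1 S))"
      unfolding d by (subst f1) (rule proj_sum)
    also have "\<dots> = (\<Sum>S\<in>quads. D S * g S)"
      unfolding g_def by (intro sum.cong refl proj_mult_invariant D)
    finally have "f = (\<Sum>S\<in>quads. D S * g S)" .
    moreover have "invariant e (g S)" for S
      unfolding invariant_def
    proof (intro conjI allI)
      show "EE (g S) = 0" unfolding g_def by (intro EE_proj Th1 EE_nilpotent hom1)
      show dle: "dle i (g S) (if i \<in> {1..8} then e else 0)" for i
        unfolding g_def by (intro dle_proj dle1)
      show "homog (4 * e) (g S)"
        by (rule homog_if_Th) (use Th_proj[OF Th1[of S], of "4 * e"] dle[of 0] in \<open>simp_all add: g_def\<close>)
    qed
    ultimately show ?thesis by blast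
  qed
qed

section \<open>Invariants are spanned by bracket monomials\<close>

lemma homog_prod: "(\<And>i. i \<in> A \<Longrightarrow> homog (k i) (g i)) \<Longrightarrow> homog (sum k A) (prod g A)"
proof (induction A rule: infinite_finite_induct)
  case (insert i A)
  then show ?case by (simp add: homog_mult)
qed (use homog_Const[of 1] in simp_all)

lemma homog_power: "homog k p \<Longrightarrow> homog (n * k) (p ^ n)"
  using homog_Const[of 1] by (induction n) (simp_all add: homog_mult)

lemma homog_Var': "homog (of_bool (i \<le> 8)) (Var i)"
  by (simp add: homog_def Var_def weight_def lookup_single when_def)

lemma homog_subst_Var:
  assumes "\<And>i. \<exists>j. \<phi> i = Var j \<and> (i \<le> 8 \<longleftrightarrow> j \<le> 8)" "homog k p"
  shows "homog k (subst_poly \<phi> p)"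
  unfolding subst_poly_def
proof (rule homog_sum)
  fix m assume m: "m \<in> Poly_Mapping.keys p"
  have "homog (of_bool (i \<le> 8)) (\<phi> i)" for i
  proof -
    obtain j where "\<phi> i = Var j" "i \<le> 8 \<longleftrightarrow> j \<le> 8" using assms(1)[of i] by blast
    then show ?thesis using homog_Var'[of j] by simp
  qed
  then have "homog (\<Sum>i\<in>Poly_Mapping.keys m. Poly_Mapping.lookup m i * of_bool (i \<le> 8)) (monom_eval \<phi> m)"
    unfolding monom_eval_def by (intro homog_prod homog_power)
  also have "(\<Sum>i\<in>Poly_Mapping.keys m. Poly_Mapping.lookup m i * of_bool (i \<le> 8)) = weight m"
  proof -
    have "(\<Sum>i\<in>Poly_Mapping.keys m. Poly_Mapping.lookup m i * of_bool (i \<le> 8))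
      = (\<Sum>i\<in>Poly_Mapping.keys m \<union> {..8}. Poly_Mapping.lookup m i * of_bool (i \<le> 8))"
      by (intro sum.mono_neutral_left) (auto simp: in_keys_iff)
    also have "\<dots> = (\<Sum>i\<le>8. Poly_Mapping.lookup m i * of_bool (i \<le> 8))"
      by (intro sum.mono_neutral_right) auto
    also have "\<dots> = weight m"
      unfolding weight_def by (intro sum.cong) auto
    finally show ?thesis .
  qed
  also have "weight m = k" using assms(2) m by (simp add: homog_def)
  finally show "homog k (Const (Poly_Mapping.lookup p m) * monom_eval \<phi> m)"
    using homog_mult[OF homog_Const] by fastforce
qed

text \<open>Linear combinations of bracket monomials with prescribed vertex degrees, in a form that
  lets arguments peel off one monomial at a time.\<close>

inductive bracket_span :: "(nat \<Rightarrow> nat) \<Rightarrow> mpoly \<Rightarrow> bool" for d where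
  zero: "bracket_span d 0"
| add: "edges es \<Longrightarrow> (\<And>v. v \<in> {1..8} \<Longrightarrow> edge_deg es v = d v) \<Longrightarrow> bracket_span d p \<Longrightarrow>
    bracket_span d (Const c * edge_prod es + p)"

lemma bracket_span_add: "bracket_span d p \<Longrightarrow> bracket_span d q \<Longrightarrow> bracket_span d (p + q)"
  by (induction rule: bracket_span.induct) (auto simp: add.assoc intro: bracket_span.add)

lemma bracket_span_edge:
  assumes "bracket_span d p" "i \<in> {1..8}" "j \<in> {1..8}" "i \<noteq> j"
    "\<And>v. v \<in> {1..8} \<Longrightarrow> d' v = d v + of_bool (v = i) + of_bool (v = j)"
  shows "bracket_span d' ((Var i - Var j) * p)"
  using assms(1)
proof induction
  case (add es p c)
  have "bracket_span d' (Const c * edge_prod ((i, j) # es) + (Var i - Var j) * p)"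
    using add assms by (intro bracket_span.add) auto
  then show ?case by (simp add: algebra_simps)
qed (simp add: bracket_span.zero)

text \<open>The degrees may differ from point to point, because merging two points in the induction
  below adds their degrees. The degree \<open>k\<close>, half of the total, is again weight
  zero.\<close>

definition covariant :: "(nat \<Rightarrow> nat) \<Rightarrow> mpoly \<Rightarrow> bool" where
  "covariant d p \<longleftrightarrow> (\<forall>i. dle i p (d i)) \<and> EE p = 0 \<and> (\<exists>k. 2 * k = (\<Sum>i\<in>{1..8}. d i) \<and> homog k p)"

lemma covariant_diff:
  assumes "covariant d p" "covariant d q"
  shows "covariant d (p - q)"
proof -
  obtain k where k: "2 * k = (\<Sum>i\<in>{1..8}. d i)" "homog k p" using assms(1) by (auto simp: covariant_def)
  obtain l where l: "2 * l = (\<Sum>i\<in>{1..8}. d i)" "homog l q" using assms(2) by (auto simp: covariant_def)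
  have "k = l" using k(1) l(1) by linarith
  then have "homog k (p - q)" using k(2) l(2) by (simp add: homog_diff)
  then show ?thesis
    using assms k(1) unfolding covariant_def by (auto simp: EE_diff intro: dle_diff)
qed

lemma edge_deg_sum: "edges es \<Longrightarrow> (\<Sum>v\<in>{1..8}. edge_deg es v) = 2 * length es"
proof (induction es)
  case (Cons e es)
  obtain i j where e: "e = (i, j)" by fastforce
  have "(\<Sum>v\<in>{1..8}. of_bool (v = i) :: nat) = 1" if "i \<in> {1..8}" for i :: nat
    using that by (simp add: of_bool_def)
  with Cons show ?case by (simp add: e sum.distrib)
qed simp

lemma covariant_bracket_span:
  assumes "bracket_span d p" "\<And>i. i \<notin> {1..8} \<Longrightarrow> d i = 0" "even (\<Sum>i\<in>{1..8}. d i)"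
  shows "covariant d p"
  using assms(1)
proof induction
  case zero
  then show ?case using assms(3) by (auto simp: covariant_def elim: evenE)
next
  case (add es p c)
  obtain k where k: "2 * k = (\<Sum>i\<in>{1..8}. d i)" "homog k p" using add.IH by (auto simp: covariant_def)
  have "(\<Sum>v\<in>{1..8}. edge_deg es v) = (\<Sum>v\<in>{1..8}. d v)"
    by (rule sum.cong) (use add.hyps in auto)
  then have len: "length es = k" using k(1) edge_deg_sum[OF add.hyps(1)] by simp
  have "edge_deg es i = d i" for i
    using add.hyps edge_deg_outside assms(2) by (cases "i \<in> {1..8}") auto
  then have "dle i (Const c * edge_prod es) (d i)" for i
    using dle_mult[OF dle_Const[of i c 0] dle_edge_prod[of i es]] by simp
  moreover have "homog k (Const c * edge_prod es)"
    using homog_mult[OF homog_Const homog_edge_prod[OF add.hyps(1)]] len by simp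
  ultimately show ?case
    using add.IH k unfolding covariant_def
    by (auto simp: EE_add EE_Const_mult EE_edge_prod[OF add.hyps(1)] intro!: dle_add exI[of _ k] homog_add)
qed

text \<open>Of the \<open>m + n\<close> edge ends at \<open>b\<close>, the first \<open>m\<close>
  met in the list are moved to the isolated vertex \<open>a\<close>; identifying the two vertices
  undoes this. An edge has at most one end at \<open>b\<close>, so no edge between \<open>a\<close>
  and \<open>b\<close> arises.\<close>

lemma split_vertex:
  assumes "edges es" "a \<in> {1..8}" "a \<noteq> b" "edge_deg es a = 0" "edge_deg es b = m + n"
  shows "\<exists>es'. edges es' \<and> edge_deg es' a = m \<and> edge_deg es' b = n \<and>
    (\<forall>v. v \<noteq> a \<longrightarrow> v \<noteq> b \<longrightarrow> edge_deg es' v = edge_deg es v) \<and>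
    subst_poly (Var(a := Var b)) (edge_prod es') = edge_prod es"
  using assms(1,4,5)
proof (induction es arbitrary: m n)
  case Nil
  then show ?case by (intro exI[of _ "[]"]) simp
next
  case (Cons e es)
  obtain i j where e: "e = (i, j)" by fastforce
  have ij: "i \<noteq> a" "j \<noteq> a" "i \<noteq> j" "i \<in> {1..8}" "j \<in> {1..8}" "edges es" "edge_deg es a = 0"
    using Cons.prems(1,2) by (auto simp: e split: if_splits)
  show ?case
  proof (cases "i = b \<or> j = b")
    case False
    then have "edge_deg es b = m + n" using Cons.prems(3) by (auto simp: e)
    from Cons.IH[OF ij(6,7) this] obtain es' where es': "edges es'" "edge_deg es' a = m" "edge_deg es' b = n"
      "\<forall>v. v \<noteq> a \<longrightarrow> v \<noteq> b \<longrightarrow> edge_deg es' v = edge_deg es v"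
      "subst_poly (Var(a := Var b)) (edge_prod es') = edge_prod es" by blast
    show ?thesis
      using es' ij False by (intro exI[of _ "(i, j) # es'"]) (auto simp: e subst_poly_mult subst_poly_diff simp del: fun_upd_apply simp add: fun_upd_same fun_upd_other)
  next
    case True
    then have deg: "Suc (edge_deg es b) = m + n" using Cons.prems(3) ij by (auto simp: e)
    show ?thesis
    proof (cases m)
      case 0
      then have n: "n = Suc (edge_deg es b)" using deg by simp
      have "edge_deg es b = 0 + edge_deg es b" by simp
      from Cons.IH[OF ij(6,7) this] obtain es' where es': "edges es'" "edge_deg es' a = 0" "edge_deg es' b = edge_deg es b"
        "\<forall>v. v \<noteq> a \<longrightarrow> v \<noteq> b \<longrightarrow> edge_deg es' v = edge_deg es v"
        "subst_poly (Var(a := Var b)) (edge_prod es') = edge_prod es" by blast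
      show ?thesis
        using es' ij True 0 n by (intro exI[of _ "(i, j) # es'"]) (auto simp: e subst_poly_mult subst_poly_diff simp del: fun_upd_apply simp add: fun_upd_same fun_upd_other)
    next
      case (Suc m')
      then have "edge_deg es b = m' + n" using deg by simp
      from Cons.IH[OF ij(6,7) this] obtain es' where es': "edges es'" "edge_deg es' a = m'" "edge_deg es' b = n"
        "\<forall>v. v \<noteq> a \<longrightarrow> v \<noteq> b \<longrightarrow> edge_deg es' v = edge_deg es v"
        "subst_poly (Var(a := Var b)) (edge_prod es') = edge_prod es" by blast
      show ?thesis
        using es' ij True Suc assms(2,3)
        by (intro exI[of _ "(if i = b then a else i, if j = b then a else j) # es'"])
          (auto simp: e subst_poly_mult subst_poly_diff simp del: fun_upd_apply simp add: fun_upd_same fun_upd_other)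
    qed
  qed
qed

text \<open>Splitting the merged vertex in every term shows that restriction to
  \<open>X\<^sub>a = X\<^sub>b\<close> is onto.\<close>

lemma lift_bracket_span:
  assumes "bracket_span (d(a := 0, b := d a + d b)) p" "a \<in> {1..8}" "b \<in> {1..8}" "a \<noteq> b"
  shows "\<exists>p'. bracket_span d p' \<and> subst_poly (Var(a := Var b)) p' = p"
  using assms(1)
proof induction
  case zero
  then show ?case by (intro exI[of _ 0]) (simp add: bracket_span.zero)
next
  case (add es p c)
  then obtain p' where p': "bracket_span d p'" "subst_poly (Var(a := Var b)) p' = p" by blast
  have "edge_deg es a = 0" "edge_deg es b = d a + d b"
    using add.hyps(2)[of a] add.hyps(2)[of b] assms(2-4) by simp_all
  from split_vertex[OF add.hyps(1) assms(2,4) this] obtain es' where es': "edges es'" "edge_deg es' a = d a" "edge_deg es' b = d b"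
    "\<And>v. v \<noteq> a \<Longrightarrow> v \<noteq> b \<Longrightarrow> edge_deg es' v = edge_deg es v"
    "subst_poly (Var(a := Var b)) (edge_prod es') = edge_prod es" by blast
  have "edge_deg es' v = d v" if "v \<in> {1..8}" for v
    using es'(2,3) es'(4)[of v] add.hyps(2)[OF that] by (cases "v = a"; cases "v = b") auto
  then have "bracket_span d (Const c * edge_prod es' + p')"
    by (intro bracket_span.add es' p')
  moreover have "subst_poly (Var(a := Var b)) (Const c * edge_prod es' + p') = Const c * edge_prod es + p"
    by (simp only: subst_poly_add subst_poly_mult subst_poly_Const es'(5) p'(2))
  ultimately show ?case by blast
qed

lemma EE_subst:
  assumes "a \<in> {1..8}" "b \<in> {1..8}"
  shows "EE (subst_poly (Var(a := Var b)) p) = subst_poly (Var(a := Var b)) (EE p)"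
proof (induction p rule: mpoly_induct)
  case (Var i)
  have "EE (Var i) = (if i \<in> {1..8} then 1 else 0)" for i
    by (simp add: EE_def pd_Var)
  then show ?case using assms by simp
next
  case (mult p q)
  then show ?case by (simp add: EE_mult subst_poly_hom del: fun_upd_apply)
next
  case (add p q)
  then show ?case by (simp add: EE_add subst_poly_hom del: fun_upd_apply)
qed simp

lemma pd_eq_0: "dle i p 0 \<Longrightarrow> pd i p = 0"
  unfolding pd_def dle_def by (intro sum.neutral) auto

lemma sum_upd2:
  fixes d :: "nat \<Rightarrow> nat"
  assumes "finite X" "a \<in> X" "b \<in> X" "a \<noteq> b"
  shows "sum (d(a := x, b := y)) X = x + y + sum d (X - {a, b})"
proof -
  have *: "sum f X = f a + f b + sum f (X - {a, b})" for f :: "nat \<Rightarrow> nat"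
  proof -
    have "insert a (insert b (X - {a, b})) = X" using assms by auto
    moreover have "sum f (insert a (insert b (X - {a, b}))) = f a + (f b + sum f (X - {a, b}))"
      using assms by simp
    ultimately show ?thesis by (simp only: add.assoc)
  qed
  have "sum (d(a := x, b := y)) (X - {a, b}) = sum d (X - {a, b})"
    by (rule sum.cong) auto
  then show ?thesis using *[of "d(a := x, b := y)"] assms(4) by simp
qed

lemma covariant_merge:
  assumes "covariant d p" "a \<in> {1..8}" "b \<in> {1..8}" "a \<noteq> b"
  shows "covariant (d(a := 0, b := d a + d b)) (subst_poly (Var(a := Var b)) p)"
proof -
  have dle: "dle i p (d i)" for i using assms(1) by (simp add: covariant_def)
  obtain k where k: "2 * k = (\<Sum>i\<in>{1..8}. d i)" "homog k p" using assms(1) by (auto simp: covariant_def)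
  have "dle i (subst_poly (Var(a := Var b)) p) ((d(a := 0, b := d a + d b)) i)" for i
    using dle_subst_upd[OF dle[of a] dle[of i], of "Var b"] assms(4)
    by (cases "i = b"; cases "i = a") (auto simp del: fun_upd_apply simp add: fun_upd_def split: if_splits)
  moreover have "(\<Sum>i\<in>{1..8}. (d(a := 0, b := d a + d b)) i) = (\<Sum>i\<in>{1..8}. d i)"
    using sum_upd2[of "{1..8}" a b d 0 "d a + d b"] sum_upd2[of "{1..8}" a b d "d a" "d b"] assms(2-4)
    by (simp del: fun_upd_apply add: fun_upd_triv)
  moreover have "homog k (subst_poly (Var(a := Var b)) p)"
    using assms(2,3) by (intro homog_subst_Var k) auto
  moreover have "EE (subst_poly (Var(a := Var b)) p) = 0"
    using assms by (simp add: EE_subst covariant_def del: fun_upd_apply)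
  ultimately show ?thesis
    using k(1) unfolding covariant_def by metis
qed

text \<open>Removing a bracket lowers the total degree by 2 and the degree of the polynomial by 1,
  so the weight stays zero.\<close>

lemma covariant_cancel:
  assumes "covariant d ((Var a - Var b) * p)" "a \<in> {1..8}" "b \<in> {1..8}" "a \<noteq> b" "0 < d a" "0 < d b"
  shows "covariant (d(a := d a - 1, b := d b - 1)) p"
proof -
  let ?d = "d(a := d a - 1, b := d b - 1)"
  obtain k where k: "2 * k = (\<Sum>i\<in>{1..8}. d i)" "homog k ((Var a - Var b) * p)" using assms(1) by (auto simp: covariant_def)
  have sum: "(\<Sum>i\<in>{1..8}. d i) = (\<Sum>i\<in>{1..8}. ?d i) + 2"
    using sum_upd2[of "{1..8}" a b d "d a - 1" "d b - 1"] sum_upd2[of "{1..8}" a b d "d a" "d b"] assms(2-6)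
    by (simp del: fun_upd_apply add: fun_upd_triv)
  have nz: "Var a - Var b \<noteq> 0" using assms(4) by (simp add: Var_inject)
  have k': "2 * (k - 1) = (\<Sum>i\<in>{1..8}. ?d i)" "1 \<le> k" using k(1) sum by linarith+
  have "homog 1 (Var a - Var b)" using assms(2,3) by (intro homog_diff homog_Var) auto
  from hc_mult_homog[OF this, of "k - 1" p] have "(Var a - Var b) * p = (Var a - Var b) * hc (k - 1) p"
    using hc_homog[OF k(2), of k] k'(2) by simp
  then have "p = hc (k - 1) p" using nz by simp
  then have "homog (k - 1) p" using homog_hc by metis
  moreover have "dle i p (?d i)" for i
  proof (cases "p = 0")
    case False
    have "dle i ((Var a - Var b) * p) (d i)" using assms(1) by (simp add: covariant_def)
    from dle_cancel(1)[OF _ _ this False] show ?thesis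
      using assms(4) dle_mono[OF dle_Var, of i b "Suc 0"] by (cases "i = a"; cases "i = b") auto
  qed simp
  moreover have "(Var a - Var b) * EE p = 0"
    using assms(1-3) by (simp add: covariant_def EE_mult EE_diff EE_Var)
  then have "EE p = 0" using nz by simp
  ultimately show ?thesis using k' unfolding covariant_def by blast
qed

text \<open>Two points of positive degree are merged and a bracket representation of the restriction
  is lifted. The difference vanishes on \<open>X\<^sub>a = X\<^sub>b\<close>, hence is divisible by
  that bracket, and the quotient is again a covariant.\<close>

lemma covariant_imp_bracket_span:
  assumes "covariant d p" "\<And>i. i \<notin> {1..8} \<Longrightarrow> d i = 0"
  shows "bracket_span d p"
  using assms
\<comment> \<open>Merging keeps the total degree and lowers the number of active points; dividing by
  a bracket lowers the total degree. At most eight points are active, so the factor 9 gives priority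
  to the total degree.\<close>
proof (induction "9 * (\<Sum>i\<in>{1..8}. d i) + card {i\<in>{1..8}. d i \<noteq> 0}" arbitrary: d p rule: less_induct)
  case less
  let ?A = "{i\<in>{1..8}. d i \<noteq> 0}"
  have dle: "dle i p (d i)" for i using less.prems(1) by (simp add: covariant_def)
  obtain k where k: "2 * k = (\<Sum>i\<in>{1..8}. d i)" "homog k p" using less.prems(1) by (auto simp: covariant_def)
  consider "?A = {}" | a where "?A = {a}" | a b where "a \<in> ?A" "b \<in> ?A" "a \<noteq> b" by blast
  then show ?case
  proof cases
    case 1
    then have d: "d i = 0" for i using less.prems(2)[of i] by (cases "i \<in> {1..8}") auto
    then obtain c where "p = Const c" using dle dle_0_imp_Const[of p] by auto
    then show ?thesis
      using bracket_span.add[of "[]" d 0 c] d by (simp add: bracket_span.zero)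
  next
    case (2 a)
    then have a: "a \<in> {1..8}" "d a \<noteq> 0" by auto
    have d: "d i = 0" if "i \<noteq> a" for i
    proof (rule ccontr)
      assume "d i \<noteq> 0"
      with less.prems(2)[of i] have "i \<in> ?A" by (cases "i \<in> {1..8}") simp_all
      with 2 that show False by blast
    qed
    have pd: "pd i p = 0" if "i \<noteq> a" for i
      using dle[of i] d[OF that] by (simp add: pd_eq_0)
    \<comment> \<open>With a single active variable, translation invariance makes \<open>p\<close>
      constant, while its degree \<open>k\<close> is positive; so \<open>p = 0\<close>.\<close>
    have "EE p = pd a p"
      unfolding EE_def using a(1) pd by (subst sum.remove[of _ a]) auto
    then have "pd a p = 0" using less.prems(1) by (simp add: covariant_def)
    with pd have "pd i p = 0" for i by (cases "i = a") auto
    then have "Th p = 0" by (simp add: Th_def)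
    moreover have "dle 0 p 0" using dle[of 0] less.prems(2)[of 0] by simp
    ultimately have "C k * p = 0" using Th_homog[OF k(2)] by simp
    moreover have "k \<noteq> 0"
    proof
      assume "k = 0"
      then have "(\<Sum>i\<in>{1..8}. d i) = 0" using k(1) by simp
      then have "d a = 0" using a(1) by (simp only: sum_eq_0_iff finite_atLeastAtMost)
      with a(2) show False by simp
    qed
    ultimately have "p = 0" by simp
    then show ?thesis by (simp add: bracket_span.zero)
  next
    case (3 a b)
    then have ab: "a \<in> {1..8}" "b \<in> {1..8}" "a \<noteq> b" "0 < d a" "0 < d b" by auto
    let ?m = "d(a := 0, b := d a + d b)"
    have sum_m: "(\<Sum>i\<in>{1..8}. ?m i) = (\<Sum>i\<in>{1..8}. d i)"
      using sum_upd2[of "{1..8}" a b d 0 "d a + d b"] sum_upd2[of "{1..8}" a b d "d a" "d b"] ab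
      by (simp del: fun_upd_apply add: fun_upd_triv)
    have "{i\<in>{1..8}. ?m i \<noteq> 0} = ?A - {a}" using ab by auto
    then have "card {i\<in>{1..8}. ?m i \<noteq> 0} < card ?A"
      using 3 by (simp only:) (rule card_Diff1_less; simp)
    then have "bracket_span ?m (subst_poly (Var(a := Var b)) p)"
      using ab less.prems sum_m by (intro less.hyps covariant_merge) auto
    from lift_bracket_span[OF this ab(1-3)] obtain p' where p': "bracket_span d p'"
      "subst_poly (Var(a := Var b)) p' = subst_poly (Var(a := Var b)) p" by blast
    then obtain h where h: "p - p' = (Var a - Var b) * h"
      using restrict_eq_imp_dvd by metis
    have "even (\<Sum>i\<in>{1..8}. d i)" using k(1) by (metis dvd_triv_left)
    with covariant_bracket_span[OF p'(1) less.prems(2)] have "covariant d p'" by blast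
    with less.prems(1) have "covariant d (p - p')" by (rule covariant_diff)
    then have cov: "covariant (d(a := d a - 1, b := d b - 1)) h"
      unfolding h using ab by (intro covariant_cancel)
    let ?n = "d(a := d a - 1, b := d b - 1)"
    have "(\<Sum>i\<in>{1..8}. d i) = (\<Sum>i\<in>{1..8}. ?n i) + 2"
      using sum_upd2[of "{1..8}" a b d "d a - 1" "d b - 1"] sum_upd2[of "{1..8}" a b d "d a" "d b"] ab
      by (simp del: fun_upd_apply add: fun_upd_triv)
    moreover have "card {i\<in>{1..8}. ?n i \<noteq> 0} \<le> card ?A"
      by (intro card_mono) (use ab in auto)
    ultimately have "bracket_span ?n h"
      using less.prems(2) ab by (intro less.hyps cov) auto
    then have "bracket_span d ((Var a - Var b) * h)"
      using ab by (intro bracket_span_edge) auto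
    with p'(1) have "bracket_span d (p' + (Var a - Var b) * h)" by (rule bracket_span_add)
    then show ?thesis by (simp flip: h)
  qed
qed

section \<open>Perfect matchings are combinations of standard Specht polynomials\<close>

lemma edge_prod_mset: "mset es = mset es' \<Longrightarrow> edge_prod es = edge_prod es'"
  unfolding edge_prod_def prod_mset_prod_list[symmetric] mset_map by simp

lemma linear_forms_add: "p \<in> linear_forms \<Longrightarrow> q \<in> linear_forms \<Longrightarrow> p + q \<in> linear_forms"
  unfolding linear_forms_def
proof clarify
  fix c c' :: "nat \<Rightarrow> complex"
  show "\<exists>d. (\<Sum>k\<in>{1..14}. Const (c k) * Y k) + (\<Sum>k\<in>{1..14}. Const (c' k) * Y k) = (\<Sum>k\<in>{1..14}. Const (d k) * Y k) \<and> True"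
    by (intro exI[of _ "\<lambda>k. c k + c' k"]) (simp add: Const_add distrib_right sum.distrib)
qed

lemma linear_forms_Const: "p \<in> linear_forms \<Longrightarrow> Const a * p \<in> linear_forms"
  unfolding linear_forms_def
proof clarify
  fix c :: "nat \<Rightarrow> complex"
  show "\<exists>d. Const a * (\<Sum>k\<in>{1..14}. Const (c k) * Y k) = (\<Sum>k\<in>{1..14}. Const (d k) * Y k) \<and> True"
    by (intro exI[of _ "\<lambda>k. a * c k"]) (simp add: Const_mult sum_distrib_left mult.assoc)
qed

lemma linear_forms_uminus: "p \<in> linear_forms \<Longrightarrow> - p \<in> linear_forms"
  using linear_forms_Const[of p "- 1"] by (simp add: Const_uminus)

lemma linear_forms_diff: "p \<in> linear_forms \<Longrightarrow> q \<in> linear_forms \<Longrightarrow> p - q \<in> linear_forms"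
  using linear_forms_add[of p "- q"] linear_forms_uminus[of q] by simp

lemma linear_forms_Y: "k \<in> {1..14} \<Longrightarrow> Y k \<in> linear_forms"
  unfolding linear_forms_def
  by (intro CollectI exI[of _ "\<lambda>j. if j = k then 1 else 0"])
    (simp add: if_distrib[of Const] if_distrib[of "\<lambda>c. c * _"] cong: if_cong)

text \<open>Comparing multisets makes the notion independent of the order and the orientation of the
  edges.\<close>

definition perfect :: "(nat \<times> nat) list \<Rightarrow> bool" where
  "perfect es \<longleftrightarrow> mset (map fst es @ map snd es) = mset [1..<9]"

text \<open>An executable enumeration: the first point is paired with each of the others. For eight
  points this gives 7 * 5 * 3 = 105 matchings.\<close>

function matchings :: "nat list \<Rightarrow> (nat \<times> nat) list list" where
  "matchings [] = [[]]"
| "matchings (x # xs) = concat (map (\<lambda>y. map ((#) (x, y)) (matchings (remove1 y xs))) xs)"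
  by pat_completeness auto
termination by (relation "measure length") (auto simp: length_remove1)

text \<open>If edges point upwards and are sorted by their left ends, the first edge must start at
  the minimum \<open>x\<close>, as in the enumeration.\<close>

lemma in_matchings:
  assumes "sorted xs" "\<And>i j. (i, j) \<in> set es \<Longrightarrow> i < j" "sorted (map fst es)"
    "mset (map fst es @ map snd es) = mset xs"
  shows "es \<in> set (matchings xs)"
  using assms
proof (induction xs arbitrary: es rule: matchings.induct)
  case (1 es)
  then show ?case by simp
next
  case (2 x xs es)
  have mem: "set (map fst es @ map snd es) = set (x # xs)"
    using mset_eq_setD[OF "2.prems"(4)] .
  have min: "x \<le> y" if "y \<in> set (map fst es @ map snd es)" for y
    using that "2.prems"(1) unfolding mem by auto
  have "x \<in> set (map fst es @ map snd es)" using mem by simp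
  then obtain i j where ij: "(i, j) \<in> set es" "x = i \<or> x = j" by fastforce
  have "i \<in> set (map fst es @ map snd es)" using ij(1) by force
  then have "x = i" using ij "2.prems"(2)[OF ij(1)] min[of i] by auto
  obtain a b es' where es: "es = (a, b) # es'" using ij(1) by (cases es) auto
  have "a \<le> i" using "2.prems"(3) ij(1) by (auto simp: es)
  moreover have "x \<le> a" by (rule min) (simp add: es)
  ultimately have a: "a = x" using \<open>x = i\<close> by simp
  have ms: "mset (map fst es' @ map snd es') + {#b#} = mset xs"
    using "2.prems"(4) by (simp add: es a)
  then have b: "b \<in> set xs" by (metis mset_subset_eq_add_right mset_subset_eqD set_mset_mset union_single_eq_member)
  have "es' \<in> set (matchings (remove1 b xs))"
  proof (rule "2.IH"[OF b])
    show "sorted (remove1 b xs)" using "2.prems"(1) by (simp add: sorted_remove1)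
    show "mset (map fst es' @ map snd es') = mset (remove1 b xs)"
      using ms[symmetric] by simp
  qed (use "2.prems" es in auto)
  then show ?case using b by (auto simp: es a)
qed

text \<open>Without nesting, the right ends increase along with the left ends, so the edges are the
  columns of a standard tableau. The finitely many cases are evaluated.\<close>

lemma nonnesting_standard:
  "list_all (\<lambda>es. (\<forall>e\<in>set es. \<forall>f\<in>set es. \<not> (fst e < fst f \<and> snd f < snd e)) \<longrightarrow>
    (map fst es, map snd es) \<in> set standard_tableaux) (matchings [1..<9])"
  by code_simp

lemma standard_tableaux_Y:
  assumes "(is, js) \<in> set standard_tableaux"
  shows "\<exists>k\<in>{1..14}. Y k = specht is js"
proof -
  have len: "length standard_tableaux = 14" by (simp add: standard_tableaux_def)
  from assms obtain n where n: "n < 14" "standard_tableaux ! n = (is, js)"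
    by (auto simp: in_set_conv_nth len)
  then show ?thesis by (intro bexI[of _ "Suc n"]) (auto simp: Y_def)
qed

lemma perfect_length:
  assumes "perfect es"
  shows "length es = 4"
proof -
  have "length (map fst es @ map snd es) = length [1..<9]"
    using assms unfolding perfect_def by (rule mset_eq_length)
  then show ?thesis by simp
qed

lemma endpoints_mset: "mset es = mset es' \<Longrightarrow> mset (map fst es @ map snd es) = mset (map fst es' @ map snd es')"
  by simp

lemma sum_list_map_mset: "mset es = mset es' \<Longrightarrow> (\<Sum>e\<leftarrow>es. f e) = (\<Sum>e\<leftarrow>es'. f e :: nat)"
  unfolding sum_mset_sum_list[symmetric] mset_map by simp

lemma specht_edge_prod:
  assumes "length es = 4"
  shows "specht (map fst es) (map snd es) = edge_prod es"
proof -
  obtain a b c d where "es = [a, b, c, d]"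
    using assms by (auto simp: numeral_eq_Suc length_Suc_conv)
  then show ?thesis
    by (cases a; cases b; cases c; cases d) (simp add: specht_def numeral_eq_Suc mult_ac)
qed

lemma mset_Cons2:
  assumes "e \<in> set es" "f \<in> set es" "e \<noteq> f"
  shows "\<exists>r. mset es = mset (e # f # r)"
proof -
  obtain M where M: "mset es = add_mset e M"
    using assms(1) multi_member_split[of e "mset es"] by auto
  have "f \<in># M" using assms(2,3) M by (metis insert_iff set_mset_add_mset_insert set_mset_mset)
  then obtain M' where "M = add_mset f M'" using multi_member_split by metis
  moreover obtain r where "mset r = M'" using ex_mset by blast
  ultimately show ?thesis using M by (intro exI[of _ r]) simp
qed

text \<open>Replacing a nested pair of edges by the Pluecker relation shortens the edges in the quadratic mean;
  the nonnesting matchings are the standard tableaux.\<close>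

lemma perfect_edge_prod_oriented:
  assumes "perfect es" "\<And>i j. (i, j) \<in> set es \<Longrightarrow> i < j"
  shows "edge_prod es \<in> linear_forms"
  using assms
proof (induction "\<Sum>(i, j)\<leftarrow>es. (j - i)\<^sup>2" arbitrary: es rule: less_induct)
  case less
  show ?case
  proof (cases "\<exists>e\<in>set es. \<exists>f\<in>set es. fst e < fst f \<and> snd f < snd e")
    case True
    then obtain a d b c where adbc: "(a, d) \<in> set es" "(b, c) \<in> set es" "a < b" "c < d" by auto
    have lt: "b < c" using less.prems(2)[OF adbc(2)] .
    then have lt': "a < c" "b < d" using adbc(3,4) by simp_all
    obtain r where r: "mset es = mset ((a, d) # (b, c) # r)"
      using mset_Cons2[OF adbc(1,2)] adbc(3) by auto
    have sum_list_mset: "(\<Sum>(i, j)\<leftarrow>es. (j - i)\<^sup>2) = (\<Sum>(i, j)\<leftarrow>(a, d) # (b, c) # r. (j - i)\<^sup>2)"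
      by (rule sum_list_map_mset[OF r])
    have set_es: "set es = set ((a, d) # (b, c) # r)" using mset_eq_setD[OF r] .
    have perf: "perfect es'" if "mset (map fst es' @ map snd es') = mset (map fst ((a, d) # (b, c) # r) @ map snd ((a, d) # (b, c) # r))" for es'
      using less.prems(1) endpoints_mset[OF r] that unfolding perfect_def by simp
    have sq: "(c - a)\<^sup>2 + (d - b)\<^sup>2 < (d - a)\<^sup>2 + (c - b)\<^sup>2" "(b - a)\<^sup>2 + (d - c)\<^sup>2 < (d - a)\<^sup>2 + (c - b)\<^sup>2"
    proof -
      obtain x where x: "b = a + x" "0 < x" using adbc(3) less_imp_add_positive by blast
      obtain y where y: "c = b + y" "0 < y" using lt less_imp_add_positive by blast
      obtain z where z: "d = c + z" "0 < z" using adbc(4) less_imp_add_positive by blast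
      \<comment> \<open>The first of the two gaps between the sums of squares is
        \<open>2 * x * z\<close>.\<close>
      have "0 < x * z" using x z by simp
      then show "(c - a)\<^sup>2 + (d - b)\<^sup>2 < (d - a)\<^sup>2 + (c - b)\<^sup>2" "(b - a)\<^sup>2 + (d - c)\<^sup>2 < (d - a)\<^sup>2 + (c - b)\<^sup>2"
        using y by (simp_all add: x(1) y(1) z(1) power2_eq_square algebra_simps)
    qed
    have "edge_prod ((a, c) # (b, d) # r) \<in> linear_forms"
      using adbc lt lt' sq(1) less.prems(2) set_es
      by (intro less.hyps perf) (auto simp: sum_list_mset)
    moreover have "edge_prod ((a, b) # (c, d) # r) \<in> linear_forms"
      using adbc lt lt' sq(2) less.prems(2) set_es
      by (intro less.hyps perf) (auto simp: sum_list_mset)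
    moreover have "edge_prod es = edge_prod ((a, c) # (b, d) # r) - edge_prod ((a, b) # (c, d) # r)"
      unfolding edge_prod_mset[OF r] by (simp add: algebra_simps)
    ultimately show ?thesis by (simp add: linear_forms_diff)
  next
    case False
    define es' where "es' = sort_key fst es"
    have m: "mset es' = mset es" by (simp add: es'_def)
    have set_es': "set es' = set es" by (simp add: es'_def)
    have "es' \<in> set (matchings [1..<9])"
    proof (rule in_matchings)
      show "mset (map fst es' @ map snd es') = mset [1..<9]"
        using less.prems(1) endpoints_mset[OF m] unfolding perfect_def by simp
      show "sorted (map fst es')" by (simp add: es'_def)
    qed (use less.prems(2) set_es' in auto)
    then have "(map fst es', map snd es') \<in> set standard_tableaux"
      using nonnesting_standard False set_es' unfolding list_all_iff by blast
    then obtain k where k: "k \<in> {1..14}" "Y k = specht (map fst es') (map snd es')"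
      using standard_tableaux_Y by blast
    have "length es' = 4" using perfect_length[OF less.prems(1)] by (simp add: es'_def)
    then have "edge_prod es = Y k"
      using k(2) specht_edge_prod[of es'] edge_prod_mset[OF m] by simp
    then show ?thesis using linear_forms_Y[OF k(1)] by simp
  qed
qed

text \<open>Reversing an edge only changes the sign. \<open>P\<close> will be the order of the
  endpoints for tableaux and the bipartition in Kempe's argument.\<close>

lemma orient_edges:
  assumes "\<And>i j. (i, j) \<in> set es \<Longrightarrow> P i j \<or> P j i"
  shows "\<exists>es'. (\<forall>(i, j)\<in>set es'. P i j) \<and> (edge_prod es = edge_prod es' \<or> edge_prod es = - edge_prod es') \<and>
    mset (map fst es' @ map snd es') = mset (map fst es @ map snd es) \<and>
    (\<forall>v. edge_deg es' v = edge_deg es v) \<and> (edges es \<longrightarrow> edges es')"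
  using assms
proof (induction es)
  case Nil
  show ?case by (intro exI[of _ "[]"]) simp
next
  case (Cons e es)
  obtain i j where e: "e = (i, j)" by fastforce
  obtain es' where es': "\<forall>(i, j)\<in>set es'. P i j" "edge_prod es = edge_prod es' \<or> edge_prod es = - edge_prod es'"
    "mset (map fst es' @ map snd es') = mset (map fst es @ map snd es)" "\<forall>v. edge_deg es' v = edge_deg es v" "edges es \<longrightarrow> edges es'"
    using Cons.IH Cons.prems by auto
  show ?case
  proof (cases "P i j")
    case True
    then show ?thesis using es' by (intro exI[of _ "(i, j) # es'"]) (auto simp: e)
  next
    case False
    then have "P j i" using Cons.prems[of i j] by (simp add: e)
    moreover have "(Var i - Var j) * p = - ((Var j - Var i) * p)" for p by (simp add: algebra_simps)
    ultimately show ?thesis using es' by (intro exI[of _ "(j, i) # es'"]) (auto simp: e)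
  qed
qed

lemma perfect_edge_prod:
  assumes "perfect es"
  shows "edge_prod es \<in> linear_forms"
proof -
  have ne: "i < j \<or> j < i" if mem: "(i, j) \<in> set es" for i j
  proof (rule ccontr)
    assume "\<not> ?thesis"
    then have "i = j" by simp
    have "count (mset (map fst es @ map snd es)) i = count (mset [1..<9]) i"
      using assms by (simp add: perfect_def)
    moreover have "count (mset [1..<9]) i \<le> 1"
      by (simp add: count_mset_set')
    moreover obtain xs ys where "es = xs @ (i, j) # ys" using split_list[OF mem] by blast
    then have "2 \<le> count (mset (map fst es @ map snd es)) i"
      by (simp add: \<open>i = j\<close>)
    ultimately show False by simp
  qed
  from orient_edges[of es "(<)", OF ne] obtain es' where es': "\<forall>(i, j)\<in>set es'. i < j"
    "edge_prod es = edge_prod es' \<or> edge_prod es = - edge_prod es'"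
    "mset (map fst es' @ map snd es') = mset (map fst es @ map snd es)" by blast
  have "edge_prod es' \<in> linear_forms"
    by (rule perfect_edge_prod_oriented) (use es'(1,3) assms in \<open>auto simp: perfect_def\<close>)
  then show ?thesis using es'(2) linear_forms_uminus by auto
qed

section \<open>Hall's theorem\<close>

text \<open>The proof asks whether some nonempty proper subset is tight. If none is, one point can
  be matched arbitrarily, since removing its partner costs every neighbourhood at most one element.
  If \<open>S\<close> is tight, \<open>S\<close> and its complement are matched separately, the
  latter outside the neighbourhood of \<open>S\<close>.\<close>

lemma hall:
  assumes "finite A" "\<And>a. a \<in> A \<Longrightarrow> finite (N a)" "\<And>S. S \<subseteq> A \<Longrightarrow> card S \<le> card (\<Union>(N ` S))"
  shows "\<exists>f. inj_on f A \<and> (\<forall>a\<in>A. f a \<in> N a)"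
  using assms
proof (induction "card A" arbitrary: A N rule: less_induct)
  case less
  show ?case
  proof (cases "A = {}")
    case True
    then show ?thesis by simp
  next
    case False
    have finN: "finite (\<Union>(N ` S))" if "S \<subseteq> A" for S
      using that less.prems(1,2) by (intro finite_UN_I) (auto intro: finite_subset)
    show ?thesis
    proof (cases "\<exists>S. S \<subset> A \<and> S \<noteq> {} \<and> card (\<Union>(N ` S)) \<le> card S")
      case False
      obtain a where a: "a \<in> A" using \<open>A \<noteq> {}\<close> by blast
      have "card {a} \<le> card (\<Union>(N ` {a}))" using a by (intro less.prems) auto
      then have "N a \<noteq> {}" by auto
      then obtain b where b: "b \<in> N a" by blast
      have "\<exists>f. inj_on f (A - {a}) \<and> (\<forall>x\<in>A - {a}. f x \<in> N x - {b})"
      proof (rule less.hyps)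
        show "card (A - {a}) < card A" using less.prems(1) a by (rule card_Diff1_less)
        fix S assume S: "S \<subseteq> A - {a}"
        show "card S \<le> card (\<Union>x\<in>S. N x - {b})"
        proof (cases "S = {}")
          case nonempty: False
          have "S \<subset> A" using S a by blast
          with False nonempty have "card S < card (\<Union>(N ` S))" by (meson not_less)
          moreover have "(\<Union>x\<in>S. N x - {b}) = \<Union>(N ` S) - {b}" by blast
          moreover have "card (\<Union>(N ` S)) - 1 \<le> card (\<Union>(N ` S) - {b})"
            using finN[of S] S by (simp add: card_Diff_singleton_if)
          ultimately show ?thesis by simp
        qed simp
      qed (use less.prems in auto)
      then obtain f where f: "inj_on f (A - {a})" "\<forall>x\<in>A - {a}. f x \<in> N x - {b}" by blast
      have "inj_on (f(a := b)) A"
        using f by (auto simp: inj_on_def)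
      then show ?thesis using f b by (intro exI[of _ "f(a := b)"]) auto
    next
      case True
      then obtain S where S: "S \<subset> A" "S \<noteq> {}" "card (\<Union>(N ` S)) \<le> card S" by blast
      have finS: "finite S" using S less.prems(1) finite_subset by blast
      have "card S < card A" using S less.prems(1) by (intro psubset_card_mono)
      then have "\<exists>f. inj_on f S \<and> (\<forall>x\<in>S. f x \<in> N x)"
        using S less.prems finS by (intro less.hyps) auto
      then obtain f where f: "inj_on f S" "\<forall>x\<in>S. f x \<in> N x" by blast
      let ?N = "\<Union>(N ` S)"
      have "\<exists>g. inj_on g (A - S) \<and> (\<forall>x\<in>A - S. g x \<in> N x - ?N)"
      proof (rule less.hyps)
        show "card (A - S) < card A" using S less.prems(1) by (intro psubset_card_mono) auto
        fix T assume T: "T \<subseteq> A - S"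
        have finT: "finite T" using T less.prems(1) finite_subset by blast
        have "card T + card S = card (T \<union> S)"
          using T finT finS by (intro card_Un_disjoint[symmetric]) auto
        also have "\<dots> \<le> card (\<Union>(N ` (T \<union> S)))" using T S by (intro less.prems(3)) auto
        also have "\<Union>(N ` (T \<union> S)) = (\<Union>x\<in>T. N x - ?N) \<union> ?N" by blast
        also have "card \<dots> = card (\<Union>x\<in>T. N x - ?N) + card ?N"
        proof (rule card_Un_disjoint)
          show "finite (\<Union>x\<in>T. N x - ?N)"
            by (rule finite_subset[OF _ finN[of T]]) (use T in auto)
        qed (use finN[of S] S in auto)
        finally show "card T \<le> card (\<Union>x\<in>T. N x - ?N)" using S(3) by simp
      qed (use less.prems in auto)
      then obtain g where g: "inj_on g (A - S)" "\<forall>x\<in>A - S. g x \<in> N x - ?N" by blast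
      have "inj_on (\<lambda>x. if x \<in> S then f x else g x) A"
      proof (rule inj_onI)
        fix x y assume xy: "x \<in> A" "y \<in> A" "(if x \<in> S then f x else g x) = (if y \<in> S then f y else g y)"
        show "x = y"
        proof (cases "x \<in> S"; cases "y \<in> S")
          assume "x \<in> S" "y \<notin> S"
          then have "f x \<in> ?N" "g y \<notin> ?N" using f g xy by auto
          with xy \<open>x \<in> S\<close> \<open>y \<notin> S\<close> show ?thesis by simp
        next
          assume "x \<notin> S" "y \<in> S"
          then have "f y \<in> ?N" "g x \<notin> ?N" using f(2) g(2) xy(1) by blast+
          with xy \<open>x \<notin> S\<close> \<open>y \<in> S\<close> show ?thesis by simp
        qed (use xy f(1) g(1) in \<open>auto dest: inj_onD\<close>)
      qed
      moreover have "\<forall>x\<in>A. (if x \<in> S then f x else g x) \<in> N x" using f g by auto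
      ultimately show ?thesis by blast
    qed
  qed
qed

section \<open>Invariants lie in the ring of Specht polynomials\<close>

lemma carrier_specht_ring: "carrier specht_ring = subst_poly Y ` carrier (poly_ring {1..14})"
  by (simp add: specht_ring_def ring_on_def)

lemma Const_in_poly_ring: "Const c \<in> carrier (poly_ring V)"
  by (simp add: poly_ring_def ring_on_def Const_def)

lemma Var_in_poly_ring: "k \<in> V \<Longrightarrow> Var k \<in> carrier (poly_ring V)"
  by (simp add: poly_ring_def ring_on_def Var_def)

lemma specht_ring_Const: "Const c \<in> carrier specht_ring"
  unfolding carrier_specht_ring using Const_in_poly_ring subst_poly_Const by (metis image_eqI)

lemma specht_ring_Y: "k \<in> {1..14} \<Longrightarrow> Y k \<in> carrier specht_ring"
  unfolding carrier_specht_ring using Var_in_poly_ring subst_poly_Var by (metis image_eqI)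

lemma specht_ring_add: "p \<in> carrier specht_ring \<Longrightarrow> q \<in> carrier specht_ring \<Longrightarrow> p + q \<in> carrier specht_ring"
  unfolding carrier_specht_ring by (elim imageE) (simp add: subst_poly_add[symmetric] poly_ring_closed)

lemma specht_ring_mult: "p \<in> carrier specht_ring \<Longrightarrow> q \<in> carrier specht_ring \<Longrightarrow> p * q \<in> carrier specht_ring"
  unfolding carrier_specht_ring by (elim imageE) (simp add: subst_poly_mult[symmetric] poly_ring_closed)

lemma specht_ring_0: "0 \<in> carrier specht_ring"
  using specht_ring_Const[of 0] by simp

lemma specht_ring_1: "1 \<in> carrier specht_ring"
  using specht_ring_Const[of 1] by simp

lemma specht_ring_uminus: "p \<in> carrier specht_ring \<Longrightarrow> - p \<in> carrier specht_ring"
  using specht_ring_mult[OF specht_ring_Const[of "- 1"], of p] by (simp add: Const_uminus)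

lemma specht_ring_diff: "p \<in> carrier specht_ring \<Longrightarrow> q \<in> carrier specht_ring \<Longrightarrow> p - q \<in> carrier specht_ring"
  using specht_ring_add[of p "- q"] specht_ring_uminus[of q] by simp

lemma specht_ring_sum: "(\<And>a. a \<in> A \<Longrightarrow> g a \<in> carrier specht_ring) \<Longrightarrow> sum g A \<in> carrier specht_ring"
  by (induction A rule: infinite_finite_induct) (auto intro: specht_ring_add specht_ring_0)

lemma specht_ring_prod: "(\<And>a. a \<in> A \<Longrightarrow> g a \<in> carrier specht_ring) \<Longrightarrow> prod g A \<in> carrier specht_ring"
  by (induction A rule: infinite_finite_induct) (auto intro: specht_ring_mult specht_ring_1)

lemma specht_ring_power: "p \<in> carrier specht_ring \<Longrightarrow> p ^ n \<in> carrier specht_ring"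
  by (induction n) (auto intro: specht_ring_mult specht_ring_1)

lemma linear_forms_specht_ring: "p \<in> linear_forms \<Longrightarrow> p \<in> carrier specht_ring"
  unfolding linear_forms_def
  by (auto intro!: specht_ring_sum specht_ring_mult specht_ring_Const specht_ring_Y)

lemma edge_deg_count: "edge_deg es v = count (mset (map fst es @ map snd es)) v"
  by (induction es) auto

lemma edge_deg_mset: "mset es = mset es' \<Longrightarrow> edge_deg es v = edge_deg es' v"
  unfolding edge_deg_count by simp

lemma edges_mset: "mset es = mset es' \<Longrightarrow> edges es = edges es'"
  using mset_eq_setD[of es es'] by (simp add: edges_def)

lemma length_filter_mono: "(\<And>x. x \<in> set xs \<Longrightarrow> P x \<Longrightarrow> Q x) \<Longrightarrow> length (filter P xs) \<le> length (filter Q xs)"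
  by (induction xs) auto

lemma sum_of_bool_eq: "finite S \<Longrightarrow> (\<Sum>v\<in>S. of_bool (v = i) :: nat) = of_bool (i \<in> S)"
  by (simp add: of_bool_def)

lemma bipartite_degree:
  assumes "\<And>i j. (i, j) \<in> set es \<Longrightarrow> i \<in> {1..4} \<and> j \<in> {5..8}"
  shows "S \<subseteq> {1..4} \<Longrightarrow> (\<Sum>v\<in>S. edge_deg es v) = length (filter (\<lambda>e. fst e \<in> S) es)"
    and "T \<subseteq> {5..8} \<Longrightarrow> (\<Sum>v\<in>T. edge_deg es v) = length (filter (\<lambda>e. snd e \<in> T) es)"
proof -
  assume S: "S \<subseteq> {1..4}"
  then have fin: "finite S" using finite_subset by blast
  show "(\<Sum>v\<in>S. edge_deg es v) = length (filter (\<lambda>e. fst e \<in> S) es)"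
    using assms
  proof (induction es)
    case (Cons e es)
    obtain i j where e: "e = (i, j)" by fastforce
    have "j \<in> {5..8}" using Cons.prems[of i j] by (simp add: e)
    then have "j \<notin> S" using S by auto
    moreover have "(\<Sum>v\<in>S. edge_deg es v) = length (filter (\<lambda>e. fst e \<in> S) es)"
      by (rule Cons.IH) (use Cons.prems in auto)
    ultimately show ?case using fin by (simp add: e sum.distrib sum_of_bool_eq)
  qed simp
next
  assume T: "T \<subseteq> {5..8}"
  then have fin: "finite T" using finite_subset by blast
  show "(\<Sum>v\<in>T. edge_deg es v) = length (filter (\<lambda>e. snd e \<in> T) es)"
    using assms
  proof (induction es)
    case (Cons e es)
    obtain i j where e: "e = (i, j)" by fastforce
    have "i \<in> {1..4}" using Cons.prems[of i j] by (simp add: e)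
    then have "i \<notin> T" using T by auto
    moreover have "(\<Sum>v\<in>T. edge_deg es v) = length (filter (\<lambda>e. snd e \<in> T) es)"
      by (rule Cons.IH) (use Cons.prems in auto)
    ultimately show ?case using fin by (simp add: e sum.distrib sum_of_bool_eq)
  qed simp
qed

lemma perfect_edge_deg: "perfect ms \<Longrightarrow> v \<in> {1..8} \<Longrightarrow> edge_deg ms v = 1"
  unfolding edge_deg_count perfect_def by (simp add: count_mset_set')

text \<open>Hall's condition holds by counting: all edges leaving \<open>S\<close> end in its
  neighbourhood, and all degrees are equal. The resulting perfect matching contributes a linear
  form; the remaining graph is regular of smaller degree.\<close>

lemma bipartite_regular_specht_ring:
  assumes "\<And>i j. (i, j) \<in> set es \<Longrightarrow> i \<in> {1..4} \<and> j \<in> {5..8}" "\<And>v. v \<in> {1..8} \<Longrightarrow> edge_deg es v = e"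
  shows "edge_prod es \<in> carrier specht_ring"
  using assms
proof (induction e arbitrary: es)
  case 0
  have "es = []"
  proof (rule ccontr)
    assume "es \<noteq> []"
    then obtain i j es' where es: "es = (i, j) # es'" by (metis list.exhaust surj_pair)
    then have "i \<in> {1..8}" using "0.prems"(1)[of i j] by auto
    then show False using "0.prems"(2)[of i] by (simp add: es)
  qed
  then show ?case by (simp add: specht_ring_1)
next
  case (Suc e)
  note bip = Suc.prems(1)
  let ?N = "\<lambda>a. {b. (a, b) \<in> set es}"
  have "\<exists>f. inj_on f {1..4} \<and> (\<forall>a\<in>{1..4}. f a \<in> ?N a)"
  proof (rule hall)
    show "finite (?N a)" for a
      by (rule finite_subset[of _ "snd ` set es"]) force+
    fix S :: "nat set" assume S: "S \<subseteq> {1..4}"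
    let ?T = "\<Union>(?N ` S)"
    have T: "?T \<subseteq> {5..8}" using bip by blast
    have "Suc e * card S = (\<Sum>v\<in>S. edge_deg es v)"
    proof -
      have "(\<Sum>v\<in>S. edge_deg es v) = (\<Sum>v\<in>S. Suc e)"
        using S by (intro sum.cong Suc.prems(2)) auto
      then show ?thesis by simp
    qed
    also have "\<dots> = length (filter (\<lambda>e. fst e \<in> S) es)" by (rule bipartite_degree(1)[OF bip S])
    also have "\<dots> \<le> length (filter (\<lambda>e. snd e \<in> ?T) es)" by (intro length_filter_mono) force
    also have "\<dots> = (\<Sum>v\<in>?T. edge_deg es v)" by (rule bipartite_degree(2)[OF bip T, symmetric])
    also have "\<dots> = (\<Sum>v\<in>?T. Suc e)"
    proof (rule sum.cong)
      fix v assume "v \<in> ?T"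
      then have "v \<in> {5..8}" using T by blast
      then show "edge_deg es v = Suc e" by (intro Suc.prems(2)) auto
    qed simp
    finally show "card S \<le> card ?T" by (simp only: sum_constant mult.commute[of _ "Suc e"] of_nat_id Suc_mult_le_cancel1)
  qed simp
  then obtain f where f: "inj_on f {1..4}" "\<And>a. a \<in> {1..4} \<Longrightarrow> (a, f a) \<in> set es" by blast
  define ms where "ms = map (\<lambda>a. (a, f a)) [1..<5]"
  have set14: "{1..<5} = {1..4::nat}" by auto
  \<comment> \<open>\<open>es\<close> may repeat edges; the matching uses each of its edges once and
    so is a sub-multiset.\<close>
  have "set ms \<subseteq> set es" using f(2) by (auto simp: ms_def)
  then have "mset_set (set ms) \<subseteq># mset_set (set es)" by (simp add: subset_imp_msubset_mset_set)
  moreover have "mset_set (set es) \<subseteq># mset es"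
    using mset_set_set_mset_msubset[of "mset es"] by simp
  moreover have "distinct ms" by (simp add: ms_def distinct_map inj_on_def)
  then have "mset_set (set ms) = mset ms" by (rule mset_set_set)
  ultimately have sub: "mset ms \<subseteq># mset es" by simp
  obtain r where "mset r = mset es - mset ms" using ex_mset by blast
  with sub have r: "mset es = mset (ms @ r)" by simp
  have "f ` {1..4} = {5..8}"
  proof (rule card_subset_eq)
    show "f ` {1..4} \<subseteq> {5..8}" using f(2) bip by blast
    show "card (f ` {1..4}) = card {5..8::nat}" using f(1) by (simp add: card_image)
  qed simp
  then have "image_mset f (mset_set {1..4}) = mset_set {5..8}"
    using image_mset_mset_set[OF f(1)] by simp
  then have "mset (map f [1..<5]) = mset_set {5..8}"
    by (simp only: mset_map mset_upt set14)
  moreover have "mset_set {1..<5} + mset_set {5..8} = mset_set ({1..<5} \<union> {5..8::nat})"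
    by (rule mset_set_Union[symmetric]) auto
  moreover have "{1..<5} \<union> {5..8} = {1..<9::nat}" by auto
  ultimately have "perfect ms"
    unfolding perfect_def ms_def by (simp add: comp_def)
  then have "edge_prod ms \<in> carrier specht_ring"
    by (intro linear_forms_specht_ring perfect_edge_prod)
  moreover have "edge_prod r \<in> carrier specht_ring"
  proof (rule Suc.IH)
    show "i \<in> {1..4} \<and> j \<in> {5..8}" if "(i, j) \<in> set r" for i j
      using bip[of i j] that mset_eq_setD[OF r] by simp
    show "edge_deg r v = e" if "v \<in> {1..8}" for v
      using Suc.prems(2)[OF that] edge_deg_mset[OF r, of v] perfect_edge_deg[OF \<open>perfect ms\<close> that] by simp
  qed
  ultimately show ?case
    unfolding edge_prod_mset[OF r] edge_prod_simps by (rule specht_ring_mult)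
qed

definition inner :: "(nat \<times> nat) list \<Rightarrow> nat" where
  "inner es = length (filter (\<lambda>(i, j). i \<le> 4 \<and> j \<le> 4) es)"

text \<open>Mixed edges count once in the degree sum of either half, edges inside a half twice. In a
  regular graph the two halves therefore contain equally many inner edges.\<close>

lemma inner_balance:
  assumes "edges es"
  shows "(\<Sum>v\<in>{1..4}. edge_deg es v) + 2 * length (filter (\<lambda>(i, j). 4 < i \<and> 4 < j) es) =
    (\<Sum>v\<in>{5..8}. edge_deg es v) + 2 * inner es"
  using assms
proof (induction es)
  case (Cons e es)
  obtain i j where e: "e = (i, j)" by fastforce
  show ?case using Cons
    by (cases "i \<le> 4"; cases "j \<le> 4") (simp_all add: e inner_def sum.distrib sum_of_bool_eq)
qed (simp add: inner_def)

text \<open>Kempe's argument: the Pluecker relation applied to an edge inside \<open>{1..4}\<close> and one inside \<open>{5..8}\<close>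
  reduces to bipartite graphs, which split into perfect matchings.\<close>

lemma regular_specht_ring:
  assumes "edges es" "\<And>v. v \<in> {1..8} \<Longrightarrow> edge_deg es v = e"
  shows "edge_prod es \<in> carrier specht_ring"
  using assms
proof (induction "inner es" arbitrary: es rule: less_induct)
  case less
  have "(\<Sum>v\<in>{1..4}. edge_deg es v) = (\<Sum>v\<in>{1..4::nat}. e)" "(\<Sum>v\<in>{5..8}. edge_deg es v) = (\<Sum>v\<in>{5..8::nat}. e)"
    by (intro sum.cong less.prems(2); auto)+
  then have outer: "length (filter (\<lambda>(i, j). 4 < i \<and> 4 < j) es) = inner es"
    using inner_balance[OF less.prems(1)] by simp
  show ?case
  proof (cases "inner es = 0")
    case True
    then have "filter (\<lambda>(i, j). i \<le> 4 \<and> j \<le> 4) es = []" "filter (\<lambda>(i, j). 4 < i \<and> 4 < j) es = []"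
      using outer by (simp_all add: inner_def)
    then have "(i \<in> {1..4} \<and> j \<in> {5..8}) \<or> (j \<in> {1..4} \<and> i \<in> {5..8})" if "(i, j) \<in> set es" for i j
      using less.prems(1) that unfolding filter_empty_conv edges_def by force
    from orient_edges[of es "\<lambda>i j. i \<in> {1..4} \<and> j \<in> {5..8}", OF this]
    obtain es' where es': "\<forall>(i, j)\<in>set es'. i \<in> {1..4} \<and> j \<in> {5..8}"
      "edge_prod es = edge_prod es' \<or> edge_prod es = - edge_prod es'" "\<forall>v. edge_deg es' v = edge_deg es v" by blast
    have "edge_prod es' \<in> carrier specht_ring"
      by (rule bipartite_regular_specht_ring[where e = e]) (use es'(1,3) less.prems(2) in auto)
    then show ?thesis using es'(2) specht_ring_uminus by auto
  next
    case False
    then have "filter (\<lambda>(i, j). i \<le> 4 \<and> j \<le> 4) es \<noteq> []" "filter (\<lambda>(i, j). 4 < i \<and> 4 < j) es \<noteq> []"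
      using outer by (auto simp: inner_def)
    then obtain w x y z where wx: "(w, x) \<in> set es" "w \<le> 4" "x \<le> 4" and yz: "(y, z) \<in> set es" "4 < y" "4 < z"
      unfolding filter_empty_conv by auto
    then obtain r where r: "mset es = mset ((w, x) # (y, z) # r)"
      using mset_Cons2[of "(w, x)" es "(y, z)"] by auto
    have edges: "edges ((w, x) # (y, z) # r)" using less.prems(1) edges_mset[OF r] by simp
    have deg: "edge_deg ((w, x) # (y, z) # r) v = e" if "v \<in> {1..8}" for v
      using less.prems(2)[OF that] edge_deg_mset[OF r] by simp
    have "inner es = inner ((w, x) # (y, z) # r)"
      unfolding inner_def using arg_cong[OF r, of "\<lambda>M. size (filter_mset (\<lambda>(i, j). i \<le> 4 \<and> j \<le> 4) M)"]
      by (simp only: size_mset flip: mset_filter)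
    then have inner: "inner es = Suc (inner r)" using wx yz by (simp add: inner_def)
    \<comment> \<open>The new edges all run between the two halves, so \<open>inner\<close> drops by
      one.\<close>
    have "edge_prod ((w, y) # (x, z) # r) \<in> carrier specht_ring"
    proof (rule less.hyps)
      show "edge_deg ((w, y) # (x, z) # r) v = e" if "v \<in> {1..8}" for v
        using deg[OF that] by simp
    qed (use inner wx yz edges in \<open>auto simp: inner_def\<close>)
    moreover have "edge_prod ((w, z) # (x, y) # r) \<in> carrier specht_ring"
    proof (rule less.hyps)
      show "edge_deg ((w, z) # (x, y) # r) v = e" if "v \<in> {1..8}" for v
        using deg[OF that] by simp
    qed (use inner wx yz edges in \<open>auto simp: inner_def\<close>)
    moreover have "edge_prod es = edge_prod ((w, y) # (x, z) # r) - edge_prod ((w, z) # (x, y) # r)"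
      unfolding edge_prod_mset[OF r] by (simp add: algebra_simps)
    ultimately show ?thesis by (simp add: specht_ring_diff)
  qed
qed

lemma invariant_specht_ring:
  assumes "invariant e p"
  shows "p \<in> carrier specht_ring"
proof -
  let ?d = "\<lambda>i. if i \<in> {1..8::nat} then e else 0"
  have "(\<Sum>i\<in>{1..8}. ?d i) = (\<Sum>i\<in>{1..8::nat}. e)" by (intro sum.cong) auto
  then have "2 * (4 * e) = (\<Sum>i\<in>{1..8}. ?d i)" by simp
  then have "covariant ?d p"
    using assms unfolding covariant_def invariant_def by blast
  then have "bracket_span ?d p" by (rule covariant_imp_bracket_span) (simp only: if_False)
  then show ?thesis
  proof induction
    case (add es p c)
    have "edge_prod es \<in> carrier specht_ring"
      by (rule regular_specht_ring[where e = e]) (use add.hyps in auto)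
    then show ?case using add.IH by (intro specht_ring_add specht_ring_mult specht_ring_Const)
  qed (rule specht_ring_0)
qed

section \<open>Ideals of the ring of Specht polynomials\<close>

lemma specht_ring_ops:
  "zero specht_ring = 0" "one specht_ring = 1" "add specht_ring p q = p + q" "mult specht_ring p q = p * q"
  by (simp_all add: specht_ring_def ring_on_def)

lemma specht_ring_idealI:
  assumes "I \<subseteq> carrier specht_ring" "0 \<in> I"
    and add: "\<And>p q. p \<in> I \<Longrightarrow> q \<in> I \<Longrightarrow> p + q \<in> I"
    and mult: "\<And>p q. p \<in> I \<Longrightarrow> q \<in> carrier specht_ring \<Longrightarrow> q * p \<in> I"
  shows "ideal I specht_ring"
proof -
  interpret cring specht_ring by (rule cring_specht_ring)
  show ?thesis
  proof (rule idealI[OF ring_axioms])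
    show "subgroup I (add_monoid specht_ring)"
    proof
      fix p assume p: "p \<in> I"
      have "- p = Const (- 1) * p" by (simp add: Const_uminus)
      then have "- p \<in> I" using mult[OF p specht_ring_Const] by metis
      moreover have "\<ominus>\<^bsub>specht_ring\<^esub> p = - p"
        by (rule minus_equality) (use p assms(1) in \<open>auto simp: specht_ring_ops intro: specht_ring_uminus\<close>)
      ultimately show "inv\<^bsub>add_monoid specht_ring\<^esub> p \<in> I"
        by (simp add: a_inv_def)
    qed (use assms in \<open>auto simp: specht_ring_ops\<close>)
  qed (use mult in \<open>auto simp: specht_ring_ops mult.commute\<close>)
qed

lemma specht_ring_idealD:
  assumes "ideal I specht_ring"
  shows "p \<in> I \<Longrightarrow> p \<in> carrier specht_ring" "0 \<in> I" "p \<in> I \<Longrightarrow> q \<in> I \<Longrightarrow> p + q \<in> I"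
    "p \<in> I \<Longrightarrow> q \<in> carrier specht_ring \<Longrightarrow> q * p \<in> I"
proof -
  interpret ideal I specht_ring by fact
  show "p \<in> I \<Longrightarrow> p \<in> carrier specht_ring" by (rule a_Hcarr)
  show "0 \<in> I" using additive_subgroup.zero_closed[OF is_additive_subgroup] by (simp add: specht_ring_ops)
  show "p \<in> I \<Longrightarrow> q \<in> I \<Longrightarrow> p + q \<in> I" using additive_subgroup.a_closed[OF is_additive_subgroup, of p q] by (simp add: specht_ring_ops)
  show "p \<in> I \<Longrightarrow> q \<in> carrier specht_ring \<Longrightarrow> q * p \<in> I" using I_l_closed[of p q] by (simp add: specht_ring_ops)
qed

lemma specht_ring_ideal_sum:
  assumes "ideal I specht_ring" "\<And>a. a \<in> A \<Longrightarrow> g a \<in> I"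
  shows "sum g A \<in> I"
  using assms(2) by (induction A rule: infinite_finite_induct) (auto simp: specht_ring_idealD[OF assms(1)])

lemma Idl_specht_ring:
  assumes "L \<subseteq> carrier specht_ring"
  shows "ideal (Idl\<^bsub>specht_ring\<^esub> L) specht_ring" "L \<subseteq> Idl\<^bsub>specht_ring\<^esub> L"
    "ideal I specht_ring \<Longrightarrow> L \<subseteq> I \<Longrightarrow> Idl\<^bsub>specht_ring\<^esub> L \<subseteq> I"
proof -
  interpret cring specht_ring by (rule cring_specht_ring)
  show "ideal (Idl\<^bsub>specht_ring\<^esub> L) specht_ring" "L \<subseteq> Idl\<^bsub>specht_ring\<^esub> L"
    "ideal I specht_ring \<Longrightarrow> L \<subseteq> I \<Longrightarrow> Idl\<^bsub>specht_ring\<^esub> L \<subseteq> I"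
    by (rule genideal_ideal genideal_self genideal_minimal; use assms in simp)+
qed

lemma specht_ring_monom:
  assumes "\<And>k. k \<in> Poly_Mapping.keys m \<Longrightarrow> g k \<in> carrier specht_ring"
  shows "monom_eval g m \<in> carrier specht_ring"
  unfolding monom_eval_def using assms by (intro specht_ring_prod specht_ring_power)

lemma specht_ring_repr:
  assumes "f \<in> carrier specht_ring"
  obtains q where "f = (\<Sum>m\<in>Poly_Mapping.keys q. Const (Poly_Mapping.lookup q m) * monom_eval Y m)"
    "\<And>m. m \<in> Poly_Mapping.keys q \<Longrightarrow> Poly_Mapping.keys m \<subseteq> {1..14}"
proof -
  from assms obtain q where q: "f = subst_poly Y q" "q \<in> carrier (poly_ring {1..14})"
    unfolding carrier_specht_ring by blast
  show thesis
    by (rule that[of q]) (use q in \<open>auto simp: subst_poly_def poly_ring_def ring_on_def\<close>)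
qed

section \<open>The grading\<close>

lemma invariant_0: "invariant e 0"
  by (simp add: invariant_def)

lemma invariant_add: "invariant e p \<Longrightarrow> invariant e q \<Longrightarrow> invariant e (p + q)"
  unfolding invariant_def EE_add by (simp only: homog_add dle_add add_0_left simp_thms)

lemma invariant_sum: "(\<And>a. a \<in> A \<Longrightarrow> invariant e (g a)) \<Longrightarrow> invariant e (sum g A)"
  by (induction A rule: infinite_finite_induct) (auto intro: invariant_0 invariant_add)

lemma invariant_mult:
  assumes "invariant a p" "invariant b q"
  shows "invariant (a + b) (p * q)"
  unfolding invariant_def
proof (intro conjI allI)
  show "EE (p * q) = 0" using assms by (simp add: invariant_def EE_mult)
  show "homog (4 * (a + b)) (p * q)"
    unfolding distrib_left using assms by (intro homog_mult) (simp_all add: invariant_def)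
  fix i
  have "dle i p (if i \<in> {1..8} then a else 0)" "dle i q (if i \<in> {1..8} then b else 0)"
    using assms unfolding invariant_def by blast+
  then show "dle i (p * q) (if i \<in> {1..8} then a + b else 0)" by (rule dle_mult_le) simp
qed

lemma invariant_Const: "invariant 0 (Const c)"
  by (simp add: invariant_def homog_Const)

lemma invariant_power:
  assumes "invariant a p"
  shows "invariant (n * a) (p ^ n)"
proof (induction n)
  case 0
  then show ?case using invariant_Const[of 1] by simp
next
  case (Suc n)
  show ?case using invariant_mult[OF assms Suc.IH] by simp
qed

lemma invariant_prod:
  assumes "\<And>i. i \<in> A \<Longrightarrow> invariant (k i) (g i)"
  shows "invariant (sum k A) (prod g A)"
  using assms
proof (induction A rule: infinite_finite_induct)
  case (insert i A)
  then show ?case by (simp add: invariant_mult)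
qed (use invariant_Const[of 1] in simp_all)

lemma perfect_edges:
  assumes "perfect es"
  shows "edges es"
  unfolding edges_def
proof clarify
  fix i j assume ij: "(i, j) \<in> set es"
  obtain us vs where es: "es = us @ (i, j) # vs" using split_list[OF ij] by blast
  have ms: "mset (map fst es @ map snd es) = mset [1..<9]" using assms unfolding perfect_def .
  have "set (map fst es @ map snd es) = set [1..<9]" using arg_cong[OF ms, of set_mset] by (simp only: set_mset_mset)
  moreover have "i \<in> set (map fst es @ map snd es)" "j \<in> set (map fst es @ map snd es)"
    unfolding es by simp_all
  ultimately have "i \<in> set [1..<9]" "j \<in> set [1..<9]" by simp_all
  moreover have "distinct (map fst es @ map snd es)"
    using mset_eq_imp_distinct_iff[OF ms] distinct_upt by blast
  then have "i \<noteq> j" unfolding es by simp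
  ultimately show "i \<in> {1..8} \<and> j \<in> {1..8} \<and> i \<noteq> j" by auto
qed

text \<open>The columns of the tableau are the edges; that the entries are 1 to 8 is
  evaluated.\<close>

lemma Y_perfect:
  assumes "k \<in> {1..14}"
  shows "\<exists>es. perfect es \<and> Y k = edge_prod es"
proof -
  have "list_all (\<lambda>(is, js). length is = 4 \<and> length js = 4 \<and> sort (is @ js) = [1..<9]) standard_tableaux"
    by code_simp
  moreover have len: "length standard_tableaux = 14" by code_simp
  moreover have "k - 1 < 14" using assms by auto
  ultimately have *: "case standard_tableaux ! (k - 1) of (is, js) \<Rightarrow> length is = 4 \<and> length js = 4 \<and> sort (is @ js) = [1..<9]"
    unfolding list_all_length len by (elim allE[where x = "k - 1"] impE)
  obtain "is" js where t: "standard_tableaux ! (k - 1) = (is, js)" by fastforce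
  have l: "length is = 4" "length js = 4" "sort (is @ js) = [1..<9]" using * unfolding t by auto
  have maps: "map fst (zip is js) = is" "map snd (zip is js) = js" using l by simp_all
  have "perfect (zip is js)"
    unfolding perfect_def maps using mset_sort[of "\<lambda>x. x" "is @ js"] unfolding l(3) by simp
  moreover have "Y k = edge_prod (zip is js)"
    using specht_edge_prod[of "zip is js"] l unfolding maps Y_def t by simp
  ultimately show ?thesis by blast
qed

lemma invariant_Y:
  assumes "k \<in> {1..14}"
  shows "invariant 1 (Y k)"
proof -
  obtain es where es: "perfect es" "Y k = edge_prod es" using Y_perfect[OF assms] by blast
  note e = perfect_edges[OF es(1)]
  have "dle i (edge_prod es) (if i \<in> {1..8} then 1 else 0)" for i
    using dle_edge_prod[of i es] perfect_edge_deg[OF es(1), of i] edge_deg_outside[OF e, of i] by (cases "i \<in> {1..8}") auto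
  then show ?thesis
    unfolding invariant_def es(2) using EE_edge_prod[OF e] homog_edge_prod[OF e] perfect_length[OF es(1)] by simp
qed

text \<open>A monomial in the \<open>Y k\<close> is an invariant whose degree is its number of
  factors; grouping by this degree splits every element. \<open>invariant_rep\<close> applies to one
  degree at a time.\<close>

lemma invariant_decomposition:
  assumes "f \<in> carrier specht_ring"
  obtains J F where "finite J" "f = (\<Sum>d\<in>J. F d)" "\<And>d. invariant d (F d)"
proof -
  obtain q where q: "f = (\<Sum>m\<in>Poly_Mapping.keys q. Const (Poly_Mapping.lookup q m) * monom_eval Y m)"
    "\<And>m. m \<in> Poly_Mapping.keys q \<Longrightarrow> Poly_Mapping.keys m \<subseteq> {1..14}"
    using specht_ring_repr[OF assms] by blast
  let ?t = "\<lambda>m. Const (Poly_Mapping.lookup q m) * monom_eval Y m"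
  define deg where "deg m = (\<Sum>k\<in>Poly_Mapping.keys m. Poly_Mapping.lookup m k * 1)" for m :: "nat \<Rightarrow>\<^sub>0 nat"
  have inv: "invariant (deg m) (?t m)" if m: "m \<in> Poly_Mapping.keys q" for m
  proof -
    have "invariant (deg m) (monom_eval Y m)"
      unfolding monom_eval_def deg_def using q(2)[OF m]
      by (intro invariant_prod invariant_power invariant_Y) auto
    from invariant_mult[OF invariant_Const this] show ?thesis by simp
  qed
  show thesis
  proof
    show "finite (deg ` Poly_Mapping.keys q)" by simp
    show "f = (\<Sum>d\<in>deg ` Poly_Mapping.keys q. \<Sum>m\<in>{m\<in>Poly_Mapping.keys q. deg m = d}. ?t m)"
      unfolding q(1) by (rule sum.image_gen) simp
    show "invariant d (\<Sum>m\<in>{m\<in>Poly_Mapping.keys q. deg m = d}. ?t m)" for d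
      by (rule invariant_sum) (use inv in auto)
  qed
qed

section \<open>Merging variables\<close>

text \<open>\<open>Var 0\<close> serves as a fresh variable.\<close>

definition merge :: "nat set \<Rightarrow> nat \<Rightarrow> mpoly" where
  "merge T i = (if i \<in> T then Var 0 else Var i)"

definition merge_ideal :: "nat set \<Rightarrow> mpoly set" where
  "merge_ideal T = {f \<in> carrier specht_ring. subst_poly (merge T) f = 0}"

definition triples :: "nat set set" where
  "triples = {T. T \<subseteq> {1..8} \<and> card T = 3}"

lemma ideal_merge_ideal: "ideal (merge_ideal T) specht_ring"
  by (rule specht_ring_idealI)
    (auto simp: merge_ideal_def subst_poly_hom intro: specht_ring_add specht_ring_mult specht_ring_0)

text \<open>Merging replaces variables by one of equal weight, so the images of components of
  different degrees remain homogeneous of different degrees and cannot cancel.\<close>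

lemma merge_ideal_component:
  assumes "T \<subseteq> {1..8}" "finite J" "\<And>d. invariant d (F d)" "subst_poly (merge T) (\<Sum>d\<in>J. F d) = 0" "d \<in> J"
  shows "subst_poly (merge T) (F d) = 0"
proof -
  have homog: "homog (4 * k) (subst_poly (merge T) (F k))" for k
  proof (rule homog_subst_Var)
    show "\<exists>j. merge T i = Var j \<and> (i \<le> 8 \<longleftrightarrow> j \<le> 8)" for i
      using assms(1) by (cases "i \<in> T") (auto simp: merge_def Var_inject)
    show "homog (4 * k) (F k)" using assms(3)[of k] unfolding invariant_def by blast
  qed
  have hc: "hc (4 * d) (subst_poly (merge T) (F k)) = (if k = d then subst_poly (merge T) (F k) else 0)" for k
    by (simp add: hc_homog[OF homog])
  have "(\<Sum>k\<in>J. subst_poly (merge T) (F k)) = 0" using assms(4) unfolding subst_poly_sum .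
  then have "hc (4 * d) (\<Sum>k\<in>J. subst_poly (merge T) (F k)) = 0" by simp
  then show ?thesis unfolding hc_sum hc using assms(2,5) by simp
qed

lemma D_specht_ring:
  assumes "S \<in> quads"
  shows "D S \<in> carrier specht_ring"
proof -
  obtain k es where "D S = Const k * edge_prod es" "edges es" "\<forall>v\<in>{1..8}. edge_deg es v = 3"
    using D_edge_prod[OF assms] by blast
  then show ?thesis using regular_specht_ring[of es 3] by (auto intro: specht_ring_mult specht_ring_Const)
qed

lemma D_merge_ideal:
  assumes "S \<in> quads" "T \<in> triples"
  shows "D S \<in> merge_ideal T"
proof -
  obtain a b c where T: "T = {a, b, c}" "a \<noteq> b" "b \<noteq> c" "a \<noteq> c" and sub: "{a, b, c} \<subseteq> {1..8}"
    using assms(2) unfolding triples_def by (auto simp: card_3_iff)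
  have in8: "a \<in> {1..8}" "b \<in> {1..8}" "c \<in> {1..8}" using sub by blast+
  have "merge T a = Var 0" "merge T b = Var 0" "merge T c = Var 0" by (simp_all add: merge_def T(1))
  moreover have "(a \<in> S \<longleftrightarrow> b \<in> S) \<or> (b \<in> S \<longleftrightarrow> c \<in> S) \<or> (a \<in> S \<longleftrightarrow> c \<in> S)" by blast
  ultimately have "subst_poly (merge T) (D S) = 0"
    using D_vanish[OF assms(1) in8(1,2) T(2), of "merge T"] D_vanish[OF assms(1) in8(2,3) T(3), of "merge T"]
      D_vanish[OF assms(1) in8(1,3) T(4), of "merge T"] by presburger
  then show ?thesis by (simp add: merge_ideal_def D_specht_ring[OF assms(1)])
qed

lemma D_ideal_eq_Inter: "Idl\<^bsub>specht_ring\<^esub> (D ` quads) = (\<Inter>T\<in>triples. merge_ideal T)" (is "?I = ?R")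
proof
  have sub: "D ` quads \<subseteq> carrier specht_ring" using D_specht_ring by blast
  note Idl = Idl_specht_ring[OF sub]
  show "?I \<subseteq> ?R"
    by (intro INT_greatest Idl(3) ideal_merge_ideal) (use D_merge_ideal in blast)
  show "?R \<subseteq> ?I"
  proof
    fix f assume f: "f \<in> ?R"
    have "{1, 2, 3} \<in> triples" by (simp add: triples_def)
    then have "f \<in> carrier specht_ring" using f unfolding merge_ideal_def by blast
    from invariant_decomposition[OF this] obtain J F where
      F: "finite J" "f = (\<Sum>d\<in>J. F d)" "\<And>d. invariant d (F d)" by metis
    have "F d \<in> ?I" if d: "d \<in> J" for d
    proof -
      have dle0: "dle 0 (F d) 0"
        using F(3)[of d] unfolding invariant_def by (metis atLeastAtMost_iff not_one_le_zero)
      have "subst_poly (Var(a := Var c, b := Var c)) (F d) = 0"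
        if abc: "{a, b, c} \<subseteq> {1..8}" "distinct [a, b, c]" for a b c
      proof -
        have "{a, b, c} \<in> triples" using abc by (simp add: triples_def)
        then have "subst_poly (merge {a, b, c}) f = 0" using f unfolding merge_ideal_def by blast
        then have "subst_poly (merge {a, b, c}) (F d) = 0"
          by (intro merge_ideal_component[where J = J and F = F] abc(1) F(1,3) d) (simp only: F(2))
        \<comment> \<open>Renaming the fresh variable to \<open>X\<^sub>c\<close> translates the
          symmetric form of coincidence into the one used for division; \<open>F d\<close> itself is
          free of \<open>X\<^sub>0\<close>.\<close>
        then have "subst_poly (Var(0 := Var c)) (subst_poly (merge {a, b, c}) (F d)) = 0" by simp
        moreover have "subst_poly (Var(0 := Var c)) (subst_poly (merge {a, b, c}) (F d))
            = subst_poly (Var(a := Var c, b := Var c)) (F d)"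
          unfolding subst_poly_subst
        proof (rule subst_poly_cong)
          fix i assume "subst_poly (Var(0 := Var c)) (merge {a, b, c} i) \<noteq> (Var(a := Var c, b := Var c)) i"
          then have "i = 0" by (auto simp: merge_def split: if_splits)
          then show "dle i (F d) 0" using dle0 by simp
        qed
        ultimately show ?thesis by simp
      qed
      from invariant_rep[OF F(3) this] obtain e g where
        g: "F d = (\<Sum>S\<in>quads. D S * g S)" "\<forall>S. invariant e (g S)" by blast
      show ?thesis unfolding g(1)
      proof (rule specht_ring_ideal_sum[OF Idl(1)])
        fix S assume "S \<in> quads"
        then have "g S * D S \<in> ?I"
          using g(2) Idl(2) by (intro specht_ring_idealD(4)[OF Idl(1)] invariant_specht_ring) blast+
        then show "D S * g S \<in> ?I" by (simp add: mult.commute)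
      qed
    qed
    then show "f \<in> ?I" unfolding F(2) by (rule specht_ring_ideal_sum[OF Idl(1)])
  qed
qed

section \<open>The prime of a triple is generated by linear forms\<close>

text \<open>One variable at a time: as the field is infinite, there are more constants than the
  degree, and all of them are roots.\<close>

lemma eval_zero_imp_zero:
  assumes "finite V" "\<And>i. i \<notin> V \<Longrightarrow> dle i p 0" "\<And>\<beta>. subst_poly (\<lambda>i. Const (\<beta> i)) p = 0"
  shows "p = 0"
  using assms
proof (induction V arbitrary: p rule: finite_induct)
  case empty
  then obtain c where c: "p = Const c" using dle_0_imp_Const[of p] by blast
  show ?case using empty.prems(2) unfolding c by simp
next
  case (insert v V)
  have zero: "subst_poly (Var(v := Const z)) p = 0" for z
  proof (rule insert.IH)
    show "dle i (subst_poly (Var(v := Const z)) p) 0" if "i \<notin> V" for i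
      using that dle_subst_Const[OF insert.prems(1), of i v z] dle_subst_Const_same[of v z p] by (cases "i = v") auto
    show "subst_poly (\<lambda>i. Const (\<beta> i)) (subst_poly (Var(v := Const z)) p) = 0" for \<beta>
    proof -
      have "(\<lambda>i. subst_poly (\<lambda>i. Const (\<beta> i)) ((Var(v := Const z)) i)) = (\<lambda>i. Const ((\<beta>(v := z)) i))"
        by auto
      then show ?thesis unfolding subst_poly_subst using insert.prems(2)[of "\<beta>(v := z)"] by simp
    qed
  qed
  have "\<forall>i. \<exists>n. dle i p n" using dle_exists by blast
  then obtain k where k: "\<And>i. dle i p (k i)" by metis
  let ?Q = "(\<lambda>n. C n) ` {..k v}"
  have "inj (\<lambda>n. C n)" by (auto intro: injI)
  then have card: "card ?Q = Suc (k v)" by (simp add: card_image inj_on_subset[OF _ subset_UNIV])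
  have "\<exists>h. p = (\<Prod>q\<in>?Q. Var v - q) * h \<and> (k v < card ?Q \<longrightarrow> h = 0) \<and>
    (\<forall>i. dle i h (k i - (if i = v then card ?Q else card {q\<in>?Q. \<not> dle i q 0})))"
    by (rule linear_roots) (use zero k in auto)
  then show ?case unfolding card by auto
qed

lemma exists_fourth_root: "\<exists>r. r ^ 4 = (w :: complex)"
proof
  have "csqrt (csqrt w) ^ 4 = (csqrt (csqrt w) ^ 2) ^ 2" by (simp only: power_mult[symmetric]) simp
  then show "csqrt (csqrt w) ^ 4 = w" by simp
qed

abbreviation "T0 \<equiv> {5, 6, 8 :: nat}"
text \<open>The tableaux with two of the numbers 5, 6, 8 in one column. In the remaining ones, 1, 4,
  7 and 12, these numbers lie in three different columns.\<close>

abbreviation "N0 \<equiv> {2, 3, 5, 6, 8, 9, 10, 11, 13, 14 :: nat}"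

lemma Y_in_merge_ideal: "k \<in> N0 \<Longrightarrow> Y k \<in> merge_ideal T0"
proof -
  assume k: "k \<in> N0"
  have "subst_poly (merge T0) (Y k) = 0"
    using k by (auto simp: Y_def standard_tableaux_def specht_def merge_def numeral_eq_Suc lessThan_Suc subst_poly_hom)
  then show ?thesis using k by (auto simp: merge_ideal_def intro: specht_ring_Y)
qed

lemma merged_Y:
  "subst_poly (merge T0) (Y 1) = (Var 1 - Var 0) * (Var 2 - Var 0) * (Var 3 - Var 7) * (Var 4 - Var 0)"
  "subst_poly (merge T0) (Y 4) = (Var 1 - Var 4) * (Var 2 - Var 0) * (Var 3 - Var 0) * (Var 7 - Var 0)"
  "subst_poly (merge T0) (Y 7) = (Var 1 - Var 3) * (Var 2 - Var 0) * (Var 4 - Var 0) * (Var 7 - Var 0)"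
  "subst_poly (merge T0) (Y 12) = (Var 1 - Var 2) * (Var 3 - Var 0) * (Var 4 - Var 0) * (Var 7 - Var 0)"
  by (simp_all add: Y_def standard_tableaux_def specht_def merge_def numeral_eq_Suc lessThan_Suc subst_poly_hom mult_ac)

text \<open>At \<open>X\<^sub>5 = X\<^sub>6 = X\<^sub>8 = 0\<close> and \<open>X\<^sub>i = r / u\<^sub>i\<close> the four surviving generators become \<open>r\<^sup>4 / \<Prod>u\<^sub>i\<close>
  times differences of the \<open>u\<^sub>i\<close>; hence they take arbitrary values and are algebraically independent.\<close>

lemma merged_Y_values:
  fixes \<beta> :: "nat \<Rightarrow> complex"
  obtains \<gamma> where "\<And>k. k \<in> {1, 4, 7, 12} \<Longrightarrow>
    subst_poly (\<lambda>i. Const (\<gamma> i)) (subst_poly (merge T0) (Y k)) = Const (\<beta> k)"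
proof -
  obtain s where s: "s \<notin> {0, - \<beta> 12, - \<beta> 7, - \<beta> 4, - (\<beta> 7 + \<beta> 1)}"
    using ex_new_if_finite[OF infinite_UNIV_char_0, of "{0, - \<beta> 12, - \<beta> 7, - \<beta> 4, - (\<beta> 7 + \<beta> 1)}"] by auto
  \<comment> \<open>The four prescribed differences form a tree on the five values and thus fix them
    up to the common shift \<open>s\<close>, which was chosen to keep all of them nonzero.\<close>
  define u1 u2 u3 u4 u7 where u: "u1 = s" "u2 = s + \<beta> 12" "u3 = s + \<beta> 7" "u4 = s + \<beta> 4" "u7 = s + (\<beta> 7 + \<beta> 1)"
  have nz: "u1 \<noteq> 0" "u2 \<noteq> 0" "u3 \<noteq> 0" "u4 \<noteq> 0" "u7 \<noteq> 0"
    using s by (auto simp: u add_eq_0_iff2)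
  \<comment> \<open>This makes the common factor \<open>r\<^sup>4 / \<Prod>u\<^sub>i\<close> equal
    to 1.\<close>
  obtain r where r: "r ^ 4 = u1 * u2 * u3 * u4 * u7" using exists_fourth_root by blast
  have "r * r * r * r = u1 * u2 * u3 * u4 * u7" unfolding r[symmetric] by (simp add: power4_eq_xxxx)
  then have rr: "r * (r * (r * r)) = u1 * (u2 * (u3 * (u4 * u7)))" by (simp add: mult_ac)
  have key: "(r / a) * (r / b) * (r / c - r / d) * (r / e) = d - c"
    if "a \<noteq> 0" "b \<noteq> 0" "c \<noteq> 0" "d \<noteq> 0" "e \<noteq> 0" "a * (b * (c * (d * e))) = u1 * (u2 * (u3 * (u4 * u7)))" for a b c d e
  proof -
    have "(r / a) * (r / b) * (r / c - r / d) * (r / e) = (r * (r * (r * r))) * (d - c) / (a * (b * (c * (d * e))))"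
      using that(1-5) by (simp add: divide_simps algebra_simps)
    also have "\<dots> = d - c" unfolding rr that(6) using nz by simp
    finally show ?thesis .
  qed
  define \<gamma> :: "nat \<Rightarrow> complex" where "\<gamma> = (\<lambda>_. 0)(1 := r / u1, 2 := r / u2, 3 := r / u3, 4 := r / u4, 7 := r / u7)"
  have \<gamma>: "\<gamma> 0 = 0" "\<gamma> 1 = r / u1" "\<gamma> 2 = r / u2" "\<gamma> 3 = r / u3" "\<gamma> 4 = r / u4" "\<gamma> 7 = r / u7"
    by (simp_all add: \<gamma>_def)
  have v1: "\<gamma> 1 * \<gamma> 2 * (\<gamma> 3 - \<gamma> 7) * \<gamma> 4 = \<beta> 1"
    unfolding \<gamma> using key[of u1 u2 u3 u7 u4] nz by (simp add: mult_ac) (simp add: u)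
  have v4: "\<gamma> 2 * \<gamma> 3 * (\<gamma> 1 - \<gamma> 4) * \<gamma> 7 = \<beta> 4"
    unfolding \<gamma> using key[of u2 u3 u1 u4 u7] nz by (simp add: mult_ac) (simp add: u)
  have v7: "\<gamma> 2 * \<gamma> 4 * (\<gamma> 1 - \<gamma> 3) * \<gamma> 7 = \<beta> 7"
    unfolding \<gamma> using key[of u2 u4 u1 u3 u7] nz by (simp add: mult_ac) (simp add: u)
  have v12: "\<gamma> 3 * \<gamma> 4 * (\<gamma> 1 - \<gamma> 2) * \<gamma> 7 = \<beta> 12"
    unfolding \<gamma> using key[of u3 u4 u1 u2 u7] nz by (simp add: mult_ac) (simp add: u)
  show thesis
  proof
    fix k :: nat assume "k \<in> {1, 4, 7, 12}"
    then consider "k = 1" | "k = 4" | "k = 7" | "k = 12" by blast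
    then show "subst_poly (\<lambda>i. Const (\<gamma> i)) (subst_poly (merge T0) (Y k)) = Const (\<beta> k)"
      by cases (simp_all only: merged_Y subst_poly_mult subst_poly_diff subst_poly_Var \<gamma>(1) Const_0 diff_zero
        v1[symmetric] v4[symmetric] v7[symmetric] v12[symmetric] Const_mult Const_diff mult_ac)
  qed
qed

lemma Y_image_subset: "Y ` N0 \<subseteq> carrier specht_ring"
  by (auto intro: specht_ring_Y)

lemma merge_ideal_generated: "merge_ideal T0 = Idl\<^bsub>specht_ring\<^esub> (Y ` N0)" (is "_ = ?I")
proof
  note Idl = Idl_specht_ring[OF Y_image_subset]
  show "?I \<subseteq> merge_ideal T0" by (intro Idl(3) ideal_merge_ideal image_subsetI Y_in_merge_ideal)
  show "merge_ideal T0 \<subseteq> ?I"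
  proof
    fix f assume f: "f \<in> merge_ideal T0"
    then have "f \<in> carrier specht_ring" unfolding merge_ideal_def by blast
    then obtain q where q: "f = (\<Sum>m\<in>Poly_Mapping.keys q. Const (Poly_Mapping.lookup q m) * monom_eval Y m)"
      "\<And>m. m \<in> Poly_Mapping.keys q \<Longrightarrow> Poly_Mapping.keys m \<subseteq> {1..14}"
      using specht_ring_repr by blast
    let ?K = "{1, 4, 7, 12 :: nat}"
    let ?A = "{m \<in> Poly_Mapping.keys q. Poly_Mapping.keys m \<subseteq> ?K}"
    let ?t = "\<lambda>m. Const (Poly_Mapping.lookup q m) * monom_eval Y m"
    \<comment> \<open>The part involving only the four surviving generators; every other monomial
      contains some \<open>Y k\<close> with \<open>k\<close> in \<open>N0\<close>.\<close>
    define q0 :: mpoly where "q0 = (\<Sum>m\<in>?A. Poly_Mapping.single m (Poly_Mapping.lookup q m))"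
    have "f = sum ?t ?A + sum ?t (Poly_Mapping.keys q - ?A)"
      unfolding q(1) by (subst sum.subset_diff[of ?A]) (auto simp: add.commute)
    moreover have "sum ?t ?A = subst_poly Y q0"
      unfolding q0_def subst_poly_sum subst_poly_single ..
    ultimately have f': "f = subst_poly Y q0 + sum ?t (Poly_Mapping.keys q - ?A)" by simp
    have rest: "sum ?t (Poly_Mapping.keys q - ?A) \<in> ?I"
    proof (rule specht_ring_ideal_sum[OF Idl(1)])
      fix m assume m: "m \<in> Poly_Mapping.keys q - ?A"
      then have keys: "Poly_Mapping.keys m \<subseteq> {1..14}" using q(2) by blast
      from m obtain k where k: "k \<in> Poly_Mapping.keys m" "k \<notin> ?K" by blast
      have "k \<in> {1..14}" using k(1) keys by blast
      then have "k \<in> N0" using k(2) by (simp add: atLeastAtMost_iff) presburger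
      then have Yk: "Y k \<in> ?I" using Idl(2) by blast
      obtain n where n: "Poly_Mapping.lookup m k = Suc n" using k(1) by (auto simp: in_keys_iff gr0_conv_Suc)
      let ?r = "\<Prod>i\<in>Poly_Mapping.keys m - {k}. Y i ^ Poly_Mapping.lookup m i"
      have "monom_eval Y m = Y k ^ n * ?r * Y k"
        unfolding monom_eval_def using k(1) by (subst prod.remove[of _ k]) (simp_all add: n mult_ac)
      then have "?t m = (Const (Poly_Mapping.lookup q m) * (Y k ^ n * ?r)) * Y k" by (simp add: mult_ac)
      moreover have "Const (Poly_Mapping.lookup q m) * (Y k ^ n * ?r) \<in> carrier specht_ring"
        using keys k(1) by (intro specht_ring_mult specht_ring_Const specht_ring_prod specht_ring_power specht_ring_Y) auto
      ultimately show "?t m \<in> ?I" using specht_ring_idealD(4)[OF Idl(1) Yk] by (simp only:)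
    qed
    have "sum ?t (Poly_Mapping.keys q - ?A) \<in> merge_ideal T0"
      using rest Idl(3)[OF ideal_merge_ideal image_subsetI[OF Y_in_merge_ideal]] by blast
    then have zero: "subst_poly (merge T0) (subst_poly Y q0) = 0"
      using f unfolding f' merge_ideal_def by (simp add: subst_poly_add)
    have keys_q0: "dle i q0 0" if "i \<notin> ?K" for i
      unfolding q0_def by (rule dle_sum) (use that in \<open>auto simp: dle_def in_keys_iff\<close>)
    \<comment> \<open>A relation between the four restrictions would hold at points where they take
      arbitrary values.\<close>
    have "q0 = 0"
    proof (rule eval_zero_imp_zero[of ?K])
      fix \<beta> :: "nat \<Rightarrow> complex"
      obtain \<gamma> where \<gamma>: "\<And>k. k \<in> ?K \<Longrightarrow>
        subst_poly (\<lambda>i. Const (\<gamma> i)) (subst_poly (merge T0) (Y k)) = Const (\<beta> k)"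
        using merged_Y_values[of \<beta>] by blast
      have "0 = subst_poly (\<lambda>i. Const (\<gamma> i)) (subst_poly (merge T0) (subst_poly Y q0))"
        unfolding zero by simp
      also have "\<dots> = subst_poly (\<lambda>k. subst_poly (\<lambda>i. Const (\<gamma> i)) (subst_poly (merge T0) (Y k))) q0"
        by (simp only: subst_poly_subst)
      also have "\<dots> = subst_poly (\<lambda>k. Const (\<beta> k)) q0"
      proof (rule subst_poly_cong)
        fix i assume "subst_poly (\<lambda>i. Const (\<gamma> i)) (subst_poly (merge T0) (Y i)) \<noteq> Const (\<beta> i)"
        then show "dle i q0 0" using \<gamma>[of i] keys_q0[of i] by blast
      qed
      finally show "subst_poly (\<lambda>k. Const (\<beta> k)) q0 = 0" by simp
    qed (use keys_q0 in simp_all)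
    then show "f \<in> ?I" using rest unfolding f' by simp
  qed
qed

section \<open>The action of the symmetric group\<close>

lemma perm_act_hom:
  "perm_act \<sigma> (p + q) = perm_act \<sigma> p + perm_act \<sigma> q" "perm_act \<sigma> (p * q) = perm_act \<sigma> p * perm_act \<sigma> q"
  "perm_act \<sigma> 0 = 0" "perm_act \<sigma> (Const c) = Const c" "perm_act \<sigma> (sum g A) = (\<Sum>a\<in>A. perm_act \<sigma> (g a))"
  by (simp_all add: perm_act_def subst_poly_hom)

lemma perm_act_monom: "perm_act \<sigma> (monom_eval f m) = monom_eval (\<lambda>k. perm_act \<sigma> (f k)) m"
  by (simp add: perm_act_def monom_eval_def subst_poly_hom)

lemma perm_act_inverse:
  assumes "\<sigma> permutes {1..8}"
  shows "perm_act (inv_into UNIV \<sigma>) (perm_act \<sigma> p) = p" "perm_act \<sigma> (perm_act (inv_into UNIV \<sigma>) p) = p"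
  unfolding perm_act_def subst_poly_subst
  by (simp_all add: permutes_inverses[OF assms] subst_poly_Var_id)

lemma perm_act_edge_prod: "perm_act \<sigma> (edge_prod es) = edge_prod (map (map_prod \<sigma> \<sigma>) es)"
  by (induction es) (auto simp: perm_act_def subst_poly_hom)

lemma perfect_map:
  assumes "\<sigma> permutes {1..8}" "perfect es"
  shows "perfect (map (map_prod \<sigma> \<sigma>) es)"
proof -
  have "set [1..<9] = {1..8::nat}" by auto
  then have ms: "mset [1..<9] = mset_set {1..8::nat}" by (metis distinct_upt mset_set_set)
  have "mset (map fst (map (map_prod \<sigma> \<sigma>) es) @ map snd (map (map_prod \<sigma> \<sigma>) es)) =
      image_mset \<sigma> (mset (map fst es @ map snd es))"
    by (simp add: image_mset.compositionality o_def)
  also have "\<dots> = image_mset \<sigma> (mset_set {1..8})" using assms(2) unfolding perfect_def ms by simp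
  also have "\<dots> = mset_set (\<sigma> ` {1..8})" by (rule image_mset_mset_set) (rule permutes_inj_on[OF assms(1)])
  also have "\<dots> = mset [1..<9]" unfolding permutes_image[OF assms(1)] ms ..
  finally show ?thesis unfolding perfect_def .
qed

lemma perm_act_Y:
  assumes "\<sigma> permutes {1..8}" "k \<in> {1..14}"
  shows "perm_act \<sigma> (Y k) \<in> linear_forms"
proof -
  obtain es where "perfect es" "Y k = edge_prod es" using Y_perfect[OF assms(2)] by blast
  then show ?thesis by (simp only: perm_act_edge_prod perfect_edge_prod perfect_map[OF assms(1)])
qed

lemma perm_act_specht_ring:
  assumes "\<sigma> permutes {1..8}" "f \<in> carrier specht_ring"
  shows "perm_act \<sigma> f \<in> carrier specht_ring"
proof -
  obtain q where q: "f = (\<Sum>m\<in>Poly_Mapping.keys q. Const (Poly_Mapping.lookup q m) * monom_eval Y m)"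
    "\<And>m. m \<in> Poly_Mapping.keys q \<Longrightarrow> Poly_Mapping.keys m \<subseteq> {1..14}"
    using specht_ring_repr[OF assms(2)] by blast
  show ?thesis
    unfolding q(1) perm_act_hom perm_act_monom
    using q(2) by (intro specht_ring_sum specht_ring_mult specht_ring_Const specht_ring_monom
      linear_forms_specht_ring perm_act_Y assms(1)) blast
qed

text \<open>A permutation of 1 to 8 fixes the index 0 and with it the fresh variable, so merging
  \<open>T\<close> and then permuting equals permuting and then merging the image of
  \<open>T\<close>.\<close>

lemma perm_act_merge_ideal_subset:
  assumes "\<sigma> permutes {1..8}"
  shows "perm_act \<sigma> ` merge_ideal T \<subseteq> merge_ideal (\<sigma> ` T)"
proof (rule image_subsetI)
  fix f assume f: "f \<in> merge_ideal T"
  have "\<sigma> 0 = 0" using assms by (simp add: permutes_def)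
  then have "merge (\<sigma> ` T) (\<sigma> i) = perm_act \<sigma> (merge T i)" for i
    using inj_image_mem_iff[OF permutes_inj[OF assms], of i T] by (simp add: merge_def perm_act_def)
  then have "subst_poly (merge (\<sigma> ` T)) (perm_act \<sigma> f) = perm_act \<sigma> (subst_poly (merge T) f)"
    by (simp add: perm_act_def subst_poly_subst)
  then show "perm_act \<sigma> f \<in> merge_ideal (\<sigma> ` T)"
    using f perm_act_specht_ring[OF assms] by (simp add: merge_ideal_def perm_act_hom)
qed

lemma perm_act_merge_ideal:
  assumes "\<sigma> permutes {1..8}"
  shows "perm_act \<sigma> ` merge_ideal T = merge_ideal (\<sigma> ` T)"
proof
  show "perm_act \<sigma> ` merge_ideal T \<subseteq> merge_ideal (\<sigma> ` T)" by (rule perm_act_merge_ideal_subset[OF assms])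
  have "inv_into UNIV \<sigma> ` \<sigma> ` T = T" by (simp add: image_image permutes_inverses[OF assms])
  then have "perm_act (inv_into UNIV \<sigma>) ` merge_ideal (\<sigma> ` T) \<subseteq> merge_ideal T"
    using perm_act_merge_ideal_subset[OF permutes_inv[OF assms], of "\<sigma> ` T"] by simp
  then show "merge_ideal (\<sigma> ` T) \<subseteq> perm_act \<sigma> ` merge_ideal T"
    by (metis image_subset_iff perm_act_inverse(2)[OF assms] rev_image_eqI subsetI)
qed

text \<open>The preimage of an ideal under the action is an ideal, which gives one inclusion for
  every permutation; applied to the inverse permutation it gives the other.\<close>

lemma perm_act_Idl:
  assumes \<sigma>: "\<sigma> permutes {1..8}" and L: "L \<subseteq> carrier specht_ring"
  shows "perm_act \<sigma> ` (Idl\<^bsub>specht_ring\<^esub> L) = Idl\<^bsub>specht_ring\<^esub> (perm_act \<sigma> ` L)"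
proof -
  have sub: "perm_act \<tau> ` (Idl\<^bsub>specht_ring\<^esub> M) \<subseteq> Idl\<^bsub>specht_ring\<^esub> (perm_act \<tau> ` M)"
    if \<tau>: "\<tau> permutes {1..8}" and M: "M \<subseteq> carrier specht_ring" for \<tau> M
  proof -
    have \<tau>M: "perm_act \<tau> ` M \<subseteq> carrier specht_ring" using M perm_act_specht_ring[OF \<tau>] by blast
    note Idl = Idl_specht_ring[OF \<tau>M]
    let ?J = "{f \<in> carrier specht_ring. perm_act \<tau> f \<in> Idl\<^bsub>specht_ring\<^esub> (perm_act \<tau> ` M)}"
    have "ideal ?J specht_ring"
      by (rule specht_ring_idealI)
        (auto simp: perm_act_hom specht_ring_0 specht_ring_add specht_ring_mult perm_act_specht_ring[OF \<tau>]
          specht_ring_idealD[OF Idl(1)])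
    moreover have "M \<subseteq> ?J" using M Idl(2) by blast
    ultimately have "Idl\<^bsub>specht_ring\<^esub> M \<subseteq> ?J" by (rule Idl_specht_ring(3)[OF M])
    then show ?thesis by blast
  qed
  have \<sigma>L: "perm_act \<sigma> ` L \<subseteq> carrier specht_ring" using L perm_act_specht_ring[OF \<sigma>] by blast
  have "perm_act (inv_into UNIV \<sigma>) ` (Idl\<^bsub>specht_ring\<^esub> (perm_act \<sigma> ` L)) \<subseteq> Idl\<^bsub>specht_ring\<^esub> L"
    using sub[OF permutes_inv[OF \<sigma>] \<sigma>L] by (simp add: image_image perm_act_inverse[OF \<sigma>])
  then have "Idl\<^bsub>specht_ring\<^esub> (perm_act \<sigma> ` L) \<subseteq> perm_act \<sigma> ` (Idl\<^bsub>specht_ring\<^esub> L)"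
    by (metis image_subset_iff perm_act_inverse(2)[OF \<sigma>] rev_image_eqI subsetI)
  then show ?thesis using sub[OF \<sigma> L] by blast
qed

lemma triple_transitive:
  assumes "T \<in> triples"
  shows "\<exists>\<sigma>. \<sigma> permutes {1..8} \<and> \<sigma> ` T0 = T"
proof -
  have fin: "finite T" and sub: "T \<subseteq> {1..8}" and card: "card T = card T0"
    using assms finite_subset[of T "{1..8}"] by (auto simp: triples_def)
  obtain f where f: "bij_betw f T0 T"
    using finite_same_card_bij[of T0 T] fin card by auto
  have "card ({1..8} - T0) = card ({1..8} - T)"
    using sub card fin by (subst (1 2) card_Diff_subset) auto
  then obtain g where g: "bij_betw g ({1..8} - T0) ({1..8} - T)"
    using finite_same_card_bij[of "{1..8} - T0" "{1..8} - T"] by auto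
  let ?h = "\<lambda>x. if x \<in> T0 then f x else g x"
  have "bij_betw ?h (T0 \<union> ({1..8} - T0)) (T \<union> ({1..8} - T))"
  proof (rule bij_betw_combine)
    show "bij_betw ?h T0 T" using f by (subst bij_betw_cong[of T0 ?h f]) simp_all
    show "bij_betw ?h ({1..8} - T0) ({1..8} - T)" using g by (subst bij_betw_cong[of "{1..8} - T0" ?h g]) simp_all
  qed simp
  moreover have "T0 \<union> ({1..8} - T0) = {1..8}" "T \<union> ({1..8} - T) = {1..8}" using sub by auto
  ultimately have bij: "bij_betw ?h {1..8} {1..8}" by (simp only:)
  let ?\<sigma> = "\<lambda>x. if x \<in> {1..8} then ?h x else x"
  have "?\<sigma> permutes {1..8}"
  proof (rule bij_imp_permutes)
    show "bij_betw ?\<sigma> {1..8} {1..8}" using bij by (subst bij_betw_cong[of "{1..8}" ?\<sigma> ?h]) simp_all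
  qed (rule if_not_P)
  moreover have "?\<sigma> ` T0 = f ` T0" by (rule image_cong) auto
  then have "?\<sigma> ` T0 = T" using f by (simp only: bij_betw_imp_surj_on)
  ultimately show ?thesis by blast
qed

section \<open>The ideals of different triples are different\<close>

lemma merge_edge_prod_eq_0_iff:
  assumes "edges es" "T \<subseteq> {1..8}"
  shows "subst_poly (merge T) (edge_prod es) = 0 \<longleftrightarrow> (\<exists>(i, j)\<in>set es. i \<in> T \<and> j \<in> T)"
  using assms(1)
proof (induction es)
  case (Cons e es)
  obtain i j where e: "e = (i, j)" by fastforce
  have ij: "i \<in> {1..8}" "j \<in> {1..8}" "i \<noteq> j" using Cons.prems unfolding e by auto
  have "subst_poly (merge T) (Var i - Var j) = 0 \<longleftrightarrow> i \<in> T \<and> j \<in> T"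
    using ij assms(2) by (auto simp: merge_def subst_poly_hom Var_inject)
  then show ?case using Cons unfolding e by (simp add: subst_poly_mult)
qed simp

lemma perfectI:
  assumes "distinct (map fst es @ map snd es)" "set (map fst es @ map snd es) = {1..8}"
  shows "perfect es"
proof -
  have "set (map fst es @ map snd es) = set [1..<9]" unfolding assms(2) by auto
  then show ?thesis
    unfolding perfect_def using set_eq_iff_mset_eq_distinct[OF assms(1) distinct_upt] by blast
qed

text \<open>A perfect matching with an edge inside \<open>T\<close> and none inside
  \<open>T'\<close> separates the two ideals. The edge joins some \<open>i\<close> in
  \<open>T\<close> outside \<open>T'\<close> to another point \<open>j\<close> of \<open>T\<close>;
  the points of \<open>T'\<close> other than \<open>j\<close> are joined to points outside
  \<open>T'\<close>.\<close>

lemma merge_ideal_inj: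
  assumes "T \<in> triples" "T' \<in> triples" "merge_ideal T = merge_ideal T'"
  shows "T = T'"
proof (rule ccontr)
  assume "T \<noteq> T'"
  have T: "T \<subseteq> {1..8}" "card T = 3" and T': "T' \<subseteq> {1..8}" "card T' = 3"
    using assms by (auto simp: triples_def)
  have fin: "finite T" "finite T'" using T T' finite_subset by blast+
  have "\<not> T \<subseteq> T'" using \<open>T \<noteq> T'\<close> card_subset_eq[OF fin(2)] T T' by auto
  then obtain i where i: "i \<in> T" "i \<notin> T'" by blast
  have "card (T - {i}) = 2" using i T fin by simp
  then have "T - {i} \<noteq> {}" by (metis card.empty zero_neq_numeral)
  then obtain j where j: "j \<in> T" "j \<noteq> i" by blast
  have ij: "i \<in> {1..8}" "j \<in> {1..8}" using i j T by blast+
  have "\<exists>es. perfect es \<and> (i, j) \<in> set es \<and> (\<forall>(a, b)\<in>set es. \<not> (a \<in> T' \<and> b \<in> T'))"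
  proof (cases "j \<in> T'")
    case True
    then have "card (T' - {j}) = 2" using T' fin by simp
    then obtain p q where pq: "T' - {j} = {p, q}" "p \<noteq> q" unfolding card_2_iff by blast
    then have T'eq: "T' = {j, p, q}" using True by blast
    have "p \<in> T' - {j}" "q \<in> T' - {j}" unfolding pq(1) by simp_all
    then have d: "p \<noteq> j" "q \<noteq> j" "p \<noteq> i" "q \<noteq> i" using i by auto
    then obtain xs where xs: "distinct ([i, j, p, q] @ xs)" "set ([i, j, p, q] @ xs) = {1..8}" "length xs = 4"
      using complement_list[of "[i, j, p, q]"] pq(2) j(2) ij T' T'eq by auto
    then obtain a b c e where "xs = [a, b, c, e]" by (auto simp: numeral_eq_Suc length_Suc_conv)
    then have *: "distinct [i, j, p, q, a, b, c, e]" "set [i, j, p, q, a, b, c, e] = {1..8}" using xs by simp_all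
    let ?es = "[(i, j), (a, p), (b, q), (c, e)]"
    have "perfect ?es"
    proof (rule perfectI)
      show "distinct (map fst ?es @ map snd ?es)" using *(1) by auto
      have "set (map fst ?es @ map snd ?es) = set [i, j, p, q, a, b, c, e]" by auto
      then show "set (map fst ?es @ map snd ?es) = {1..8}" using *(2) by (simp only:)
    qed
    moreover have "\<forall>(a, b)\<in>set ?es. \<not> (a \<in> T' \<and> b \<in> T')" using *(1) unfolding T'eq by auto
    ultimately show ?thesis by (intro exI[of _ ?es]) simp
  next
    case False
    obtain p q r where T'eq: "T' = {p, q, r}" and d: "p \<noteq> q" "q \<noteq> r" "p \<noteq> r"
      using T'(2) unfolding card_3_iff by blast
    have "i \<notin> {p, q, r}" "j \<notin> {p, q, r}" using i False unfolding T'eq by blast+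
    then obtain xs where xs: "distinct ([i, j, p, q, r] @ xs)" "set ([i, j, p, q, r] @ xs) = {1..8}" "length xs = 3"
      using complement_list[of "[i, j, p, q, r]"] d j(2) ij T' T'eq by auto
    then obtain a b c where "xs = [a, b, c]" by (auto simp: numeral_eq_Suc length_Suc_conv)
    then have *: "distinct [i, j, p, q, r, a, b, c]" "set [i, j, p, q, r, a, b, c] = {1..8}" using xs by simp_all
    let ?es = "[(i, j), (a, p), (b, q), (c, r)]"
    have "perfect ?es"
    proof (rule perfectI)
      show "distinct (map fst ?es @ map snd ?es)" using *(1) by auto
      have "set (map fst ?es @ map snd ?es) = set [i, j, p, q, r, a, b, c]" by auto
      then show "set (map fst ?es @ map snd ?es) = {1..8}" using *(2) by (simp only:)
    qed
    moreover have "\<forall>(a, b)\<in>set ?es. \<not> (a \<in> T' \<and> b \<in> T')" using *(1) unfolding T'eq by auto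
    ultimately show ?thesis by (intro exI[of _ ?es]) simp
  qed
  then obtain es where es: "perfect es" "(i, j) \<in> set es" "\<forall>(a, b)\<in>set es. \<not> (a \<in> T' \<and> b \<in> T')" by blast
  note e = perfect_edges[OF es(1)]
  have R: "edge_prod es \<in> carrier specht_ring" by (intro linear_forms_specht_ring perfect_edge_prod es(1))
  have "subst_poly (merge T) (edge_prod es) = 0"
    using merge_edge_prod_eq_0_iff[OF e T(1)] i(1) j(1) es(2) by blast
  moreover have "subst_poly (merge T') (edge_prod es) \<noteq> 0"
    using merge_edge_prod_eq_0_iff[OF e T'(1)] es(3) by blast
  ultimately show False using assms(3) R unfolding merge_ideal_def by blast
qed

lemma card_triples: "card triples = 56"
proof -
  have "card triples = 8 choose 3" unfolding triples_def using n_subsets[of "{1..8::nat}" 3] by simp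
  also have "\<dots> = 56" by code_simp
  finally show ?thesis .
qed

theorem mainTheorem4:
  shows "let I = Idl\<^bsub>specht_ring\<^esub> {D S | S. S \<subseteq> {1..8} \<and> card S = 4};
             P\<^sub>0 = Idl\<^bsub>specht_ring\<^esub> {Y 2, Y 3, Y 5, Y 6, Y 8, Y 9, Y 10, Y 11, Y 13, Y 14};
             \<P> = {perm_act \<sigma> ` P\<^sub>0 | \<sigma>. \<sigma> permutes {1..8}}
         in card \<P> = 56 \<and> P\<^sub>0 \<in> \<P> \<and>
            (\<forall>P\<in>\<P>. \<exists>L. L \<subseteq> linear_forms \<and> P = Idl\<^bsub>specht_ring\<^esub> L) \<and>
            I = \<Inter>\<P>"
proof -
  define P0 where "P0 = Idl\<^bsub>specht_ring\<^esub> {Y 2, Y 3, Y 5, Y 6, Y 8, Y 9, Y 10, Y 11, Y 13, Y 14}"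
  define \<P> where "\<P> = {perm_act \<sigma> ` P0 | \<sigma>. \<sigma> permutes {1..8}}"
  have gens: "Y ` N0 = {Y 2, Y 3, Y 5, Y 6, Y 8, Y 9, Y 10, Y 11, Y 13, Y 14}" by simp
  have P0: "P0 = merge_ideal T0" unfolding P0_def merge_ideal_generated gens ..
  have T0: "\<sigma> ` T0 \<in> triples" if \<sigma>: "\<sigma> permutes {1..8}" for \<sigma>
  proof -
    have "card (\<sigma> ` T0) = 3" using card_image[OF permutes_inj_on[OF \<sigma>, of T0]] by simp
    moreover have "\<sigma> ` T0 \<subseteq> \<sigma> ` {1..8}" by (rule image_mono) simp
    ultimately show ?thesis unfolding triples_def permutes_image[OF \<sigma>] by simp
  qed
  \<comment> \<open>The permutations act transitively on triples, so the orbit of \<open>P0\<close>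
    is indexed by triples; both the count and the intersection follow from this.\<close>
  have orbit: "\<P> = merge_ideal ` triples"
  proof (intro subset_antisym subsetI)
    fix P assume "P \<in> \<P>"
    then obtain \<sigma> where \<sigma>: "\<sigma> permutes {1..8}" "P = perm_act \<sigma> ` P0" unfolding \<P>_def by blast
    show "P \<in> merge_ideal ` triples"
      unfolding \<sigma>(2) P0 perm_act_merge_ideal[OF \<sigma>(1)] by (rule imageI) (rule T0[OF \<sigma>(1)])
  next
    fix P assume "P \<in> merge_ideal ` triples"
    then obtain T where T: "T \<in> triples" "P = merge_ideal T" by blast
    obtain \<sigma> where \<sigma>: "\<sigma> permutes {1..8}" "\<sigma> ` T0 = T" using triple_transitive[OF T(1)] by blast
    have "P = perm_act \<sigma> ` P0" unfolding T(2) P0 perm_act_merge_ideal[OF \<sigma>(1)] \<sigma>(2) ..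
    then show "P \<in> \<P>" unfolding \<P>_def using \<sigma>(1) by blast
  qed
  have "card \<P> = 56"
    unfolding orbit card_triples[symmetric] by (rule card_image, rule inj_onI) (rule merge_ideal_inj)
  moreover have "P0 \<in> \<P>"
    unfolding orbit P0 using T0[OF permutes_id] by (simp only: image_id imageI id_apply)
  moreover have "\<exists>L. L \<subseteq> linear_forms \<and> P = Idl\<^bsub>specht_ring\<^esub> L" if P: "P \<in> \<P>" for P
  proof -
    obtain \<sigma> where \<sigma>: "\<sigma> permutes {1..8}" "P = perm_act \<sigma> ` P0" using P unfolding \<P>_def by blast
    have "P = Idl\<^bsub>specht_ring\<^esub> (perm_act \<sigma> ` Y ` N0)"
      unfolding \<sigma>(2) P0 merge_ideal_generated by (rule perm_act_Idl[OF \<sigma>(1) Y_image_subset])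
    moreover have "perm_act \<sigma> ` Y ` N0 \<subseteq> linear_forms"
      by (intro image_subsetI, elim imageE) (auto intro: perm_act_Y[OF \<sigma>(1)])
    ultimately show ?thesis by blast
  qed
  moreover have "{D S | S. S \<subseteq> {1..8} \<and> card S = 4} = D ` quads" unfolding quads_def by blast
  then have "Idl\<^bsub>specht_ring\<^esub> {D S | S. S \<subseteq> {1..8} \<and> card S = 4} = \<Inter>\<P>"
    unfolding orbit by (simp only: D_ideal_eq_Inter)
  ultimately show ?thesis
    unfolding Let_def P0_def[symmetric] \<P>_def[symmetric] by blast
qed

end
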